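(* Let $t\ge 2$ be a fixed integer. For every $\varepsilon>0$ there is $m_0$ such that for every $m\ge m_0$, every $m$-edge graph $G$ with $\lambda(G)>\lambda(S_{t-1,m})$ satisfies $$\#K_{t,t}(G)\ \ge\ \Big(\frac{2^{-(t-1)^2}}{(t!)^2}-\varepsilon\Big)m^t .$$ The constant $\frac{2^{-(t-1)^2}}{(t!)^2}$ is best possible, as witnessed by $m$-edge random graphs on $(2+o(1))\sqrt m$ vertices: there is a function $n=n(m)=(2+o(1))\sqrt m$ (as $m\to\infty$) such that, for every $\varepsilon>0$, a uniformly random graph $G$ with vertex set $\{1,\dots,n\}$ and exactly $m$ edges satisfies, with probability tending to $1$ as $m\to\infty$, both $\lambda(G)>\lambda(S_{t-1,m})$ and $\#K_{t,t}(G)\le \big(\frac{2^{-(t-1)^2}}{(t!)^2}+\varepsilon\big)m^t$.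
   Context: All graphs are finite and simple. $\lambda(G)$ is the spectral radius of the adjacency matrix of $G$. $\#H(G)$ is the number of unlabelled copies of $H$ in $G$, i.e. the number of injective homomorphisms $H\to G$ divided by $|\mathrm{Aut}(H)|$. Split graph $S_{k,m}$: for integers $k\ge1$ and $m\ge\binom k2$, write $m-\binom k2=kq+r$ with $q\ge0$ and $0\le r\le k-1$; $S_{k,m}$ is the $m$-edge graph obtained by joining a clique $K_k$ to an independent set of size $q$ (adding all edges between them), and adding one further vertex adjacent to exactly $r$ vertices of the clique. *)

theory Defs
  imports
    "Jordan_Normal_Form.Spectral_Radius"
    "HOL-Probability.Probability_Mass_Function"
begin

datatype 'a graph = Graph (verts: "'a set") (edges: "'a set set")

definition simple_graph :: "'a graph \<Rightarrow> bool" where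
  "simple_graph G \<longleftrightarrow>
     finite (verts G) \<and> (\<forall>e \<in> edges G. e \<subseteq> verts G \<and> card e = 2)"

text \<open>Rows and columns are indexed by the vertices in increasing order.\<close>

definition adj_matrix :: "'a::linorder graph \<Rightarrow> complex mat" where
  "adj_matrix G =
     (let vs = sorted_list_of_set (verts G); n = card (verts G)
      in Matrix.mat n n (\<lambda>(i, j). if {vs ! i, vs ! j} \<in> edges G then 1 else 0))"

definition graph_radius :: "'a::linorder graph \<Rightarrow> real" where
  "graph_radius G = spectral_radius (adj_matrix G)"

text \<open>Maps are taken extensional on the vertex set of the source, so that the
  sets below are finite and count functions on that vertex set.\<close>

definition inj_homs :: "'a graph \<Rightarrow> 'b graph \<Rightarrow> ('a \<Rightarrow> 'b) set" where
  "inj_homs H G =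
     {f \<in> verts H \<rightarrow>\<^sub>E verts G. inj_on f (verts H) \<and>
        (\<forall>u \<in> verts H. \<forall>v \<in> verts H. {u, v} \<in> edges H \<longrightarrow> {f u, f v} \<in> edges G)}"

definition automorphisms :: "'a graph \<Rightarrow> ('a \<Rightarrow> 'a) set" where
  "automorphisms H =
     {f \<in> verts H \<rightarrow>\<^sub>E verts H. bij_betw f (verts H) (verts H) \<and>
        (\<forall>u \<in> verts H. \<forall>v \<in> verts H. {u, v} \<in> edges H \<longleftrightarrow> {f u, f v} \<in> edges H)}"

definition num_copies :: "'a graph \<Rightarrow> 'b graph \<Rightarrow> real" where
  "num_copies H G = real (card (inj_homs H G)) / real (card (automorphisms H))"

definition complete_bipartite :: "nat \<Rightarrow> nat \<Rightarrow> nat graph" where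
  "complete_bipartite s t =
     Graph {..<s + t} {{i, j} | i j. i < s \<and> s \<le> j \<and> j < s + t}"

text \<open>The clique is on \<open>{..<k}\<close>, the independent set on \<open>{k..<k + q}\<close>, and the further
  vertex is \<open>k + q\<close>; it is isolated when \<open>r = 0\<close>. Only meaningful for \<open>k \<ge> 1\<close> and
  \<open>m \<ge> k choose 2\<close>.\<close>

definition split_graph :: "nat \<Rightarrow> nat \<Rightarrow> nat graph" where
  "split_graph k m =
     (let q = (m - (k choose 2)) div k; r = (m - (k choose 2)) mod k
      in Graph {..k + q}
           ({{i, j} | i j. i < j \<and> j < k} \<union>
            {{i, j} | i j. i < k \<and> k \<le> j \<and> j < k + q} \<union>
            {{i, k + q} | i. i < r}))"

definition gnm :: "nat \<Rightarrow> nat \<Rightarrow> nat graph set" where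
  "gnm n m = {G. simple_graph G \<and> verts G = {1..n} \<and> card (edges G) = m}"

text \<open>The uniform distribution on the set above; unspecified if \<open>m > n choose 2\<close>, when
  that set is empty.\<close>

definition uniform_graph :: "nat \<Rightarrow> nat \<Rightarrow> nat graph pmf" where
  "uniform_graph n m = pmf_of_set (gnm n m)"

lemma card_edges_split_graph:
  assumes "k \<ge> 1" "m \<ge> k choose 2"
  shows "card (edges (split_graph k m)) = m"
proof -
  define q r where "q = (m - (k choose 2)) div k" and "r = (m - (k choose 2)) mod k"
  have r: "r < k" using assms by (simp add: r_def)
  let ?A = "{{i, j} | i j. i < j \<and> j < k}"
  let ?B = "{{i, j} | i j. i < k \<and> k \<le> j \<and> j < k + q}"
  let ?C = "{{i, k + q} | i. i < r}"
  have A: "?A = {e. e \<subseteq> {..<k} \<and> card e = 2}"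
  proof (intro equalityI subsetI)
    fix e assume "e \<in> {e. e \<subseteq> {..<k} \<and> card e = 2}"
    then obtain x y where e: "e = {x, y}" "x \<noteq> y" "x < k" "y < k"
      by (auto simp: card_2_iff)
    show "e \<in> ?A"
    proof (cases "x < y")
      case True
      then show ?thesis using e by blast
    next
      case False
      then have "y < x" "e = {y, x}" using e by auto
      then show ?thesis using e by blast
    qed
  qed (auto simp: card_2_iff)
  have cA: "card ?A = k choose 2" "finite ?A"
    unfolding A using n_subsets[of "{..<k}" 2] by (auto)
  have B: "?B = (\<lambda>(i, j). {i, j}) ` ({..<k} \<times> {k..<k + q})"
    by (auto; metis)
  have "inj_on (\<lambda>(i, j). {i, j}) ({..<k} \<times> {k..<k + q})"
    by (auto simp: inj_on_def doubleton_eq_iff)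
  then have cB: "card ?B = k * q" "finite ?B"
    unfolding B by (simp_all add: card_image)
  have C: "?C = (\<lambda>i. {i, k + q}) ` {..<r}" by auto
  have "inj_on (\<lambda>i. {i, k + q}) {..<r}"
    by (auto simp: inj_on_def doubleton_eq_iff)
  then have cC: "card ?C = r" "finite ?C"
    unfolding C by (simp_all add: card_image)
  have "?A \<inter> ?B = {}" "(?A \<union> ?B) \<inter> ?C = {}"
    using r by (auto simp: doubleton_eq_iff)
  then have "card (?A \<union> ?B \<union> ?C) = (k choose 2) + k * q + r"
    using cA cB cC by (simp add: card_Un_disjoint)
  also have "\<dots> = m" using assms(2) unfolding q_def r_def by simp
  finally show ?thesis unfolding split_graph_def Let_def q_def r_def by simp
qed

lemma simple_split_graph:
  assumes "k \<ge> 1"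
  shows "simple_graph (split_graph k m)"
proof -
  have "(m - (k choose 2)) mod k < k" using assms by simp
  then show ?thesis
    unfolding simple_graph_def split_graph_def Let_def
    by (auto simp: card_insert_if)
qed

end

theory Submission imports Defs begin

text \<open>
  Let \<open>x\<close> be the Perron vector of \<open>G\<close>, let \<open>L\<close> be the boundedly many vertices of linear degree
  and \<open>R\<close> the vertices of much smaller degree; by pigeonhole the degree thresholds can be chosen
  such that the vertices in between carry almost no mass of \<open>x\<close>. The part of \<open>x\<close> on \<open>R\<close> coming from
  \<open>L\<close> is nearly orthogonal to the rest under the adjacency form. So either the rest shows that
  \<open>G[R]\<close> has spectral radius about \<open>sqrt m\<close>, or all of \<open>x\<close> comes from the bipartite graph between
  \<open>L\<close> and \<open>R\<close>.

  In the first case Hoelder's inequality gives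
  \<open>\<rho> ^ (2 t (t - 1)) \<le> hom(K_{t,t}) (2 m) ^ (t (t - 2))\<close>, and the homomorphisms that are not injective
  are negligible because all degrees are \<open>o(m)\<close>. In the second case \<open>G\<close> is close to a complete
  bipartite graph \<open>K_{a, m/a}\<close>. If \<open>a \<ge> t\<close>, this already contains enough copies. If
  \<open>a \<le> t - 1\<close>, a perturbation argument shows that \<open>G\<close> cannot have larger spectral radius than the
  split graph.

  For the random graph the spectral radius exceeds the average degree, and only the expected number
  of copies is needed: as the number of copies is bounded below by the first part, Markov's inequality
  yields concentration.
\<close>

section \<open>Quadratic forms and the spectral radius\<close>

text \<open>The constant comes from the dense case: with \<rho>^2 about m, Hoelder gives
  hom(K_{t,t}) >= m^t / 2^(t(t-2)) up to lower order, t(t-2) = (t-1)^2 - 1, and K_{t,t} has 2 (t!)^2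
  automorphisms. For K_{a,m/a} with a >= t the relevant factor a(a-1)...(a-t+1)/a^t is at least
  2^-(t-1)^2, with equality for t = a = 2. Nothing may be lost there, so approximate statements
  about neighbourhoods of bounded size are made exact by integrality.

  Lowering the degree threshold enlarges L: its size is only bounded by 2m over the threshold, and
  the orthogonality error is about sqrt(|L| \<Delta> m) with \<Delta> the largest degree in R. A
  single threshold therefore does not suffice; \<Delta> has to be smaller than the threshold of L by
  a fixed factor, and the window between them must be discarded.

  Against the split graph the hypothesis is an exact inequality, while near-extremal graphs differ
  from it by bounded amounts in \<rho>^2. The comparison has to be resolved down to constants, where
  the integrality of the costs decides.\<close>

definition bform :: "('a \<Rightarrow> 'a \<Rightarrow> real) \<Rightarrow> 'a set \<Rightarrow> 'a set \<Rightarrow> ('a \<Rightarrow> real) \<Rightarrow> ('a \<Rightarrow> real) \<Rightarrow> real" where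
  "bform a X Y x y = (\<Sum>u\<in>X. \<Sum>v\<in>Y. a u v * x u * y v)"

lemma bform_add_left: "bform a X Y (\<lambda>u. x u + x' u) y = bform a X Y x y + bform a X Y x' y"
  by (simp add: bform_def sum.distrib algebra_simps)

lemma bform_add_right: "bform a X Y x (\<lambda>u. y u + y' u) = bform a X Y x y + bform a X Y x y'"
  by (simp add: bform_def sum.distrib algebra_simps)

lemma bform_scale_left: "bform a X Y (\<lambda>u. c * x u) y = c * bform a X Y x y"
  by (simp add: bform_def sum_distrib_left algebra_simps)

lemma bform_scale_right: "bform a X Y x (\<lambda>u. c * y u) = c * bform a X Y x y"
  by (simp add: bform_def sum_distrib_left algebra_simps)

lemma bform_commute:
  assumes "\<And>u v. a u v = a v u"
  shows "bform a X Y x y = bform a Y X y x"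
  unfolding bform_def by (subst sum.swap) (simp add: assms mult_ac)

lemma bform_eq_left: "bform a X Y x y = (\<Sum>u\<in>X. x u * (\<Sum>v\<in>Y. a u v * y v))"
  by (simp add: bform_def sum_distrib_left mult_ac)

text \<open>First-order optimality: near a maximiser the linear gain must be dominated by the
  quadratic term for both signs of \<open>h\<close>. A step proportional to \<open>c\<close> already
  contradicts \<open>c \<noteq> 0\<close>; the 1 in \<open>D\<close> keeps its denominator
  positive.\<close>

lemma linear_coeff_zero:
  fixes c d :: real
  assumes "\<And>h. 2 * h * c \<le> h\<^sup>2 * d"
  shows "c = 0"
proof (rule ccontr)
  assume c: "c \<noteq> 0"
  define D where "D = \<bar>d\<bar> + 1"
  have D: "D > 0" "d \<le> D" by (auto simp: D_def)
  have "2 * (c / D) * c \<le> (c / D)\<^sup>2 * d" by (rule assms)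
  also have "\<dots> \<le> (c / D)\<^sup>2 * D" using D by (intro mult_left_mono) auto
  also have "\<dots> = (c / D) * c" using D by (simp add: power2_eq_square)
  finally have "c\<^sup>2 / D \<le> 0" by (simp add: power2_eq_square)
  then show False using c D by (simp add: divide_le_0_iff)
qed

text \<open>Perron vector by maximising the Rayleigh quotient over the unit sphere. Connectedness is
  not assumed, so \<open>x\<close> is nonnegative but may have zeros. The last conclusion is what
  later test vectors exploit.\<close>

lemma max_eigenvector:
  fixes a :: "'a \<Rightarrow> 'a \<Rightarrow> real"
  assumes fin: "finite V" and ne: "V \<noteq> {}" and sym: "\<And>u v. a u v = a v u"
    and nonneg: "\<And>u v. 0 \<le> a u v"
  obtains x \<mu> where "\<And>v. 0 \<le> x v" "(\<Sum>v\<in>V. (x v)\<^sup>2) = 1"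
    "\<And>v. v \<in> V \<Longrightarrow> (\<Sum>u\<in>V. a v u * x u) = \<mu> * x v"
    "\<And>y. bform a V V y y \<le> \<mu> * (\<Sum>v\<in>V. (y v)\<^sup>2)"
proof -
  \<comment> \<open>Functions are total on the type, so coordinates outside \<open>V\<close> are
    pinned to 0. The product of the compact factors is compact by Tychonoff, and every unit vector
    can be moved into it without changing the form.\<close>
  define K where "K = (PiE UNIV (\<lambda>v. if v \<in> V then {-1..1::real} else {0}))"
  have "compactin (product_topology (\<lambda>_. euclidean) UNIV) K"
    unfolding K_def compactin_PiE by auto
  then have cK: "compact K" by (simp add: euclidean_product_topology flip: compactin_euclidean_iff)
  define S where "S = {x. (\<Sum>v\<in>V. (x v)\<^sup>2) = (1::real)}"
  have "closed S" unfolding S_def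
    by (intro closed_Collect_eq continuous_intros continuous_on_product_coordinates)
  with cK have cKS: "compact (K \<inter> S)" by (rule compact_Int_closed)
  obtain w where w: "w \<in> V" using ne by auto
  have "(\<lambda>v. if v = w then 1 else 0) \<in> K \<inter> S"
    using w fin by (auto simp: K_def S_def of_bool_def[symmetric] power2_eq_square simp flip: of_bool_conj)
  then have neKS: "K \<inter> S \<noteq> {}" by blast
  have "continuous_on (K \<inter> S) (\<lambda>x. bform a V V x x)"
    unfolding bform_def
    by (intro continuous_intros continuous_on_subset[OF continuous_on_product_coordinates]) auto
  from continuous_attains_sup[OF cKS neKS this]
  obtain x0 where x0: "x0 \<in> K \<inter> S"
    and max: "\<And>y. y \<in> K \<inter> S \<Longrightarrow> bform a V V y y \<le> bform a V V x0 x0" by blast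
  define \<mu> where "\<mu> = bform a V V x0 x0"
  have ray: "bform a V V y y \<le> \<mu> * (\<Sum>v\<in>V. (y v)\<^sup>2)" for y
  proof (cases "(\<Sum>v\<in>V. (y v)\<^sup>2) = 0")
    case True
    then have "\<And>v. v \<in> V \<Longrightarrow> y v = 0" using fin by (simp add: sum_nonneg_eq_0_iff)
    then have "bform a V V y y = 0" by (simp add: bform_def)
    then show ?thesis using True by simp
  next
    case False
    define s where "s = (\<Sum>v\<in>V. (y v)\<^sup>2)"
    have s: "s > 0" using False by (simp add: s_def less_le sum_nonneg)
    define y' where "y' = (\<lambda>v. if v \<in> V then (1 / sqrt s) * y v else 0)"
    have sy': "(\<Sum>v\<in>V. (y' v)\<^sup>2) = 1"
    proof -
      have "(\<Sum>v\<in>V. (y' v)\<^sup>2) = (\<Sum>v\<in>V. (y v)\<^sup>2 / s)"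
        using s by (intro sum.cong) (auto simp: y'_def power_divide)
      also have "\<dots> = 1" using s by (simp add: s_def flip: sum_divide_distrib)
      finally show ?thesis .
    qed
    have "\<bar>y' v\<bar> \<le> 1" if "v \<in> V" for v
    proof -
      have "(y' v)\<^sup>2 \<le> 1" using sy' member_le_sum[of v V "\<lambda>v. (y' v)\<^sup>2"] fin that by auto
      then show ?thesis by (simp add: abs_square_le_1)
    qed
    then have "y' v \<in> (if v \<in> V then {-1..1} else {0})" for v
      by (cases "v \<in> V") (fastforce simp: abs_le_iff, simp add: y'_def)
    then have "y' \<in> K \<inter> S" using sy' unfolding K_def S_def PiE_UNIV_domain by blast
    then have "bform a V V y' y' \<le> \<mu>" using max by (simp add: \<mu>_def)
    also have "bform a V V y' y' = bform a V V (\<lambda>v. (1 / sqrt s) * y v) (\<lambda>v. (1 / sqrt s) * y v)"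
      by (simp add: bform_def y'_def)
    also have "\<dots> = bform a V V y y / s"
      unfolding bform_scale_left bform_scale_right using s by (simp add: field_simps)
    finally show ?thesis using s by (simp add: field_simps s_def)
  qed
  \<comment> \<open>Absolute values keep the norm and, the entries of \<open>a\<close> being
    nonnegative, cannot decrease the form; so \<open>x\<close> is again a maximiser.\<close>
  define x where "x = (\<lambda>v. \<bar>x0 v\<bar>)"
  have sx: "(\<Sum>v\<in>V. (x v)\<^sup>2) = 1" using x0 by (simp add: x_def S_def)
  have "\<mu> \<le> bform a V V x x"
    unfolding \<mu>_def bform_def x_def mult.assoc abs_mult[symmetric]
    by (intro sum_mono mult_left_mono abs_ge_self nonneg)
  then have mx: "bform a V V x x = \<mu>" using ray[of x] sx by simp
  have eig: "(\<Sum>u\<in>V. a v u * x u) = \<mu> * x v" if v: "v \<in> V" for v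
  proof -
    define e where "e = (\<lambda>u. if u = v then 1 else 0 :: real)"
    define Ax where "Ax = (\<Sum>u\<in>V. a v u * x u)"
    have el: "(\<Sum>u\<in>V. e u * g u) = g v" for g
    proof -
      have "(\<Sum>u\<in>V. e u * g u) = (\<Sum>u\<in>V. if u = v then g u else 0)"
        by (intro sum.cong) (auto simp: e_def)
      then show ?thesis using v fin by simp
    qed
    have e1: "bform a V V e x = Ax" unfolding bform_eq_left el Ax_def ..
    have e2: "bform a V V e e = a v v" unfolding bform_eq_left el using el[of "a v"] by (simp add: mult.commute)
    have e3: "bform a V V x e = Ax" using e1 bform_commute[of a V V x e, OF sym] by simp
    \<comment> \<open>The Rayleigh bound at x + h e; the terms free of \<open>h\<close> cancel
      because \<open>x\<close> attains the maximum.\<close>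
    have "2 * h * (Ax - \<mu> * x v) \<le> h\<^sup>2 * (\<mu> - a v v)" for h
    proof -
      have "bform a V V (\<lambda>u. x u + h * e u) (\<lambda>u. x u + h * e u) = \<mu> + 2 * h * Ax + h\<^sup>2 * a v v"
        unfolding bform_add_left bform_add_right bform_scale_left bform_scale_right
        using e1 e2 e3 mx by (simp add: power2_eq_square algebra_simps)
      moreover have "(\<Sum>u\<in>V. (x u + h * e u)\<^sup>2) = 1 + 2 * h * x v + h\<^sup>2"
      proof -
        have "(\<Sum>u\<in>V. (x u + h * e u)\<^sup>2) = (\<Sum>u\<in>V. (x u)\<^sup>2 + (if u = v then 2 * h * x u + h\<^sup>2 else 0))"
          by (intro sum.cong) (auto simp: e_def power2_eq_square algebra_simps)
        then show ?thesis using v fin sx by (simp add: sum.distrib)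
      qed
      ultimately show ?thesis using ray[of "\<lambda>u. x u + h * e u"]
        by (simp add: algebra_simps)
    qed
    then have "Ax - \<mu> * x v = 0" by (rule linear_coeff_zero)
    then show ?thesis by (simp add: Ax_def)
  qed
  show thesis using that[of x \<mu>] sx eig ray by (auto simp: x_def)
qed

section \<open>The adjacency form and the spectral radius of a graph\<close>

definition adj :: "'a graph \<Rightarrow> 'a \<Rightarrow> 'a \<Rightarrow> real" where
  "adj G u v = (if {u, v} \<in> edges G then 1 else 0)"

lemma adj_commute: "adj G u v = adj G v u"
  by (simp add: adj_def insert_commute)

lemma adj_nonneg [simp]: "0 \<le> adj G u v"
  by (simp add: adj_def)

lemma adj_le_1 [simp]: "adj G u v \<le> 1"
  by (simp add: adj_def)

lemma adj_self [simp]: "simple_graph G \<Longrightarrow> adj G v v = 0"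
  by (auto simp: adj_def simple_graph_def)

text \<open>The matrix is complex and indexed by positions in the sorted vertex list, whereas all
  estimates use real sums over vertices. The maximum \<open>\<mu>\<close> of the Rayleigh quotient
  is an eigenvalue and dominates the modulus of every complex eigenvalue, so it is the spectral
  radius.\<close>

lemma graph_radius_eigenvector:
  fixes G :: "'a::linorder graph"
  assumes G: "simple_graph G" and ne: "verts G \<noteq> {}"
  obtains x where "\<And>v. 0 \<le> x v" "(\<Sum>v\<in>verts G. (x v)\<^sup>2) = 1"
    "\<And>v. v \<in> verts G \<Longrightarrow> (\<Sum>u\<in>verts G. adj G v u * x u) = graph_radius G * x v"
    "\<And>y. bform (adj G) (verts G) (verts G) y y \<le> graph_radius G * (\<Sum>v\<in>verts G. (y v)\<^sup>2)"
proof -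
  define V where "V = verts G"
  have fin: "finite V" using G by (simp add: simple_graph_def V_def)
  define vs where "vs = sorted_list_of_set V"
  define n where "n = card V"
  have n: "n > 0" using fin ne by (simp add: n_def V_def card_gt_0_iff)
  define A where "A = adj_matrix G"
  have A: "A = Matrix.mat n n (\<lambda>(i, j). of_real (adj G (vs ! i) (vs ! j)))"
    unfolding A_def adj_matrix_def Let_def vs_def n_def V_def adj_def
    by (intro eq_matI) auto
  have cA: "A \<in> carrier_mat n n" by (simp add: A)
  have bij: "bij_betw ((!) vs) {..<n} V"
  proof (rule bij_betw_nth)
    show "distinct vs" "{..<n} = {..<length vs}" unfolding vs_def n_def by simp_all
    show "V = set vs" unfolding vs_def using fin by (rule set_sorted_list_of_set[symmetric])
  qed
  define b where "b = (\<lambda>i j. adj G (vs ! i) (vs ! j))"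
  have "{..<n} \<noteq> {}" using n by auto
  then obtain x \<mu> where x: "\<And>v. 0 \<le> x v" "(\<Sum>v<n. (x v)\<^sup>2) = 1"
    "\<And>v. v < n \<Longrightarrow> (\<Sum>u<n. b v u * x u) = \<mu> * x v"
    and ray: "\<And>y. bform b {..<n} {..<n} y y \<le> \<mu> * (\<Sum>v<n. (y v)\<^sup>2)"
    using max_eigenvector[of "{..<n}" b] by (auto simp: b_def adj_commute)
  have mult: "vec_index (A *\<^sub>v w) i = (\<Sum>j<n. of_real (b i j) * vec_index w j)"
    if "i < n" "w \<in> carrier_vec n" for w i
  proof -
    have "vec_index (A *\<^sub>v w) i = (\<Sum>j = 0..<n. vec_index (Matrix.row A i) j * vec_index w j)"
      using that cA by (simp add: scalar_prod_def)
    also have "\<dots> = (\<Sum>j = 0..<n. of_real (b i j) * vec_index w j)"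
      using that by (intro sum.cong refl) (simp add: A b_def)
    finally show ?thesis by (simp add: atLeast0LessThan)
  qed
  have exx: "\<exists>v<n. x v \<noteq> 0"
  proof (rule ccontr)
    assume "\<not> ?thesis"
    then have "(\<Sum>v<n. (x v)\<^sup>2) = 0" by (intro sum.neutral) auto
    then show False using x(2) by simp
  qed
  have \<mu>0: "\<mu> \<ge> 0"
  proof -
    obtain v where "v < n" "x v \<noteq> 0" using exx by blast
    have "0 \<le> (\<Sum>u<n. b v u * x u)" using x(1) by (intro sum_nonneg mult_nonneg_nonneg) (auto simp: b_def)
    then have "0 \<le> \<mu> * x v" using x(3)[OF \<open>v < n\<close>] by simp
    then show ?thesis using x(1)[of v] \<open>x v \<noteq> 0\<close> by (simp add: zero_le_mult_iff)
  qed
  \<comment> \<open>For a complex eigenvector \<open>w\<close> the moduli satisfy |\<alpha>| y <= A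
    y entrywise by the triangle inequality; pairing with \<open>y\<close> bounds |\<alpha>| by the
    Rayleigh quotient.\<close>
  have le: "norm \<alpha> \<le> \<mu>" if "\<alpha> \<in> spectrum A" for \<alpha>
  proof -
    from that obtain w where w: "w \<in> carrier_vec n" "w \<noteq> 0\<^sub>v n" "A *\<^sub>v w = \<alpha> \<cdot>\<^sub>v w"
      using cA by (auto simp: spectrum_def eigenvalue_def eigenvector_def)
    define y where "y i = cmod (vec_index w i)" for i
    have "\<exists>i<n. vec_index w i \<noteq> 0"
      using w(1,2) by (metis carrier_vecD eq_vecI index_zero_vec(1) index_zero_vec(2))
    then obtain i0 where i0: "i0 < n" "y i0 \<noteq> 0" by (auto simp: y_def)
    have yy: "(\<Sum>v<n. (y v)\<^sup>2) > 0" using i0 by (intro sum_pos2[of _ i0]) auto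
    have "norm \<alpha> * y i \<le> (\<Sum>j<n. b i j * y j)" if "i < n" for i
    proof -
      have "norm \<alpha> * y i = cmod (vec_index (A *\<^sub>v w) i)"
        using that w by (simp add: y_def norm_mult)
      also have "\<dots> \<le> (\<Sum>j<n. cmod (of_real (b i j) * vec_index w j))"
        unfolding mult[OF that w(1)] by (rule norm_sum)
      also have "\<dots> = (\<Sum>j<n. b i j * y j)"
        by (intro sum.cong) (auto simp: y_def norm_mult b_def)
      finally show ?thesis .
    qed
    then have "(\<Sum>i<n. y i * (norm \<alpha> * y i)) \<le> bform b {..<n} {..<n} y y"
      unfolding bform_eq_left by (intro sum_mono mult_left_mono) (auto simp: y_def)
    also have "\<dots> \<le> \<mu> * (\<Sum>v<n. (y v)\<^sup>2)" by (rule ray)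
    also have "(\<Sum>i<n. y i * (norm \<alpha> * y i)) = norm \<alpha> * (\<Sum>v<n. (y v)\<^sup>2)"
      by (simp add: sum_distrib_left power2_eq_square mult_ac)
    finally show ?thesis using yy by simp
  qed
  have mem: "of_real \<mu> \<in> spectrum A"
  proof -
    define w where "w = Matrix.vec n (\<lambda>i. complex_of_real (x i))"
    have w: "w \<in> carrier_vec n" by (simp add: w_def)
    obtain v where v: "v < n" "x v \<noteq> 0" using exx by blast
    then have "w \<noteq> 0\<^sub>v n" by (metis index_vec index_zero_vec(1) of_real_eq_0_iff w_def)
    moreover have "A *\<^sub>v w = of_real \<mu> \<cdot>\<^sub>v w"
    proof (intro eq_vecI)
      fix i assume "i < dim_vec (of_real \<mu> \<cdot>\<^sub>v w)"
      then have i: "i < n" using w by simp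
      have "vec_index (A *\<^sub>v w) i = of_real (\<Sum>j<n. b i j * x j)"
        unfolding mult[OF i w] by (simp add: w_def)
      then show "vec_index (A *\<^sub>v w) i = vec_index (of_real \<mu> \<cdot>\<^sub>v w) i"
        using i x(3)[OF i] by (simp add: w_def)
    qed (use cA w in auto)
    ultimately show ?thesis using w cA by (auto simp: spectrum_def eigenvalue_def eigenvector_def)
  qed
  have fs: "finite (norm ` spectrum A)" using card_finite_spectrum(1)[OF cA] by simp
  have "graph_radius G = \<mu>"
    unfolding graph_radius_def spectral_radius_def A_def[symmetric]
  proof (rule Max_eqI[OF fs])
    show "\<mu> \<in> norm ` spectrum A" using mem \<mu>0 by (metis abs_of_nonneg image_eqI norm_of_real)
  qed (use le in auto)
  \<comment> \<open>Inverse of the vertex enumeration, carrying the eigenvector from positions back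
    to vertices.\<close>
  define ix where "ix = the_inv_into {..<n} ((!) vs)"
  have ix: "ix (vs ! i) = i" if "i < n" for i
    using bij that unfolding ix_def by (simp add: the_inv_into_f_f bij_betw_def)
  have re: "(\<Sum>v\<in>V. f v) = (\<Sum>i<n. f (vs ! i))" for f :: "_ \<Rightarrow> real"
    by (rule sum.reindex_bij_betw[OF bij, symmetric])
  show thesis
  proof (rule that[of "\<lambda>v. x (ix v)"])
    show "(\<Sum>v\<in>verts G. (x (ix v))\<^sup>2) = 1"
      unfolding V_def[symmetric] re using x(2) by (simp add: ix)
  next
    fix v assume "v \<in> verts G"
    then obtain i where i: "i < n" "v = vs ! i" using bij by (auto simp: bij_betw_def V_def)
    show "(\<Sum>u\<in>verts G. adj G v u * x (ix u)) = graph_radius G * x (ix v)"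
      unfolding V_def[symmetric] re \<open>graph_radius G = \<mu>\<close>
      using x(3)[OF i(1)] i by (simp add: ix b_def)
  next
    fix y
    show "bform (adj G) (verts G) (verts G) y y \<le> graph_radius G * (\<Sum>v\<in>verts G. (y v)\<^sup>2)"
      using ray[of "\<lambda>i. y (vs ! i)"]
      unfolding V_def[symmetric] re \<open>graph_radius G = \<mu>\<close> bform_def by (simp add: b_def)
  qed (use x in auto)
qed

section \<open>Homomorphisms of bicliques and the spectral radius\<close>

lemma Holder_sum:
  fixes f g :: "'a \<Rightarrow> real"
  assumes "p > 1" "q > 1" "1 / p + 1 / q = 1"
    and "\<And>i. i \<in> I \<Longrightarrow> 0 \<le> f i" "\<And>i. i \<in> I \<Longrightarrow> 0 \<le> g i"
  shows "(\<Sum>i\<in>I. f i * g i) \<le> (\<Sum>i\<in>I. f i powr p) powr (1 / p) * (\<Sum>i\<in>I. g i powr q) powr (1 / q)"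
proof (cases "finite I")
  case fin: True
  define A B where "A = (\<Sum>i\<in>I. f i powr p)" and "B = (\<Sum>i\<in>I. g i powr q)"
  have nn: "A \<ge> 0" "B \<ge> 0" by (auto simp: A_def B_def intro: sum_nonneg)
  show ?thesis
  proof (cases "A = 0 \<or> B = 0")
    case True
    then have "\<And>i. i \<in> I \<Longrightarrow> f i * g i = 0"
      using fin by (auto simp: A_def B_def sum_nonneg_eq_0_iff)
    then have "(\<Sum>i\<in>I. f i * g i) = 0" by simp
    then show ?thesis by (simp flip: A_def B_def)
  next
    case False
    with nn have pos: "A > 0" "B > 0" by auto
    define \<alpha> \<beta> where "\<alpha> = A powr (1 / p)" and "\<beta> = B powr (1 / q)"
    have ab: "\<alpha> > 0" "\<beta> > 0" using pos by (auto simp: \<alpha>_def \<beta>_def)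
    have pw: "\<alpha> powr p = A" "\<beta> powr q = B" using pos assms by (auto simp: \<alpha>_def \<beta>_def powr_powr)
    have "(\<Sum>i\<in>I. (f i / \<alpha>) * (g i / \<beta>)) \<le> (\<Sum>i\<in>I. (f i / \<alpha>) powr p / p + (g i / \<beta>) powr q / q)"
      using assms ab by (intro sum_mono Youngs_inequality) auto
    also have "\<dots> = (\<Sum>i\<in>I. f i powr p / (A * p) + g i powr q / (B * q))"
      using assms ab pw by (intro sum.cong refl) (simp add: powr_divide)
    also have "\<dots> = A / (A * p) + B / (B * q)"
      by (simp add: sum.distrib A_def B_def flip: sum_divide_distrib)
    also have "\<dots> = 1" using pos assms by simp
    finally have "(\<Sum>i\<in>I. f i * g i) / (\<alpha> * \<beta>) \<le> 1" by (simp add: sum_divide_distrib)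
    then show ?thesis using ab by (simp add: \<alpha>_def \<beta>_def A_def B_def field_simps)
  qed
qed simp

text \<open>Duality in the form needed below: a weight \<open>f\<close> of norm 1 for the exponent
  t/(t-1) is traded for the t-th power of \<open>h\<close>. It is applied once to vertices and once
  to t-tuples of vertices.\<close>

lemma Holder_sum_normalized:
  fixes f h :: "'a \<Rightarrow> real" and t :: nat
  assumes t: "t \<ge> 2"
    and f: "\<And>i. i \<in> I \<Longrightarrow> 0 \<le> f i" and h: "\<And>i. i \<in> I \<Longrightarrow> 0 \<le> h i"
    and 1: "(\<Sum>i\<in>I. f i powr (t / (t - 1))) = 1"
  shows "(\<Sum>i\<in>I. f i * h i) ^ t \<le> (\<Sum>i\<in>I. h i ^ t)"
proof -
  have t1: "real t > 1" "real (t - 1) = real t - 1" using t by auto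
  have "(\<Sum>i\<in>I. f i * h i)
      \<le> (\<Sum>i\<in>I. f i powr (t / (t - 1))) powr (1 / (t / (t - 1))) * (\<Sum>i\<in>I. h i powr t) powr (1 / t)"
    using t1 f h by (intro Holder_sum) (auto simp: field_simps)
  also have "\<dots> = (\<Sum>i\<in>I. h i powr t) powr (1 / t)" unfolding 1 by simp
  finally have "(\<Sum>i\<in>I. f i * h i) ^ t \<le> ((\<Sum>i\<in>I. h i powr t) powr (1 / t)) ^ t"
    using f h by (intro power_mono sum_nonneg mult_nonneg_nonneg) auto
  also have "\<dots> = (\<Sum>i\<in>I. h i powr t)"
    using t by (cases "(\<Sum>i\<in>I. h i powr t) = 0") (simp_all add: powr_power zero_power sum_nonneg)
  also have "\<dots> = (\<Sum>i\<in>I. h i ^ t)"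
    using t h by (intro sum.cong refl powr_realpow') auto
  finally show ?thesis .
qed

text \<open>Hoelder's inequality is applied to the test function \<open>w powr s\<close>, whose exponent
  \<open>s = 2 (t - 1) / t\<close> is chosen such that its \<open>t / (t - 1)\<close>-norm is the Euclidean norm of \<open>w\<close>.\<close>

lemma hom_biclique_lower_bound:
  fixes a :: "'a \<Rightarrow> 'a \<Rightarrow> real"
  assumes fin: "finite V" and t: "t \<ge> 2" and a01: "\<And>u v. a u v = 0 \<or> a u v = 1"
    and sym: "\<And>u v. a u v = a v u"
    and w: "\<And>v. v \<in> V \<Longrightarrow> 0 \<le> w v" and w1: "(\<Sum>v\<in>V. (w v)\<^sup>2) = 1"
  shows "bform a V V w w ^ (2 * t * (t - 1))
    \<le> (\<Sum>U\<in>{..<t} \<rightarrow>\<^sub>E V. (\<Sum>v\<in>V. \<Prod>i<t. a (U i) v) ^ t) * (\<Sum>u\<in>V. \<Sum>v\<in>V. a u v) ^ (t * (t - 2))"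
proof -
  define \<mu> D where "\<mu> = bform a V V w w" and "D = (\<Sum>u\<in>V. \<Sum>v\<in>V. a u v)"
  have a0: "0 \<le> a u v" for u v using a01[of u v] by auto
  define s where "s = 2 * (real t - 1) / real t"
  have s: "s \<ge> 1" using t by (simp add: s_def field_simps)
  define f where "f v = w v powr s" for v
  have f0: "0 \<le> f v" for v by (simp add: f_def)
  have fnorm: "(\<Sum>v\<in>V. f v powr (t / (t - 1))) = 1"
  proof -
    have "f v powr (t / (t - 1)) = (w v)\<^sup>2" if "v \<in> V" for v
    proof -
      have "real t - 1 \<noteq> 0" using t by simp
      then have "s * (t / (t - 1)) = 2" using t by (simp add: s_def of_nat_diff divide_simps)
      then show ?thesis using w[OF that] by (simp add: f_def powr_powr)
    qed
    then show ?thesis using w1 by simp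
  qed
  define F where "F = bform a V V f f"
  have F0: "F \<ge> 0" unfolding F_def bform_def using a0 f0 by (intro sum_nonneg mult_nonneg_nonneg)
  have D0: "D \<ge> 0" unfolding D_def using a0 by (intro sum_nonneg)
  have \<mu>0: "\<mu> \<ge> 0" unfolding \<mu>_def bform_def using a0 w by (intro sum_nonneg mult_nonneg_nonneg) auto
  \<comment> \<open>Passing from \<open>w\<close> to its power \<open>f\<close> by Hoelder over
    pairs: as \<open>a\<close> is 0/1, (a w w)^s = a f f, and the conjugate factor is a power of
    \<open>D\<close>. For t = 2 the exponent s = 1 has no conjugate, hence the case
    distinction.\<close>
  have c: "\<mu> powr s \<le> F * D powr (s - 1)"
  proof (cases "t = 2")
    case True
    then have s1: "s = 1" by (simp add: s_def)
    have "F = \<mu>" unfolding F_def \<mu>_def bform_def f_def s1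
      using w by (intro sum.cong refl) simp
    \<comment> \<open>Here \<open>D powr (s - 1)\<close> is \<open>D powr 0\<close>, which is 0
      rather than 1 for \<open>D = 0\<close>; the claim then requires \<mu> = 0.\<close>
    moreover have "\<mu> = 0" if "D = 0"
    proof -
      have "a u v = 0" if "u \<in> V" "v \<in> V" for u v
        using \<open>D = 0\<close> fin that a0 by (simp add: D_def sum_nonneg_eq_0_iff sum_nonneg)
      then show ?thesis by (simp add: \<mu>_def bform_def)
    qed
    ultimately show ?thesis using \<mu>0 s1 D0 by (cases "D = 0") auto
  next
    case False
    then have "t > 2" using t by simp
    then have s2: "s > 1" by (simp add: s_def field_simps)
    have "\<mu> = (\<Sum>(u, v)\<in>V \<times> V. (a u v * (w u * w v)) * a u v)"
      unfolding \<mu>_def bform_def sum.cartesian_product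
      by (intro sum.cong refl) (use a01 in force)
    also have "\<dots> \<le> (\<Sum>(u, v)\<in>V \<times> V. (a u v * (w u * w v)) powr s) powr (1 / s)
         * (\<Sum>(u, v)\<in>V \<times> V. a u v powr (s / (s - 1))) powr (1 / (s / (s - 1)))"
      unfolding split_def using s2 a0 w
      by (intro Holder_sum) (auto simp: field_simps)
    also have "(\<Sum>(u, v)\<in>V \<times> V. (a u v * (w u * w v)) powr s) = F"
      unfolding F_def bform_def sum.cartesian_product f_def
    proof (intro sum.cong refl, clarsimp)
      fix u v assume "u \<in> V" "v \<in> V"
      then show "(a u v * (w u * w v)) powr s = a u v * w u powr s * w v powr s"
        using a01[of u v] w s2 by (auto simp: powr_mult)
    qed
    also have "(\<Sum>(u, v)\<in>V \<times> V. a u v powr (s / (s - 1))) = D"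
      unfolding D_def sum.cartesian_product
    proof (intro sum.cong refl, clarsimp)
      fix u v
      show "a u v powr (s / (s - 1)) = a u v" using a01[of u v] by auto
    qed
    also have "1 / (s / (s - 1)) = (s - 1) / s" by simp
    finally have "\<mu> powr s \<le> (F powr (1 / s) * D powr ((s - 1) / s)) powr s"
      using \<mu>0 s2 by (intro powr_mono2) auto
    also have "\<dots> = F * D powr (s - 1)"
      using s2 F0 D0 by (simp add: powr_mult powr_powr)
    finally show ?thesis .
  qed
  have t2: "real (t - 2) = real t - 2" using t by simp
  have "\<mu> ^ (2 * t * (t - 1)) \<le> F ^ (t * t) * D ^ (t * (t - 2))"
  proof (cases "\<mu> = 0")
    case True
    then show ?thesis using t F0 D0 by (simp add: zero_power)
  next
    case False
    then have \<mu>: "\<mu> > 0" using \<mu>0 by simp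
    have D: "D > 0"
    proof (rule ccontr)
      assume "\<not> D > 0"
      then have "D = 0" using D0 by simp
      then have "\<mu> powr s \<le> 0" using c by simp
      then show False using \<mu> by simp
    qed
    have "(\<mu> powr s) ^ (t * t) \<le> (F * D powr (s - 1)) ^ (t * t)"
      using c by (intro power_mono) auto
    also have "\<dots> = F ^ (t * t) * (D powr (s - 1)) ^ (t * t)" by (simp add: power_mult_distrib)
    also have "(D powr (s - 1)) ^ (t * t) = D powr ((s - 1) * (t * t))"
      using D by (simp add: powr_realpow[symmetric] powr_powr)
    also have "(s - 1) * (t * t) = real (t * (t - 2))"
      using t by (simp add: s_def field_simps of_nat_diff)
    also have "D powr real (t * (t - 2)) = D ^ (t * (t - 2))" using D by (rule powr_realpow)
    also have "(\<mu> powr s) ^ (t * t) = \<mu> powr (s * (t * t))"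
      using \<mu> by (simp add: powr_realpow[symmetric] powr_powr)
    also have "s * (t * t) = real (2 * t * (t - 1))"
      using t by (simp add: s_def field_simps of_nat_diff)
    also have "\<mu> powr real (2 * t * (t - 1)) = \<mu> ^ (2 * t * (t - 1))" using \<mu> by (rule powr_realpow)
    finally show ?thesis .
  qed
  \<comment> \<open>Two applications of Hoelder. The first removes the weight at \<open>v\<close>
    and leaves the t-th power of a neighbourhood sum, which expands into t-tuples \<open>U\<close>.
    After swapping the sums the second removes the product weight on tuples, whose norm is a product
    of norms equal to 1. What remains is the t-th moment of the common neighbourhoods, the number of
    homomorphisms of K_{t,t}.\<close>
  also have "F ^ (t * t) \<le> (\<Sum>U\<in>{..<t} \<rightarrow>\<^sub>E V. (\<Sum>v\<in>V. \<Prod>i<t. a (U i) v) ^ t)"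
  proof -
    have "F ^ t = (\<Sum>v\<in>V. f v * (\<Sum>u\<in>V. a v u * f u)) ^ t" by (simp add: F_def bform_eq_left)
    also have "\<dots> \<le> (\<Sum>v\<in>V. (\<Sum>u\<in>V. a v u * f u) ^ t)"
      using t f0 a0 fnorm by (intro Holder_sum_normalized) (auto intro!: sum_nonneg)
    also have "\<dots> = (\<Sum>v\<in>V. \<Prod>i<t. \<Sum>u\<in>V. a v u * f u)" by simp
    also have "\<dots> = (\<Sum>v\<in>V. \<Sum>U\<in>{..<t} \<rightarrow>\<^sub>E V. \<Prod>i<t. a v (U i) * f (U i))"
      using fin by (intro sum.cong refl prod_sum_PiE) auto
    also have "\<dots> = (\<Sum>U\<in>{..<t} \<rightarrow>\<^sub>E V. (\<Prod>i<t. f (U i)) * (\<Sum>v\<in>V. \<Prod>i<t. a (U i) v))"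
      by (subst sum.swap) (simp add: prod.distrib sum_distrib_left sym mult_ac)
    finally have "(F ^ t) ^ t \<le> (\<Sum>U\<in>{..<t} \<rightarrow>\<^sub>E V. (\<Prod>i<t. f (U i)) * (\<Sum>v\<in>V. \<Prod>i<t. a (U i) v)) ^ t"
      using F0 by (intro power_mono) auto
    also have "\<dots> \<le> (\<Sum>U\<in>{..<t} \<rightarrow>\<^sub>E V. (\<Sum>v\<in>V. \<Prod>i<t. a (U i) v) ^ t)"
    proof (rule Holder_sum_normalized[OF t])
      have "(\<Sum>U\<in>{..<t} \<rightarrow>\<^sub>E V. (\<Prod>i<t. f (U i)) powr (t / (t - 1)))
          = (\<Sum>U\<in>{..<t} \<rightarrow>\<^sub>E V. \<Prod>i<t. f (U i) powr (t / (t - 1)))"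
        by (intro sum.cong refl prod_powr_distrib)
      also have "\<dots> = (\<Prod>i<t. \<Sum>v\<in>V. f v powr (t / (t - 1)))"
        using fin by (intro prod_sum_PiE[symmetric]) auto
      also have "\<dots> = 1" by (simp only: fnorm prod.neutral_const)
      finally show "(\<Sum>U\<in>{..<t} \<rightarrow>\<^sub>E V. (\<Prod>i<t. f (U i)) powr (t / (t - 1))) = 1" .
    qed (use f0 a0 in \<open>auto intro!: prod_nonneg sum_nonneg\<close>)
    finally show ?thesis by (simp add: power_mult)
  qed
  finally show ?thesis unfolding \<mu>_def D_def using D0 by (simp add: mult_right_mono D_def)
qed

section \<open>Separating high and low degrees in the eigenvector\<close>

text \<open>On \<open>R\<close> the eigenvalue equation reads \<rho> x = z + wM + r, with
  \<open>z\<close> the contribution of \<open>L\<close>. Since <z, r> <= B is small, subtracting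
  z/\<rho> from \<open>x\<close> hardly decreases the form on \<open>R\<close> beyond LR, but lowers
  the squared norm to at most d = q - LR/\<rho>. If d >= \<sigma>, the remainder is a test vector
  with quotient almost \<rho>. Otherwise nearly all mass on \<open>R\<close> comes from
  \<open>L\<close>, and \<open>L\<close> carries close to half of the total when \<gamma> and
  \<sigma> are small.\<close>

lemma spectral_dichotomy:
  fixes a :: "'a \<Rightarrow> 'a \<Rightarrow> real"
  assumes fin: "finite L" "finite M" "finite R"
    and disj: "L \<inter> M = {}" "L \<inter> R = {}" "M \<inter> R = {}"
    and sym: "\<And>u v. a u v = a v u" and a0: "\<And>u v. 0 \<le> a u v" and a1: "\<And>u v. a u v \<le> 1"
    and x0: "\<And>v. 0 \<le> x v" and x1: "(\<Sum>v\<in>L \<union> M \<union> R. (x v)\<^sup>2) = 1"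
    and eig: "\<And>v. v \<in> L \<union> M \<union> R \<Longrightarrow> (\<Sum>u\<in>L \<union> M \<union> R. a v u * x u) = \<rho> * x v"
    and \<rho>: "\<rho> > 0"
    and \<gamma>: "(\<Sum>v\<in>M. (x v)\<^sup>2) \<le> \<gamma>"
    and \<Delta>: "\<And>v. v \<in> R \<Longrightarrow> (\<Sum>u\<in>R. a v u) \<le> \<Delta>"
    and \<Delta>0: "0 \<le> \<Delta>"
    and D: "(\<Sum>u\<in>R. \<Sum>v\<in>R. a u v) \<le> D"
    and K: "real (card L) \<le> K"
    and B: "B = sqrt (K * (\<Delta> * D))"
    and \<sigma>: "\<sigma> > 0" and \<tau>: "\<tau> = (\<gamma> + 2 * B / \<rho>\<^sup>2) / \<sigma>" "\<tau> < 1"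
  obtains (dense) w where "\<And>v. v \<in> R \<Longrightarrow> 0 \<le> w v" "(\<Sum>v\<in>R. (w v)\<^sup>2) = 1"
      "bform a R R w w \<ge> \<rho> * (1 - \<tau>)"
  | (star) "(\<Sum>v\<in>L. (x v)\<^sup>2) > (1 - \<gamma> - \<sigma>) / 2"
      "(\<Sum>v\<in>R. (\<Sum>u\<in>L. a v u * x u)\<^sup>2)
        \<ge> \<rho>\<^sup>2 * (\<Sum>v\<in>L. (x v)\<^sup>2) - \<rho> * K - 2 * \<rho>\<^sup>2 * \<gamma> - B"
proof -
  define p g q where "p = (\<Sum>v\<in>L. (x v)\<^sup>2)" and "g = (\<Sum>v\<in>M. (x v)\<^sup>2)" and "q = (\<Sum>v\<in>R. (x v)\<^sup>2)"
  have split: "(\<Sum>v\<in>L \<union> M \<union> R. f v) = sum f L + sum f M + sum f R" for f :: "'a \<Rightarrow> real"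
  proof -
    have "(L \<union> M) \<inter> R = {}" using disj by auto
    then show ?thesis using fin disj by (simp add: sum.union_disjoint)
  qed
  have pq: "p + g + q = 1" using x1 unfolding split p_def g_def q_def .
  have nn: "p \<ge> 0" "g \<ge> 0" "q \<ge> 0" by (auto simp: p_def g_def q_def intro: sum_nonneg)
  define z wM r where "z v = (\<Sum>u\<in>L. a v u * x u)" and "wM v = (\<Sum>u\<in>M. a v u * x u)"
    and "r v = (\<Sum>u\<in>R. a v u * x u)" for v
  have z0: "0 \<le> z v" "0 \<le> wM v" "0 \<le> r v" for v
    unfolding z_def wM_def r_def using a0 x0 by (auto intro!: sum_nonneg mult_nonneg_nonneg)
  have eig': "z v + wM v + r v = \<rho> * x v" if "v \<in> L \<union> M \<union> R" for v
    using eig[OF that] unfolding split z_def wM_def r_def .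
  have bf0: "0 \<le> bform a X Y y y'" if "\<And>v. 0 \<le> y v" "\<And>v. 0 \<le> y' v" for X Y y y'
    unfolding bform_def using a0 that by (auto intro!: sum_nonneg mult_nonneg_nonneg)
  have row: "bform a X L y x = (\<Sum>v\<in>X. y v * z v)" "bform a X M y x = (\<Sum>v\<in>X. y v * wM v)"
    "bform a X R y x = (\<Sum>v\<in>X. y v * r v)" for X y
    unfolding bform_eq_left z_def wM_def r_def by auto
  have tot: "bform a X L y x + bform a X M y x + bform a X R y x = \<rho> * (\<Sum>v\<in>X. y v * x v)"
    if "X \<subseteq> L \<union> M \<union> R" for X y
  proof -
    have "(\<Sum>v\<in>X. y v * (z v + wM v + r v)) = (\<Sum>v\<in>X. y v * (\<rho> * x v))"
      using that eig' by (intro sum.cong refl) auto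
    then show ?thesis unfolding row by (simp add: sum.distrib sum_distrib_left algebra_simps)
  qed
  have subL: "L \<subseteq> L \<union> M \<union> R" and subM: "M \<subseteq> L \<union> M \<union> R" and subR: "R \<subseteq> L \<union> M \<union> R"
    by auto
  define LL LM LR MR RR where "LL = bform a L L x x" and "LM = bform a L M x x"
    and "LR = bform a L R x x" and "MR = bform a M R x x" and "RR = bform a R R x x"
  have ge0: "0 \<le> LL" "0 \<le> LM" "0 \<le> LR" "0 \<le> MR" "0 \<le> RR" "0 \<le> bform a M M x x"
    unfolding LL_def LM_def LR_def MR_def RR_def by (auto intro: bf0 x0)
  have eqL: "LL + LM + LR = \<rho> * p"
    using tot[OF subL, of x] by (simp add: LL_def LM_def LR_def p_def power2_eq_square)
  have eqM: "LM + bform a M M x x + MR = \<rho> * g"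
    using tot[OF subM, of x] bform_commute[of a M L x x, OF sym]
    by (simp add: LM_def MR_def g_def power2_eq_square)
  have eqR: "LR + MR + RR = \<rho> * q"
    using tot[OF subR, of x] bform_commute[of a R L x x, OF sym] bform_commute[of a R M x x, OF sym]
    by (simp add: LR_def MR_def RR_def q_def power2_eq_square)
  have \<rho>g: "\<rho> * g \<le> \<rho> * \<gamma>" using \<gamma> \<rho> by (simp add: g_def)
  have LMMR: "LM \<le> \<rho> * \<gamma>" "MR \<le> \<rho> * \<gamma>" using eqM ge0 \<rho>g by auto
  have sL: "(\<Sum>u\<in>L. x u)\<^sup>2 \<le> K"
  proof -
    have "(\<Sum>u\<in>L. x u)\<^sup>2 \<le> p * card L" unfolding p_def by (rule sum_squared_le_sum_of_squares)
    also have "\<dots> \<le> 1 * real (card L)" using pq nn by (intro mult_right_mono) auto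
    finally show ?thesis using K by simp
  qed
  have LLK: "LL \<le> K"
  proof -
    have "LL \<le> bform (\<lambda>_ _. 1) L L x x" unfolding LL_def bform_def
      using a1 x0 by (intro sum_mono mult_right_mono) auto
    also have "\<dots> = (\<Sum>u\<in>L. x u)\<^sup>2" by (simp add: bform_def power2_eq_square sum_product)
    finally show ?thesis using sL by simp
  qed
  \<comment> \<open>Pointwise \<open>z\<close> is at most the sum of \<open>x\<close> over
    \<open>L\<close>, and summing \<open>r\<close> over \<open>R\<close> gives the degrees inside
    \<open>R\<close> weighted by \<open>x\<close>. Cauchy-Schwarz applies, the sum of squared
    degrees being at most \<Delta> D.\<close>
  have zr: "(\<Sum>v\<in>R. z v * r v) \<le> B"
  proof -
    have "(\<Sum>v\<in>R. z v * r v) \<le> (\<Sum>v\<in>R. (\<Sum>u\<in>L. x u) * r v)"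
    proof (intro sum_mono mult_right_mono z0)
      fix v show "z v \<le> (\<Sum>u\<in>L. x u)" unfolding z_def
        using a1[of v] x0 by (intro sum_mono) (simp add: mult_left_le_one_le a0)
    qed
    also have "\<dots> = (\<Sum>u\<in>L. x u) * (\<Sum>u\<in>R. x u * (\<Sum>v\<in>R. a v u))"
    proof -
      have "(\<Sum>v\<in>R. r v) = (\<Sum>u\<in>R. x u * (\<Sum>v\<in>R. a v u))"
        unfolding r_def by (subst sum.swap) (simp add: sum_distrib_left mult_ac)
      then show ?thesis by (simp flip: sum_distrib_left)
    qed
    finally have 1: "(\<Sum>v\<in>R. z v * r v) \<le> (\<Sum>u\<in>L. x u) * (\<Sum>u\<in>R. x u * (\<Sum>v\<in>R. a v u))" .
    have "(\<Sum>u\<in>R. x u * (\<Sum>v\<in>R. a v u))\<^sup>2 \<le> q * (\<Sum>u\<in>R. (\<Sum>v\<in>R. a v u)\<^sup>2)"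
      unfolding q_def by (rule Cauchy_Schwarz_ineq_sum)
    also have "\<dots> \<le> 1 * (\<Sum>u\<in>R. (\<Sum>v\<in>R. a v u)\<^sup>2)"
      using pq nn by (intro mult_right_mono sum_nonneg) auto
    also have "\<dots> \<le> (\<Sum>u\<in>R. \<Delta> * (\<Sum>v\<in>R. a v u))"
      unfolding mult_1 power2_eq_square
      using \<Delta> by (intro sum_mono mult_right_mono sum_nonneg a0) (simp add: sym)
    also have "\<dots> = \<Delta> * (\<Sum>u\<in>R. \<Sum>v\<in>R. a u v)"
      by (simp add: sum_distrib_left sym)
    also have "\<dots> \<le> \<Delta> * D"
      using D \<Delta>0 by (intro mult_left_mono)
    finally have 2: "(\<Sum>u\<in>R. x u * (\<Sum>v\<in>R. a v u))\<^sup>2 \<le> \<Delta> * D" .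
    have "((\<Sum>u\<in>L. x u) * (\<Sum>u\<in>R. x u * (\<Sum>v\<in>R. a v u)))\<^sup>2 \<le> K * (\<Delta> * D)"
      unfolding power_mult_distrib by (rule mult_mono[OF sL 2]) (use K in auto)
    then have "(\<Sum>u\<in>L. x u) * (\<Sum>u\<in>R. x u * (\<Sum>v\<in>R. a v u)) \<le> B" unfolding B by (rule real_le_rsqrt)
    with 1 show ?thesis by simp
  qed
  have zx: "(\<Sum>v\<in>R. z v * x v) = LR"
    using row(1)[of R x] bform_commute[of a R L x x, OF sym] by (simp add: LR_def mult.commute)
  define zz where "zz = (\<Sum>v\<in>R. (z v)\<^sup>2)"
  have zl: "z v \<le> \<rho> * x v" if "v \<in> R" for v using eig'[of v] z0[of v] that by simp
  have zw: "(\<Sum>v\<in>R. z v * wM v) \<le> \<rho>\<^sup>2 * \<gamma>"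
  proof -
    have "(\<Sum>v\<in>R. z v * wM v) \<le> (\<Sum>v\<in>R. \<rho> * x v * wM v)"
      using zl z0 by (intro sum_mono mult_right_mono) auto
    also have "\<dots> = \<rho> * MR"
      using row(2)[of R x] bform_commute[of a R M x x, OF sym]
      by (simp add: MR_def sum_distrib_left mult_ac)
    also have "\<dots> \<le> \<rho> * (\<rho> * \<gamma>)" using LMMR \<rho> by (intro mult_left_mono) auto
    finally show ?thesis by (simp add: power2_eq_square)
  qed
  have zzeq: "\<rho> * LR = zz + (\<Sum>v\<in>R. z v * wM v) + (\<Sum>v\<in>R. z v * r v)"
    using tot[OF subR, of z] unfolding row zx zz_def power2_eq_square by simp
  have zzle: "zz \<le> \<rho> * LR" using zzeq z0 by (smt (verit) sum_nonneg mult_nonneg_nonneg)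
  \<comment> \<open>Equal to q - LR/\<rho>, the bound found below for the squared norm of
    \<open>y\<close>.\<close>
  define d where "d = 1 - p - g - LR / \<rho>"
  show thesis
  proof (cases "d \<ge> \<sigma>")
    case True
    define y where "y = (\<lambda>v. x v + (- 1 / \<rho>) * z v)"
    have y0: "0 \<le> y v" if "v \<in> R" for v
      using zl[OF that] \<rho> by (simp add: y_def field_simps)
    have "(\<Sum>v\<in>R. (y v)\<^sup>2) = (\<Sum>v\<in>R. (x v)\<^sup>2 - 2 / \<rho> * (z v * x v) + (z v)\<^sup>2 / \<rho>\<^sup>2)"
      using \<rho> by (intro sum.cong refl) (simp add: y_def power2_eq_square field_simps)
    also have "\<dots> = q - 2 / \<rho> * LR + zz / \<rho>\<^sup>2"
      unfolding sum.distrib sum_subtractf q_def zx[symmetric] zz_def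
      by (simp add: sum_distrib_left sum_divide_distrib)
    also have "\<dots> \<le> q - 2 / \<rho> * LR + (\<rho> * LR) / \<rho>\<^sup>2"
      using zzle by (intro add_left_mono divide_right_mono) auto
    also have "\<dots> = q - LR / \<rho>" using \<rho> by (simp add: power2_eq_square field_simps)
    also have "\<dots> = d" using pq by (simp add: d_def)
    finally have yd: "(\<Sum>v\<in>R. (y v)\<^sup>2) \<le> d" .
    have "bform a R R y y = RR - 2 / \<rho> * (\<Sum>v\<in>R. z v * r v) + bform a R R z z / \<rho>\<^sup>2"
      unfolding y_def bform_add_left bform_add_right bform_scale_left bform_scale_right
      using bform_commute[of a R R x z, OF sym] row(3)[of R z]
      by (simp add: RR_def power2_eq_square)
    also have "\<dots> \<ge> RR - 2 / \<rho> * B"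
    proof -
      have "2 / \<rho> * (\<Sum>v\<in>R. z v * r v) \<le> 2 / \<rho> * B" using zr \<rho> by (intro mult_left_mono) auto
      moreover have "0 \<le> bform a R R z z / \<rho>\<^sup>2" by (intro divide_nonneg_nonneg bf0 z0) auto
      ultimately show ?thesis by simp
    qed
    finally have yy: "bform a R R y y \<ge> RR - 2 / \<rho> * B" .
    have "RR - 2 / \<rho> * B = \<rho> * d - MR - 2 / \<rho> * B"
    proof -
      have "q = d + LR / \<rho>" using pq by (simp add: d_def)
      then have "\<rho> * q = \<rho> * d + LR" using \<rho> by (simp add: distrib_left)
      then show ?thesis using eqR by simp
    qed
    also have "\<dots> \<ge> \<rho> * (d - \<tau> * \<sigma>)"
    proof -
      have "\<rho> * (\<tau> * \<sigma>) = \<rho> * \<gamma> + 2 / \<rho> * B"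
        using \<sigma> \<rho> by (simp add: \<tau>(1) power2_eq_square field_simps)
      then show ?thesis using LMMR by (simp add: algebra_simps)
    qed
    \<comment> \<open>The absolute error \<tau> \<sigma> becomes a relative one because d >=
      \<sigma>.\<close>
    also have "\<rho> * (d - \<tau> * \<sigma>) \<ge> \<rho> * (d * (1 - \<tau>))"
    proof -
      have "B \<ge> 0" using zr z0 by (meson mult_nonneg_nonneg order_trans sum_nonneg)
      moreover have "\<gamma> \<ge> 0" using \<gamma> nn by (simp add: g_def)
      ultimately have "\<tau> \<ge> 0" using \<sigma> by (simp add: \<tau>(1))
      then have "\<tau> * \<sigma> \<le> \<tau> * d" using True by (intro mult_left_mono)
      then show ?thesis using \<rho> by (simp add: algebra_simps)
    qed
    finally have Q: "bform a R R y y \<ge> \<rho> * (d * (1 - \<tau>))" using yy by simp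
    define s where "s = (\<Sum>v\<in>R. (y v)\<^sup>2)"
    have "\<rho> * (d * (1 - \<tau>)) > 0" using \<rho> \<sigma> True \<tau>(2) by simp
    then have "bform a R R y y > 0" using Q by simp
    then have s: "s > 0"
    proof -
      have "s \<noteq> 0"
      proof
        assume "s = 0"
        then have "\<And>v. v \<in> R \<Longrightarrow> y v = 0" using fin by (simp add: s_def sum_nonneg_eq_0_iff)
        then have "bform a R R y y = 0" by (simp add: bform_def)
        then show False using \<open>bform a R R y y > 0\<close> by simp
      qed
      moreover have "s \<ge> 0" unfolding s_def by (intro sum_nonneg) auto
      ultimately show ?thesis by simp
    qed
    show thesis
    proof (rule dense[of "\<lambda>v. (1 / sqrt s) * y v"])
      show "0 \<le> 1 / sqrt s * y v" if "v \<in> R" for v using y0[OF that] s by simp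
      have "(\<Sum>v\<in>R. (1 / sqrt s * y v)\<^sup>2) = (\<Sum>v\<in>R. (y v)\<^sup>2 / s)"
        using s by (intro sum.cong) (auto simp: power_divide)
      also have "\<dots> = 1" using s by (simp add: s_def flip: sum_divide_distrib)
      finally show "(\<Sum>v\<in>R. (1 / sqrt s * y v)\<^sup>2) = 1" .
      have "\<rho> * (1 - \<tau>) * s \<le> \<rho> * (1 - \<tau>) * d"
        using yd \<rho> \<tau>(2) by (intro mult_left_mono) (auto simp: s_def)
      then have "\<rho> * (1 - \<tau>) * s \<le> bform a R R y y" using Q by (simp add: mult_ac)
      then show "\<rho> * (1 - \<tau>) \<le> bform a R R (\<lambda>v. 1 / sqrt s * y v) (\<lambda>v. 1 / sqrt s * y v)"
        unfolding bform_scale_left bform_scale_right using s by (simp add: field_simps)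
    qed
  next
    case False
    \<comment> \<open>The equation on \<open>L\<close> gives LR <= \<rho> p, so d < \<sigma> forces
      1 - 2p - g < \<sigma>.\<close>
    have "LR / \<rho> \<le> p" using eqL ge0 \<rho> by (simp add: field_simps)
    then have "p > (1 - \<gamma> - \<sigma>) / 2" using False \<gamma> by (simp add: d_def g_def)
    moreover have "zz \<ge> \<rho>\<^sup>2 * p - \<rho> * K - 2 * \<rho>\<^sup>2 * \<gamma> - B"
    proof -
      have "LR \<ge> \<rho> * p - K - \<rho> * \<gamma>" using eqL LLK LMMR by simp
      then have "\<rho> * LR \<ge> \<rho> * (\<rho> * p - K - \<rho> * \<gamma>)" using \<rho> by (intro mult_left_mono) auto
      then show ?thesis using zzeq zw zr by (simp add: algebra_simps power2_eq_square)
    qed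
    ultimately show thesis using star by (simp add: p_def zz_def z_def)
  qed
qed

section \<open>Comparing spectral radii\<close>

lemma sum_adj_eq_edges:
  assumes G: "simple_graph G"
  shows "finite (edges G)" "(\<Sum>u\<in>verts G. \<Sum>v\<in>verts G. adj G u v) = 2 * real (card (edges G))"
proof -
  have fin: "finite (verts G)" using G by (simp add: simple_graph_def)
  have "edges G \<subseteq> Pow (verts G)" using G by (auto simp: simple_graph_def)
  then show fe: "finite (edges G)" using fin finite_subset by blast
  have "adj G u v = (\<Sum>e\<in>edges G. if {u, v} = e then 1 else 0)" for u v
    using fe by (simp add: adj_def)
  then have adj_eq: "adj G = (\<lambda>u v. \<Sum>e\<in>edges G. if {u, v} = e then 1 else 0)" by (intro ext)
  have "(\<Sum>u\<in>verts G. \<Sum>v\<in>verts G. adj G u v)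
      = (\<Sum>(u, v)\<in>verts G \<times> verts G. \<Sum>e\<in>edges G. if {u, v} = e then 1 else 0)"
    unfolding adj_eq by (rule sum.cartesian_product)
  also have "\<dots> = (\<Sum>e\<in>edges G. \<Sum>(u, v)\<in>verts G \<times> verts G. if {u, v} = e then 1 else 0)"
    unfolding split_def by (rule sum.swap)
  also have "\<dots> = (\<Sum>e\<in>edges G. 2)"
  proof (intro sum.cong refl)
    fix e assume "e \<in> edges G"
    then have "e \<subseteq> verts G" "card e = 2" using G by (auto simp: simple_graph_def)
    then obtain p q where e: "e = {p, q}" "p \<noteq> q" "p \<in> verts G" "q \<in> verts G"
      by (auto simp: card_2_iff)
    have "(\<Sum>(u, v)\<in>verts G \<times> verts G. if {u, v} = e then 1 else 0::real)
        = (\<Sum>(u, v)\<in>{(p, q), (q, p)}. 1)"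
      unfolding split_def using e fin
      by (intro sum.mono_neutral_cong_right) (auto simp: doubleton_eq_iff)
    also have "\<dots> = 2" using e by simp
    finally show "(\<Sum>(u, v)\<in>verts G \<times> verts G. if {u, v} = e then 1 else 0::real) = 2" .
  qed
  finally show "(\<Sum>u\<in>verts G. \<Sum>v\<in>verts G. adj G u v) = 2 * real (card (edges G))" by simp
qed

lemma graph_radius_nonneg:
  fixes G :: "'a::linorder graph"
  assumes G: "simple_graph G" and ne: "verts G \<noteq> {}"
  shows "0 \<le> graph_radius G"
proof -
  obtain x where x: "\<And>v. 0 \<le> x v" "(\<Sum>v\<in>verts G. (x v)\<^sup>2) = 1"
    "\<And>v. v \<in> verts G \<Longrightarrow> (\<Sum>u\<in>verts G. adj G v u * x u) = graph_radius G * x v"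
    and ray: "\<And>y. bform (adj G) (verts G) (verts G) y y \<le> graph_radius G * (\<Sum>v\<in>verts G. (y v)\<^sup>2)"
    by (rule graph_radius_eigenvector[OF assms]) (rule that; assumption)
  have "0 \<le> bform (adj G) (verts G) (verts G) x x"
    unfolding bform_def using x(1) by (intro sum_nonneg mult_nonneg_nonneg) auto
  with x(2) ray[of x] show ?thesis by simp
qed

lemma graph_radius_rayleigh:
  fixes G :: "'a::linorder graph"
  assumes "simple_graph G" and "verts G \<noteq> {}"
  shows "bform (adj G) (verts G) (verts G) y y \<le> graph_radius G * (\<Sum>v\<in>verts G. (y v)\<^sup>2)"
  by (rule graph_radius_eigenvector[OF assms]) blast

text \<open>The Perron vector is transported along the embedding and extended by 0. Only a set
  \<open>W\<close> containing all endpoints of edges is embedded, since \<open>G\<close> may have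
  arbitrarily many isolated vertices.\<close>

lemma graph_radius_mono:
  fixes G :: "'a::linorder graph" and H :: "'b::linorder graph"
  assumes G: "simple_graph G" "verts G \<noteq> {}" and H: "simple_graph H" "verts H \<noteq> {}"
    and W: "W \<subseteq> verts G" "\<And>u v. u \<in> verts G \<Longrightarrow> v \<in> verts G \<Longrightarrow> {u, v} \<in> edges G \<Longrightarrow> u \<in> W \<and> v \<in> W"
    and f: "inj_on f W" "f ` W \<subseteq> verts H"
    and hom: "\<And>u v. u \<in> W \<Longrightarrow> v \<in> W \<Longrightarrow> {u, v} \<in> edges G \<Longrightarrow> {f u, f v} \<in> edges H"
  shows "graph_radius G \<le> graph_radius H"
proof -
  have fin: "finite (verts G)" "finite (verts H)" using G H by (auto simp: simple_graph_def)
  obtain x where x: "\<And>v. 0 \<le> x v" "(\<Sum>v\<in>verts G. (x v)\<^sup>2) = 1"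
    "\<And>v. v \<in> verts G \<Longrightarrow> (\<Sum>u\<in>verts G. adj G v u * x u) = graph_radius G * x v"
    "\<And>y. bform (adj G) (verts G) (verts G) y y \<le> graph_radius G * (\<Sum>v\<in>verts G. (y v)\<^sup>2)"
    by (rule graph_radius_eigenvector[OF G]) (rule that; assumption)
  define y where "y w = (if w \<in> f ` W then x (the_inv_into W f w) else 0)" for w
  have yf: "y (f u) = x u" if "u \<in> W" for u
    using that f by (simp add: y_def the_inv_into_f_f)
  have y0: "0 \<le> y w" for w using x by (simp add: y_def)
  have "graph_radius G = bform (adj G) (verts G) (verts G) x x"
  proof -
    have "bform (adj G) (verts G) (verts G) x x = (\<Sum>v\<in>verts G. x v * (graph_radius G * x v))"
      unfolding bform_eq_left using x(3) by (intro sum.cong refl) simp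
    also have "\<dots> = graph_radius G * (\<Sum>v\<in>verts G. (x v)\<^sup>2)"
      by (simp add: sum_distrib_left power2_eq_square mult_ac)
    finally show ?thesis using x(2) by simp
  qed
  also have "\<dots> = (\<Sum>(u, v)\<in>verts G \<times> verts G. adj G u v * x u * x v)"
    by (simp add: bform_def sum.cartesian_product)
  also have "\<dots> = (\<Sum>(u, v)\<in>W \<times> W. adj G u v * x u * x v)"
    using W fin by (intro sum.mono_neutral_right) (auto simp: adj_def split: if_splits)
  also have "\<dots> \<le> (\<Sum>(u, v)\<in>W \<times> W. adj H (f u) (f v) * y (f u) * y (f v))"
  proof (intro sum_mono, clarify)
    fix u v assume uv: "u \<in> W" "v \<in> W"
    have "adj G u v \<le> adj H (f u) (f v)" using hom[OF uv] by (auto simp: adj_def)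
    then show "adj G u v * x u * x v \<le> adj H (f u) (f v) * y (f u) * y (f v)"
      using uv x(1) by (simp add: yf mult_right_mono)
  qed
  also have "\<dots> = (\<Sum>(u, v)\<in>f ` W \<times> f ` W. adj H u v * y u * y v)"
    by (simp add: sum.reindex[OF f(1)] flip: sum.cartesian_product)
  also have "\<dots> \<le> (\<Sum>(u, v)\<in>verts H \<times> verts H. adj H u v * y u * y v)"
    using f fin y0 by (intro sum_mono2) (auto intro!: mult_nonneg_nonneg)
  also have "\<dots> \<le> graph_radius H * (\<Sum>v\<in>verts H. (y v)\<^sup>2)"
    using graph_radius_rayleigh[OF H, of y] by (simp add: bform_def sum.cartesian_product)
  also have "(\<Sum>v\<in>verts H. (y v)\<^sup>2) = (\<Sum>v\<in>f ` W. (y v)\<^sup>2)"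
    using f fin by (intro sum.mono_neutral_right) (auto simp: y_def)
  also have "\<dots> = (\<Sum>v\<in>W. (x v)\<^sup>2)" by (simp add: sum.reindex[OF f(1)] yf)
  also have "graph_radius H * \<dots> \<le> graph_radius H * (\<Sum>v\<in>verts G. (x v)\<^sup>2)"
    using W fin graph_radius_nonneg[OF H] by (intro mult_left_mono sum_mono2) auto
  finally show ?thesis using x(2) by simp
qed

text \<open>The test vector is \<open>x\<close> on \<open>L\<close> and z/\<rho> on
  \<open>R\<close>, the values dictated by the eigenvalue equation when \<open>R\<close> spans no
  edges; edges inside \<open>R\<close> only increase the form. Counterpart of
  \<open>eigenvalue_quadratic_upper\<close>.\<close>

lemma graph_radius_quadratic_lower:
  fixes G :: "'a::linorder graph"
  assumes G: "simple_graph G" "verts G \<noteq> {}" "verts G = L \<union> R" "L \<inter> R = {}"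
    and x: "\<And>v. 0 \<le> x v" "(\<Sum>v\<in>L. (x v)\<^sup>2) = 1"
  shows "(graph_radius G)\<^sup>2 \<ge> graph_radius G * bform (adj G) L L x x
    + (\<Sum>v\<in>R. (\<Sum>u\<in>L. adj G v u * x u)\<^sup>2)"
proof -
  define \<rho> where "\<rho> = graph_radius G"
  define z where "z v = (\<Sum>u\<in>L. adj G v u * x u)" for v
  define Z where "Z = (\<Sum>v\<in>R. (z v)\<^sup>2)"
  define Q where "Q = bform (adj G) L L x x"
  have z0: "0 \<le> z v" for v unfolding z_def using x(1) by (intro sum_nonneg mult_nonneg_nonneg) auto
  have fin: "finite L" "finite R" using G by (auto simp: simple_graph_def)
  have \<rho>0: "\<rho> \<ge> 0" unfolding \<rho>_def by (rule graph_radius_nonneg[OF G(1,2)])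
  have split: "(\<Sum>v\<in>verts G. f v) = sum f L + sum f R" for f :: "'a \<Rightarrow> real"
    using G(3,4) fin by (simp add: sum.union_disjoint)
  have main: "Q + 2 * c * Z \<le> \<rho> * (1 + c\<^sup>2 * Z)" if c: "c \<ge> 0" for c
  proof -
    define y where "y v = (if v \<in> L then x v else c * z v)" for v
    have yL: "y v = x v" if "v \<in> L" for v using that by (simp add: y_def)
    have yR: "y v = c * z v" if "v \<in> R" for v using that G(4) by (auto simp: y_def)
    have in_L: "(\<Sum>v\<in>L. adj G u v * y v) = z u" for u by (simp add: z_def yL)
    have "bform (adj G) (verts G) (verts G) y y
      = bform (adj G) L L y y + bform (adj G) L R y y + bform (adj G) R L y y + bform (adj G) R R y y"
      unfolding bform_def split by (simp add: sum.distrib)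
    moreover have "bform (adj G) L L y y = Q" unfolding Q_def bform_def by (simp add: yL)
    moreover have RL: "bform (adj G) R L y y = c * Z"
      unfolding bform_eq_left in_L Z_def
      by (simp add: yR power2_eq_square sum_distrib_left mult_ac)
    moreover have "bform (adj G) L R y y = c * Z"
      using RL bform_commute[of "adj G" L R y y, OF adj_commute] by simp
    moreover have "0 \<le> bform (adj G) R R y y"
      unfolding bform_def using x(1) z0 c by (intro sum_nonneg mult_nonneg_nonneg) (auto simp: y_def)
    moreover have "(\<Sum>v\<in>verts G. (y v)\<^sup>2) = 1 + c\<^sup>2 * Z"
      unfolding split Z_def using x(2) by (simp add: yL yR power_mult_distrib sum_distrib_left)
    ultimately show ?thesis
      using graph_radius_rayleigh[OF G(1,2), of y] by (simp add: \<rho>_def algebra_simps)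
  qed
  have Z0: "Z \<ge> 0" unfolding Z_def by (intro sum_nonneg) auto
  have Q0: "Q \<ge> 0" unfolding Q_def bform_def using x(1) by (intro sum_nonneg mult_nonneg_nonneg) auto
  show ?thesis
  proof (cases "\<rho> = 0")
    case True
    then show ?thesis using main[of 1] Z0 Q0 by (simp add: \<rho>_def Z_def z_def)
  next
    case False
    then have \<rho>: "\<rho> > 0" using \<rho>0 by simp
    have "\<rho> * (Q + 2 * (1 / \<rho>) * Z) \<le> \<rho> * (\<rho> * (1 + (1 / \<rho>)\<^sup>2 * Z))"
      using main[of "1 / \<rho>"] \<rho> by (intro mult_left_mono) auto
    moreover have "\<rho> * (\<rho> * (1 + (1 / \<rho>)\<^sup>2 * Z)) = \<rho>\<^sup>2 + Z"
      using \<rho> by (simp add: power2_eq_square field_simps)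
    moreover have "\<rho> * (Q + 2 * (1 / \<rho>) * Z) = \<rho> * Q + 2 * Z"
      using \<rho> by (simp add: field_simps)
    ultimately have "\<rho>\<^sup>2 \<ge> \<rho> * Q + Z" by linarith
    then show ?thesis by (simp add: \<rho>_def Q_def Z_def z_def)
  qed
qed

text \<open>Eliminating the coordinates outside \<open>L\<close> from the eigenvalue equation; the error term
  measures the edges avoiding \<open>L\<close>.\<close>

lemma eigenvalue_quadratic_upper:
  fixes a :: "'a \<Rightarrow> 'a \<Rightarrow> real" and E \<rho> :: real
  assumes fin: "finite L" "finite R" and disj: "L \<inter> R = {}"
    and sym: "\<And>u v. a u v = a v u" and a01: "\<And>u v. a u v = 0 \<or> a u v = 1"
    and eig: "\<And>v. v \<in> L \<union> R \<Longrightarrow> (\<Sum>u\<in>L \<union> R. a v u * x u) = \<rho> * x v"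
    and \<rho>: "\<rho> > 0" and x1: "(\<Sum>v\<in>L. (x v)\<^sup>2) = 1"
    and E: "E = (\<Sum>u\<in>R. \<Sum>v\<in>R. a u v)" "E \<le> \<rho>\<^sup>2 / 4"
  shows "\<rho>\<^sup>2 \<le> \<rho> * bform a L L x x + (\<Sum>v\<in>R. (\<Sum>u\<in>L. a v u * x u)\<^sup>2)
    + card L * E * (1 / \<rho> + 2 * E / \<rho>\<^sup>2)"
proof -
  define z r where "z v = (\<Sum>u\<in>L. a v u * x u)" and "r v = (\<Sum>u\<in>R. a v u * x u)" for v
  define Az Ar where "Az v = (\<Sum>u\<in>R. a v u * z u)" and "Ar v = (\<Sum>u\<in>R. a v u * r u)" for v
  define K where "K = real (card L)"
  have asq: "(a u v)\<^sup>2 = a u v" for u v using a01[of u v] by auto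
  have a0: "0 \<le> a u v" "a u v \<le> 1" for u v using a01[of u v] by auto
  have E0: "E \<ge> 0" unfolding E(1) by (intro sum_nonneg a0)
  have eig': "z v + r v = \<rho> * x v" if "v \<in> L \<union> R" for v
    using eig[OF that] fin disj unfolding z_def r_def by (simp add: sum.union_disjoint)
  have zK: "(z v)\<^sup>2 \<le> K" for v
  proof -
    have "(z v)\<^sup>2 \<le> (\<Sum>u\<in>L. (a v u)\<^sup>2) * (\<Sum>u\<in>L. (x u)\<^sup>2)"
      unfolding z_def by (rule Cauchy_Schwarz_ineq_sum)
    also have "\<dots> \<le> (\<Sum>u\<in>L. 1) * 1" unfolding x1 asq
      using a0 by (intro mult_right_mono sum_mono) auto
    finally show ?thesis by (simp add: K_def)
  qed
  \<comment> \<open>The Frobenius norm bounds the operator norm, and for a 0/1 matrix its square is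
    the sum \<open>E\<close> of the entries. As E <= \<rho>^2/4, the restriction to \<open>R\<close>
    has norm at most \<rho>/2.\<close>
  have op: "(\<Sum>v\<in>R. (\<Sum>u\<in>R. a v u * y u)\<^sup>2) \<le> E * (\<Sum>u\<in>R. (y u)\<^sup>2)" for y :: "'a \<Rightarrow> real"
  proof -
    have "(\<Sum>v\<in>R. (\<Sum>u\<in>R. a v u * y u)\<^sup>2) \<le> (\<Sum>v\<in>R. (\<Sum>u\<in>R. (a v u)\<^sup>2) * (\<Sum>u\<in>R. (y u)\<^sup>2))"
      by (intro sum_mono Cauchy_Schwarz_ineq_sum)
    then show ?thesis unfolding E(1) asq by (simp add: sum_distrib_right)
  qed
  have Az: "(\<Sum>v\<in>R. (Az v)\<^sup>2) \<le> K * E\<^sup>2"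
  proof -
    have "(\<Sum>v\<in>R. (Az v)\<^sup>2) \<le> (\<Sum>v\<in>R. K * (\<Sum>u\<in>R. a v u) * (\<Sum>u\<in>R. a v u))"
    proof (intro sum_mono)
      fix v assume "v \<in> R"
      have "\<bar>Az v\<bar> \<le> (\<Sum>u\<in>R. a v u * sqrt K)" unfolding Az_def
      proof (rule order_trans[OF sum_abs], intro sum_mono)
        fix u show "\<bar>a v u * z u\<bar> \<le> a v u * sqrt K"
          using a0[of v u] real_le_rsqrt[OF zK[of u]] real_sqrt_le_mono[OF zK[of u]]
          by (auto simp: abs_mult intro!: mult_left_mono)
      qed
      also have "\<dots> = sqrt K * (\<Sum>u\<in>R. a v u)" by (simp add: sum_distrib_left mult_ac)
      finally have "\<bar>Az v\<bar>\<^sup>2 \<le> (sqrt K * (\<Sum>u\<in>R. a v u))\<^sup>2" by (intro power_mono) auto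
      then show "(Az v)\<^sup>2 \<le> K * (\<Sum>u\<in>R. a v u) * (\<Sum>u\<in>R. a v u)"
        by (simp add: K_def power_mult_distrib power2_eq_square[of "sum _ _"] mult.assoc)
    qed
    also have "\<dots> \<le> (\<Sum>v\<in>R. K * (\<Sum>u\<in>R. a v u) * E)"
    proof (intro sum_mono mult_left_mono)
      fix v assume "v \<in> R"
      then show "(\<Sum>u\<in>R. a v u) \<le> E" unfolding E(1)
        using fin a0 by (intro member_le_sum[of v R "\<lambda>v. \<Sum>u\<in>R. a v u"]) (auto intro: sum_nonneg)
    qed (auto simp: K_def intro!: mult_nonneg_nonneg sum_nonneg a0)
    also have "\<dots> = K * E\<^sup>2"
    proof -
      have "(\<Sum>v\<in>R. K * (\<Sum>u\<in>R. a v u) * E) = K * (\<Sum>v\<in>R. \<Sum>u\<in>R. a v u) * E"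
        by (simp only: sum_distrib_left sum_distrib_right)
      also have "\<dots> = K * E * E" by (subst E(1)) (rule refl)
      finally show ?thesis by (simp add: power2_eq_square)
    qed
    finally show ?thesis .
  qed
  define \<alpha> \<beta> where "\<alpha> = L2_set r R" and "\<beta> = L2_set Az R"
  have \<alpha>0: "\<alpha> \<ge> 0" "\<beta> \<ge> 0" by (auto simp: \<alpha>_def \<beta>_def)
  have \<beta>: "\<beta> \<le> sqrt K * E"
    unfolding \<beta>_def L2_set_def using Az E0
    by (intro real_le_lsqrt) (auto simp: K_def power_mult_distrib intro: sum_nonneg)
  have rr: "\<rho> * r v = Az v + Ar v" if "v \<in> R" for v
  proof -
    have "\<rho> * r v = (\<Sum>u\<in>R. a v u * (\<rho> * x u))" by (simp add: r_def sum_distrib_left mult_ac)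
    also have "\<dots> = (\<Sum>u\<in>R. a v u * (z u + r u))" by (intro sum.cong refl) (simp add: eig')
    finally show ?thesis by (simp add: Az_def Ar_def distrib_left sum.distrib)
  qed
  have "\<rho> * \<alpha> = L2_set (\<lambda>v. \<rho> * r v) R"
    unfolding \<alpha>_def using \<rho> by (simp add: L2_set_right_distrib)
  also have "\<dots> = L2_set (\<lambda>v. Az v + Ar v) R" by (intro L2_set_cong) (auto simp: rr)
  also have "\<dots> \<le> \<beta> + L2_set Ar R" unfolding \<beta>_def by (rule L2_set_triangle_ineq)
  also have "L2_set Ar R \<le> \<rho> / 2 * \<alpha>"
  proof -
    have "(\<Sum>v\<in>R. (Ar v)\<^sup>2) \<le> E * (\<Sum>u\<in>R. (r u)\<^sup>2)" unfolding Ar_def by (rule op)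
    also have "\<dots> \<le> \<rho>\<^sup>2 / 4 * (\<Sum>u\<in>R. (r u)\<^sup>2)" using E by (intro mult_right_mono sum_nonneg) auto
    finally have "(\<Sum>v\<in>R. (Ar v)\<^sup>2) \<le> (\<rho> / 2 * \<alpha>)\<^sup>2"
      by (simp add: \<alpha>_def L2_set_def power_mult_distrib power_divide sum_nonneg)
    then show ?thesis unfolding L2_set_def using \<rho> \<alpha>0 by (intro real_le_lsqrt) (auto intro: sum_nonneg)
  qed
  \<comment> \<open>Absorbing \<rho> \<alpha>/2 on the left bounds \<open>r\<close> by its source
    \<open>Az\<close>.\<close>
  finally have \<alpha>\<beta>: "\<rho> * \<alpha> \<le> 2 * \<beta>" by simp
  \<comment> \<open>One iteration of \<rho> r = Az + Ar. The leading term <z, Az> is at most K E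
    because z^2 <= K; by symmetry the remainder is <Az, r>, which is quadratic in
    \<open>E\<close>.\<close>
  have "\<rho> * (\<Sum>v\<in>R. z v * r v) = (\<Sum>v\<in>R. z v * Az v) + (\<Sum>v\<in>R. z v * Ar v)"
  proof -
    have "\<rho> * (\<Sum>v\<in>R. z v * r v) = (\<Sum>v\<in>R. z v * (\<rho> * r v))"
      by (simp add: sum_distrib_left mult_ac)
    also have "\<dots> = (\<Sum>v\<in>R. z v * Az v + z v * Ar v)"
      by (intro sum.cong refl) (simp add: rr distrib_left)
    finally show ?thesis by (simp add: sum.distrib)
  qed
  also have "(\<Sum>v\<in>R. z v * Ar v) = (\<Sum>v\<in>R. Az v * r v)"
    using bform_commute[of a R R z r, OF sym] unfolding bform_eq_left Az_def Ar_def
    by (simp add: mult.commute)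
  also have "(\<Sum>v\<in>R. Az v * r v) \<le> \<beta> * \<alpha>"
    unfolding \<alpha>_def \<beta>_def
    by (rule order_trans[OF _ L2_set_mult_ineq], intro sum_mono) (simp flip: abs_mult)
  also have "\<beta> * \<alpha> \<le> 2 * K * E\<^sup>2 / \<rho>"
  proof -
    have "\<rho> * (\<beta> * \<alpha>) = \<beta> * (\<rho> * \<alpha>)" by simp
    also have "\<dots> \<le> \<beta> * (2 * \<beta>)" using \<alpha>\<beta> \<alpha>0 by (intro mult_left_mono)
    also have "\<dots> = 2 * \<beta>\<^sup>2" by (simp add: power2_eq_square)
    also have "\<beta>\<^sup>2 \<le> (sqrt K * E)\<^sup>2" using \<beta> \<alpha>0 by (intro power_mono)
    also have "2 * (sqrt K * E)\<^sup>2 = 2 * K * E\<^sup>2" by (simp add: power_mult_distrib K_def)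
    finally show ?thesis using \<rho> by (simp add: field_simps)
  qed
  also have "(\<Sum>v\<in>R. z v * Az v) \<le> K * E"
  proof -
    have "(\<Sum>v\<in>R. z v * Az v) = (\<Sum>v\<in>R. \<Sum>u\<in>R. a v u * (z v * z u))"
      by (simp add: Az_def sum_distrib_left mult_ac)
    also have "\<dots> \<le> (\<Sum>v\<in>R. \<Sum>u\<in>R. a v u * K)"
    proof (intro sum_mono mult_left_mono a0)
      fix u v
      have "2 * (z v * z u) \<le> (z v)\<^sup>2 + (z u)\<^sup>2" using sum_squares_bound[of "z v" "z u"] by simp
      then show "z v * z u \<le> K" using zK[of u] zK[of v] by simp
    qed
    also have "\<dots> = K * E" unfolding E(1) by (simp add: sum_distrib_left mult.commute)
    finally show ?thesis .
  qed
  finally have "\<rho> * (\<Sum>v\<in>R. z v * r v) \<le> K * E + 2 * K * E\<^sup>2 / \<rho>" by simp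
  then have "(\<Sum>v\<in>R. z v * r v) \<le> (K * E + 2 * K * E\<^sup>2 / \<rho>) / \<rho>"
    using \<rho> by (simp add: pos_le_divide_eq mult.commute)
  also have "\<dots> = K * E * (1 / \<rho> + 2 * E / \<rho>\<^sup>2)"
    by (simp add: add_divide_distrib distrib_left power2_eq_square)
  finally have err: "(\<Sum>v\<in>R. z v * r v) \<le> K * E * (1 / \<rho> + 2 * E / \<rho>\<^sup>2)" .
  have "\<rho> * 1 = bform a L L x x + (\<Sum>v\<in>R. x v * z v)"
  proof -
    have "\<rho> * 1 = (\<Sum>v\<in>L. x v * (\<rho> * x v))"
      unfolding x1[symmetric] by (simp add: sum_distrib_left power2_eq_square mult_ac)
    also have "\<dots> = (\<Sum>v\<in>L. x v * (z v + r v))" by (intro sum.cong refl) (simp add: eig')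
    also have "\<dots> = bform a L L x x + bform a L R x x"
      by (simp add: bform_eq_left z_def r_def distrib_left sum.distrib)
    also have "bform a L R x x = (\<Sum>v\<in>R. x v * z v)"
      using bform_commute[of a L R x x, OF sym] by (simp add: bform_eq_left z_def)
    finally show ?thesis .
  qed
  then have "\<rho> * \<rho> = \<rho> * (bform a L L x x + (\<Sum>v\<in>R. x v * z v))" by simp
  also have "\<dots> = \<rho> * bform a L L x x + (\<Sum>v\<in>R. z v * (\<rho> * x v))"
    by (simp add: distrib_left sum_distrib_left mult_ac)
  also have "(\<Sum>v\<in>R. z v * (\<rho> * x v)) = (\<Sum>v\<in>R. (z v)\<^sup>2 + z v * r v)"
    by (intro sum.cong refl) (simp add: eig'[symmetric] power2_eq_square distrib_left)
  also have "\<dots> = (\<Sum>v\<in>R. (z v)\<^sup>2) + (\<Sum>v\<in>R. z v * r v)" by (rule sum.distrib)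
  finally show ?thesis using err by (simp add: power2_eq_square z_def K_def)
qed

text \<open>If \<open>x\<close> vanished on \<open>L\<close>, its restriction to \<open>R\<close>
  would be an eigenvector for \<rho> of the matrix on \<open>R\<close>, whose Frobenius norm is at
  most \<rho>/2.\<close>

lemma eigenvector_normalize_on:
  fixes a :: "'a \<Rightarrow> 'a \<Rightarrow> real"
  assumes fin: "finite L" "finite R" and disj: "L \<inter> R = {}"
    and a01: "\<And>u v. a u v = 0 \<or> a u v = 1"
    and eig: "\<And>v. v \<in> L \<union> R \<Longrightarrow> (\<Sum>u\<in>L \<union> R. a v u * x u) = \<rho> * x v"
    and \<rho>: "\<rho> > 0" and x: "\<And>v. 0 \<le> x v" "(\<Sum>v\<in>L \<union> R. (x v)\<^sup>2) = 1"
    and E: "(\<Sum>u\<in>R. \<Sum>v\<in>R. a u v) \<le> \<rho>\<^sup>2 / 4"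
  obtains y where "\<And>v. 0 \<le> y v" "(\<Sum>v\<in>L. (y v)\<^sup>2) = 1"
    "\<And>v. v \<in> L \<union> R \<Longrightarrow> (\<Sum>u\<in>L \<union> R. a v u * y u) = \<rho> * y v"
proof -
  define s where "s = (\<Sum>v\<in>L. (x v)\<^sup>2)"
  have "s \<noteq> 0"
  proof
    assume "s = 0"
    then have xL: "x v = 0" if "v \<in> L" for v using that fin by (simp add: s_def sum_nonneg_eq_0_iff)
    have asq: "(a u v)\<^sup>2 = a u v" for u v using a01[of u v] by auto
    have xR: "(\<Sum>v\<in>R. (x v)\<^sup>2) = 1"
      using x(2) \<open>s = 0\<close> fin disj by (simp add: sum.union_disjoint s_def)
    have "\<rho>\<^sup>2 = (\<Sum>v\<in>R. (\<rho> * x v)\<^sup>2)"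
      using xR by (simp add: power_mult_distrib flip: sum_distrib_left)
    also have "\<dots> = (\<Sum>v\<in>R. (\<Sum>u\<in>R. a v u * x u)\<^sup>2)"
    proof (intro sum.cong refl arg_cong[where f = "\<lambda>r. r\<^sup>2"])
      fix v assume "v \<in> R"
      then show "\<rho> * x v = (\<Sum>u\<in>R. a v u * x u)"
        using eig[of v] fin disj xL by (simp add: sum.union_disjoint)
    qed
    also have "\<dots> \<le> (\<Sum>v\<in>R. (\<Sum>u\<in>R. (a v u)\<^sup>2) * (\<Sum>u\<in>R. (x u)\<^sup>2))"
      by (intro sum_mono Cauchy_Schwarz_ineq_sum)
    also have "\<dots> \<le> \<rho>\<^sup>2 / 4" using E by (simp add: xR asq)
    finally show False using \<rho> by simp
  qed
  moreover have "s \<ge> 0" unfolding s_def by (intro sum_nonneg) auto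
  ultimately have s: "s > 0" by simp
  show thesis
  proof (rule that[of "\<lambda>v. x v / sqrt s"])
    show "0 \<le> x v / sqrt s" for v using x s by simp
    show "(\<Sum>v\<in>L. (x v / sqrt s)\<^sup>2) = 1"
      using s by (simp add: power_divide s_def flip: sum_divide_distrib)
    show "(\<Sum>u\<in>L \<union> R. a v u * (x u / sqrt s)) = \<rho> * (x v / sqrt s)" if "v \<in> L \<union> R" for v
      using eig[OF that] by (simp add: sum_divide_distrib[symmetric])
  qed
qed

text \<open>For f(s) = s (k - s) one has f(s) + f(b) - f(s + b) = 2 s b. If s + b wraps around, the
  symmetry f(s) = f(k - s) gives 2 c d with c = k - s and d = k - b. The gain 2 is the integrality
  gap that later beats all analytic errors.\<close>

lemma residue_defect_add:
  fixes s b k :: nat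
  assumes "s < k" "b < k"
  shows "((s + b) mod k) * (k - (s + b) mod k) + (if s = 0 \<or> b = 0 then 0 else 2) \<le> s * (k - s) + b * (k - b)"
proof (cases "s + b < k")
  case True
  then have m: "(s + b) mod k = s + b" by simp
  obtain j where "k = s + b + j" using True less_imp_add_positive by blast
  then have "k - (s + b) = j" "k - s = b + j" "k - b = s + j" by auto
  moreover have "s \<noteq> 0 \<Longrightarrow> b \<noteq> 0 \<Longrightarrow> 2 \<le> b * s + b * s" by (cases s; cases b) auto
  ultimately show ?thesis unfolding m by (auto simp: algebra_simps)
next
  case False
  then have m: "(s + b) mod k = s + b - k" using assms by (simp add: mod_if)
  define c d where "c = k - s" and "d = k - b"
  have sb: "s = k - c" "b = k - d" "c \<ge> 1" "d \<ge> 1" "c + d \<le> k" "c \<le> k" "d \<le> k"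
    using assms False by (auto simp: c_def d_def)
  obtain j where j: "k = c + d + j" using sb by (metis le_iff_add)
  have "s = d + j" "b = c + j" "s + b - k = j" using sb j by auto
  moreover have "2 \<le> c * d + c * d" using sb by (cases c; cases d) auto
  ultimately show ?thesis unfolding m using j by (auto simp: algebra_simps)
qed

text \<open>Optimality of the split graph in arithmetic form. Scaled by \<open>k\<close>, a vertex
  with \<open>b\<close> neighbours in \<open>L\<close> costs b (k - b) and an edge avoiding
  \<open>L\<close> costs \<open>k\<close>; for the same number of edges the split graph pays r (k -
  r). The surplus E + (card P - 1) makes the comparison strict unless E = 0 and \<open>P\<close> has
  at most one element.\<close>

lemma residue_defect_sum:
  fixes b :: "'a \<Rightarrow> nat" and k E :: nat
  assumes k: "k \<ge> 1" and P: "finite P" and b: "\<And>v. v \<in> P \<Longrightarrow> 1 \<le> b v \<and> b v < k"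
  defines "r \<equiv> (sum b P + E) mod k"
  shows "r * (k - r) + E + (card P - 1) \<le> k * E + (\<Sum>v\<in>P. b v * (k - b v))"
proof -
  \<comment> \<open>The deduction of 1 is dropped when the residue is 0: that reserve pays for the
    next vertex, which meets residue 0 and yields no gain.\<close>
  have 1: "(sum b P mod k) * (k - sum b P mod k) + (card P - (if sum b P mod k = 0 then 0 else 1))
      \<le> (\<Sum>v\<in>P. b v * (k - b v))"
    using P b
  proof (induction P rule: finite_induct)
    case empty
    then show ?case by simp
  next
    case (insert p P)
    define s where "s = sum b P mod k"
    have s: "s < k" using k by (simp add: s_def)
    have bp: "1 \<le> b p" "b p < k" using insert.prems by auto
    have m: "(sum b (insert p P)) mod k = (s + b p) mod k"
      using insert.hyps by (simp add: s_def mod_simps add.commute)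
    have IH: "s * (k - s) + (card P - (if s = 0 then 0 else 1)) \<le> (\<Sum>v\<in>P. b v * (k - b v))"
      using insert.IH insert.prems by (simp add: s_def)
    show ?case
      unfolding m using IH residue_defect_add[OF s bp(2)] bp insert.hyps
      by (cases "s = 0") (auto split: if_splits)
  qed
  \<comment> \<open>A single edge shifts the residue by 1, so s (k - s) grows by at most k - 1, one
    less than the cost \<open>k\<close> of the edge.\<close>
  have 2: "((s + E) mod k) * (k - (s + E) mod k) + E \<le> s * (k - s) + k * E" if "s < k" for s
  proof (induction E)
    case 0
    then show ?case using that by simp
  next
    case (Suc E)
    define s' where "s' = (s + E) mod k"
    have s': "s' < k" using k by (simp add: s'_def)
    have m: "(s + Suc E) mod k = (s' + 1) mod k" by (simp add: s'_def mod_simps)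
    show ?case
    proof (cases "k = 1")
      case True
      then show ?thesis by simp
    next
      case False
      then have "1 < k" using k by simp
      have "((s' + 1) mod k) * (k - (s' + 1) mod k) \<le> s' * (k - s') + (k - 1)"
        using residue_defect_add[OF s' \<open>1 < k\<close>] by simp
      then show ?thesis using Suc.IH k unfolding m s'_def[symmetric] by simp
    qed
  qed
  have "r = (sum b P mod k + E) mod k" by (simp add: r_def mod_simps)
  then show ?thesis using 1 2[of "sum b P mod k"] k by (simp split: if_splits)
qed

section \<open>The split graph\<close>

text \<open>The alternative \<open>k = 0\<close> in the last part is due to
  \<open>x mod 0 = x\<close>: then \<open>r\<close> is not below \<open>k\<close>, and the last
  vertex can get neighbours outside the empty clique.\<close>

lemma split_graph_structure:
  fixes k m :: nat
  defines "q \<equiv> (m - (k choose 2)) div k" and "r \<equiv> (m - (k choose 2)) mod k"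
  shows "verts (split_graph k m) = {..k + q}"
    and "\<And>i j. i < k \<Longrightarrow> j < k \<Longrightarrow> i \<noteq> j \<Longrightarrow> {i, j} \<in> edges (split_graph k m)"
    and "\<And>i j. i < k \<Longrightarrow> k \<le> j \<Longrightarrow> j < k + q \<Longrightarrow> {i, j} \<in> edges (split_graph k m)"
    and "\<And>i. i < r \<Longrightarrow> {i, k + q} \<in> edges (split_graph k m)"
    and "\<And>i j. k \<le> i \<Longrightarrow> k \<le> j \<Longrightarrow> {i, j} \<notin> edges (split_graph k m) \<or> k = 0"
proof -
  note d = split_graph_def Let_def q_def[symmetric] r_def[symmetric]
  show "verts (split_graph k m) = {..k + q}" by (simp add: d)
  show "{i, j} \<in> edges (split_graph k m)" if "i < k" "j < k" "i \<noteq> j" for i j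
  proof (cases "i < j")
    case True
    then show ?thesis using that by (auto simp: d)
  next
    case False
    then have "{i, j} = {j, i} \<and> j < i \<and> i < k" using that by auto
    then show ?thesis unfolding d by auto
  qed
  show "{i, j} \<in> edges (split_graph k m)" if "i < k" "k \<le> j" "j < k + q" for i j
    using that by (auto simp: d)
  show "{i, k + q} \<in> edges (split_graph k m)" if "i < r" for i
    using that by (auto simp: d)
  show "{i, j} \<notin> edges (split_graph k m) \<or> k = 0" if "k \<le> i" "k \<le> j" for i j
  proof (rule disjCI)
    assume "k \<noteq> 0"
    then have "r < k" by (simp add: r_def)
    then show "{i, j} \<notin> edges (split_graph k m)"
      using that by (auto simp: d doubleton_eq_iff)
  qed
qed

lemma sum_adj_bool: "finite L \<Longrightarrow> (\<Sum>u\<in>L. adj G v u) = real (card {u \<in> L. {v, u} \<in> edges G})"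
  unfolding adj_def by (subst sum.inter_filter[symmetric]) simp_all

text \<open>Entrywise the adjacency matrix is at most J - I, with J the all-ones matrix, and
  \<open>x\<close> is nonnegative of norm 1.\<close>

lemma bform_adj_unit_le:
  assumes G: "simple_graph G" and L: "finite L" and x: "\<And>v. 0 \<le> x v" "(\<Sum>v\<in>L. (x v)\<^sup>2) = 1"
  shows "bform (adj G) L L x x \<le> (sum x L)\<^sup>2 - 1"
proof -
  have "bform (adj G) L L x x + (\<Sum>v\<in>L. (x v)\<^sup>2)
      = (\<Sum>u\<in>L. \<Sum>v\<in>L. adj G u v * x u * x v + (if v = u then x u * x v else 0))"
    using L by (simp add: bform_def sum.distrib power2_eq_square)
  also have "\<dots> \<le> (\<Sum>u\<in>L. \<Sum>v\<in>L. x u * x v)"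
  proof (intro sum_mono)
    fix u v
    have "adj G u v * (x u * x v) \<le> 1 * (x u * x v)"
      using x(1) by (intro mult_right_mono mult_nonneg_nonneg) auto
    then show "adj G u v * x u * x v + (if v = u then x u * x v else 0) \<le> x u * x v"
      using G by (simp add: mult.assoc)
  qed
  also have "\<dots> = (sum x L)\<^sup>2" by (simp add: sum_product power2_eq_square)
  finally show ?thesis using x(2) by simp
qed

lemma adj_row_square_le:
  assumes x: "(\<Sum>v\<in>L. (x v)\<^sup>2) = 1"
  shows "(\<Sum>u\<in>L. adj G v u * x u)\<^sup>2 \<le> (\<Sum>u\<in>L. adj G v u)"
proof -
  have "(\<Sum>u\<in>L. adj G v u * x u)\<^sup>2 \<le> (\<Sum>u\<in>L. (adj G v u)\<^sup>2) * (\<Sum>u\<in>L. (x u)\<^sup>2)"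
    by (rule Cauchy_Schwarz_ineq_sum)
  also have "(\<Sum>u\<in>L. (adj G v u)\<^sup>2) = (\<Sum>u\<in>L. adj G v u)"
    by (intro sum.cong) (auto simp: adj_def)
  finally show ?thesis by (simp add: x)
qed

lemma sum_adj_split:
  assumes G: "simple_graph G" "verts G = L \<union> R" "L \<inter> R = {}"
  shows "(\<Sum>u\<in>L. \<Sum>v\<in>L. adj G u v) + 2 * (\<Sum>v\<in>R. \<Sum>u\<in>L. adj G v u)
    + (\<Sum>u\<in>R. \<Sum>v\<in>R. adj G u v) = 2 * real (card (edges G))"
proof -
  have fin: "finite L" "finite R" using G by (auto simp: simple_graph_def)
  have "(\<Sum>u\<in>L. \<Sum>v\<in>R. adj G u v) = (\<Sum>v\<in>R. \<Sum>u\<in>L. adj G v u)"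
    by (subst sum.swap) (simp add: adj_commute)
  then show ?thesis
    using sum_adj_eq_edges(2)[OF G(1)] fin G(3) unfolding G(2)
    by (simp add: sum.union_disjoint sum.distrib)
qed

text \<open>The constant unit vector on the clique in \<open>graph_radius_quadratic_lower\<close>:
  each of the \<open>q\<close> common neighbours contributes \<open>k\<close>, and the last vertex
  r^2/k. The deficit of r^2/k against its \<open>r\<close> edges is r (k - r)/k, the cost of the
  split graph.\<close>

lemma split_graph_radius_lower:
  fixes k m :: nat
  defines "q \<equiv> (m - (k choose 2)) div k" and "r \<equiv> (m - (k choose 2)) mod k"
  assumes k: "k \<ge> 1"
  shows "(graph_radius (split_graph k m))\<^sup>2
    \<ge> (real k - 1) * graph_radius (split_graph k m) + real (k * q) + (real r)\<^sup>2 / real k"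
proof -
  define S where "S = split_graph k m"
  note S = split_graph_structure[where k = k and m = m, folded q_def r_def S_def]
  have r: "r < k" using k by (simp add: r_def)
  have G: "simple_graph S" unfolding S_def by (rule simple_split_graph[OF k])
  define x where "x = (\<lambda>_::nat. 1 / sqrt (real k))"
  have sq: "sqrt (real k) * sqrt (real k) = real k" by simp
  have x1: "(\<Sum>v<k. (x v)\<^sup>2) = 1" using k by (simp add: x_def power_divide)
  have V: "verts S = {..<k} \<union> {k..k + q}" unfolding S(1) by auto
  have "(graph_radius S)\<^sup>2 \<ge> graph_radius S * bform (adj S) {..<k} {..<k} x x
    + (\<Sum>v\<in>{k..k + q}. (\<Sum>u<k. adj S v u * x u)\<^sup>2)"
    by (rule graph_radius_quadratic_lower[OF G _ V]) (auto simp: S(1) x1, simp add: x_def)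
  moreover have "bform (adj S) {..<k} {..<k} x x = real k - 1"
  proof -
    have "bform (adj S) {..<k} {..<k} x x = (\<Sum>u<k. \<Sum>v<k. (1 - (if v = u then 1 else 0)) * (1 / k))"
      unfolding bform_def
    proof (intro sum.cong refl)
      fix u v assume "u \<in> {..<k}" "v \<in> {..<k}"
      then have "adj S u v = 1 - (if v = u then 1 else 0)"
        using S(2)[of u v] adj_self[OF G, of u] by (cases "v = u") (simp_all add: adj_def[of S u v])
      then show "adj S u v * x u * x v = (1 - (if v = u then 1 else 0)) * (1 / k)"
        by (simp add: x_def mult.assoc sq)
    qed
    also have "\<dots> = (\<Sum>u<k. (real k - 1) * (1 / k))"
      by (intro sum.cong refl) (simp add: sum_subtractf flip: sum_distrib_right sum_divide_distrib)
    finally show ?thesis using k by simp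
  qed
  moreover have "(\<Sum>v\<in>{k..k + q}. (\<Sum>u<k. adj S v u * x u)\<^sup>2) \<ge> real (k * q) + (real r)\<^sup>2 / real k"
  proof -
    have full: "(\<Sum>u<k. adj S v u * x u)\<^sup>2 = real k" if "v \<in> {k..<k + q}" for v
    proof -
      have "(\<Sum>u<k. adj S v u * x u) = (\<Sum>u<k. 1 / sqrt (real k))"
        using S(3)[of _ v] that by (intro sum.cong refl) (auto simp: adj_def x_def insert_commute)
      then show ?thesis using k by (simp add: real_div_sqrt)
    qed
    have part: "(\<Sum>u<k. adj S (k + q) u * x u)\<^sup>2 \<ge> (real r)\<^sup>2 / real k"
    proof -
      have "r / sqrt (real k) = (\<Sum>u<r. adj S (k + q) u * x u)"
        using S(4) by (simp add: adj_def x_def insert_commute)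
      also have "\<dots> \<le> (\<Sum>u<k. adj S (k + q) u * x u)"
        using r by (intro sum_mono2) (auto simp: x_def)
      finally have "(r / sqrt (real k))\<^sup>2 \<le> (\<Sum>u<k. adj S (k + q) u * x u)\<^sup>2"
        by (intro power_mono) auto
      then show ?thesis by (simp add: power_divide)
    qed
    have "{k..k + q} = insert (k + q) {k..<k + q}" by auto
    then have "(\<Sum>v\<in>{k..k + q}. (\<Sum>u<k. adj S v u * x u)\<^sup>2)
        = (\<Sum>u<k. adj S (k + q) u * x u)\<^sup>2 + (\<Sum>v\<in>{k..<k + q}. real k)"
      using full by simp
    then show ?thesis using part by simp
  qed
  ultimately show ?thesis unfolding S_def by (simp add: mult.commute)
qed

text \<open>All edges meet the clique, so \<open>eigenvalue_quadratic_upper\<close> holds without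
  error and gives \<rho>^2 <= (k - 1) \<rho> + m. Used for the random graphs, whose average degree
  beats this crude bound.\<close>

lemma split_graph_radius_upper:
  fixes k m :: nat
  assumes k: "k \<ge> 1" and m: "m \<ge> k choose 2"
  shows "graph_radius (split_graph k m) \<le> sqrt m + k"
proof -
  define q where "q = (m - (k choose 2)) div k"
  define S where "S = split_graph k m"
  note S = split_graph_structure[where k = k and m = m, folded q_def S_def]
  have G: "simple_graph S" unfolding S_def by (rule simple_split_graph[OF k])
  have V: "verts S = {..<k} \<union> {k..k + q}" unfolding S(1) by auto
  have ne: "verts S \<noteq> {}" unfolding S(1) by auto
  define \<rho> where "\<rho> = graph_radius S"
  have E: "(\<Sum>u\<in>{k..k + q}. \<Sum>v\<in>{k..k + q}. adj S u v) = 0"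
    using S(5) k by (intro sum.neutral ballI) (auto simp: adj_def)
  show ?thesis
  proof (cases "\<rho> > 0")
    case False
    then show ?thesis unfolding \<rho>_def S_def
      by (smt (verit) of_nat_0_le_iff real_sqrt_ge_zero)
  next
    case True
    obtain x where x: "\<And>v. 0 \<le> x v" "(\<Sum>v\<in>verts S. (x v)\<^sup>2) = 1"
      "\<And>v. v \<in> verts S \<Longrightarrow> (\<Sum>u\<in>verts S. adj S v u * x u) = graph_radius S * x v"
      "\<And>y. bform (adj S) (verts S) (verts S) y y \<le> graph_radius S * (\<Sum>v\<in>verts S. (y v)\<^sup>2)"
      by (rule graph_radius_eigenvector[OF G ne]) (rule that; assumption)
    have fin: "finite {..<k}" "finite {k..k + q}" "{..<k} \<inter> {k..k + q} = {}" by auto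
    have a01: "adj S u v = 0 \<or> adj S u v = 1" for u v by (simp add: adj_def)
    have E4: "(\<Sum>u\<in>{k..k + q}. \<Sum>v\<in>{k..k + q}. adj S u v) \<le> \<rho>\<^sup>2 / 4" unfolding E by simp
    have xV: "(\<Sum>u\<in>{..<k} \<union> {k..k + q}. adj S v u * x u) = \<rho> * x v"
      if "v \<in> {..<k} \<union> {k..k + q}" for v
      using x(3)[of v] that unfolding V \<rho>_def .
    obtain y where y: "\<And>v. 0 \<le> y v" "(\<Sum>v<k. (y v)\<^sup>2) = 1"
      "\<And>v. v \<in> {..<k} \<union> {k..k + q} \<Longrightarrow> (\<Sum>u\<in>{..<k} \<union> {k..k + q}. adj S v u * y u) = \<rho> * y v"
      by (rule eigenvector_normalize_on[OF fin a01 xV True x(1) x(2)[unfolded V] E4])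
        (assumption | (rule that; assumption))+
    have "\<rho>\<^sup>2 \<le> \<rho> * bform (adj S) {..<k} {..<k} y y + (\<Sum>v\<in>{k..k + q}. (\<Sum>u<k. adj S v u * y u)\<^sup>2)"
      using eigenvalue_quadratic_upper[OF fin adj_commute a01 y(3) True y(2) refl E4] unfolding E by simp
    also have "\<dots> \<le> \<rho> * (real k - 1) + (\<Sum>v\<in>{k..k + q}. \<Sum>u<k. adj S v u)"
    proof (intro add_mono mult_left_mono sum_mono adj_row_square_le y)
      have "(sum y {..<k})\<^sup>2 \<le> (\<Sum>v<k. (y v)\<^sup>2) * card {..<k}" by (rule sum_squared_le_sum_of_squares)
      then show "bform (adj S) {..<k} {..<k} y y \<le> real k - 1"
        using bform_adj_unit_le[OF G _ y(1,2)] y(2) by simp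
    qed (use True in auto)
    also have "(\<Sum>v\<in>{k..k + q}. \<Sum>u<k. adj S v u) \<le> real m"
    proof -
      have "0 \<le> (\<Sum>u<k. \<Sum>v<k. adj S u v)" by (intro sum_nonneg) auto
      then show ?thesis
        using sum_adj_split[OF G V] E card_edges_split_graph[OF k m] fin(3) by (simp add: S_def)
    qed
    finally have 1: "\<rho> * (\<rho> - (real k - 1)) \<le> real m" by (simp add: power2_eq_square algebra_simps)
    show ?thesis
    proof (rule ccontr)
      assume "\<not> ?thesis"
      then have gt: "\<rho> > sqrt m + k" by (simp add: \<rho>_def S_def)
      have "sqrt m * sqrt m < \<rho> * (\<rho> - (real k - 1))"
        using gt k by (intro mult_strict_mono') auto
      then show False using 1 by simp
    qed
  qed
qed

lemma real_choose_two: "real (n choose 2) = real n * (real n - 1) / 2"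
  by (cases n) (simp_all add: choose_two real_of_nat_div algebra_simps)

text \<open>Up to isolated vertices, such a graph is a subgraph of the split graph.\<close>

lemma near_split_graph_radius_le:
  fixes G :: "'a::linorder graph"
  assumes k: "k \<ge> 1" and G: "simple_graph G" and VLR: "verts G = L \<union> R" "L \<inter> R = {}"
    and L: "card L = k" "finite L"
    and indep: "\<And>u v. u \<in> R \<Longrightarrow> v \<in> R \<Longrightarrow> {u, v} \<notin> edges G"
    and b: "\<And>v. b v = card {u \<in> L. {v, u} \<in> edges G}"
    and P: "P = {v \<in> R. 1 \<le> b v \<and> b v < k}" "card P \<le> 1" "finite P"
    and F: "F = {v \<in> R. b v = k}" "finite F"
    and m: "m - (k choose 2) = k * card F + sum b P"
  shows "graph_radius G \<le> graph_radius (split_graph k m)"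
proof -
  define q r where "q = (m - (k choose 2)) div k" and "r = (m - (k choose 2)) mod k"
  define S where "S = split_graph k m"
  note S = split_graph_structure[where k = k and m = m, folded q_def r_def S_def]
  \<comment> \<open>The neighbours of the at most one partially joined vertex. They must be mapped
    onto the first \<open>r\<close> clique vertices, which forces the piecewise bijection
    \<open>f\<close> below.\<close>
  define N where "N = {u \<in> L. \<exists>v\<in>P. {v, u} \<in> edges G}"
  have bP: "sum b P < k \<and> card N = sum b P"
  proof (cases "P = {}")
    case True
    then show ?thesis using k by (simp add: N_def)
  next
    case False
    with P(2,3) have "card P = 1" by (metis One_nat_def Suc_leI card_gt_0_iff le_antisym)
    then obtain p where p: "P = {p}" by (auto simp: card_1_singleton_iff)
    then have "p \<in> {v \<in> R. 1 \<le> b v \<and> b v < k}" using P(1) by simp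
    then show ?thesis using p by (simp add: N_def b)
  qed
  have qr: "q = card F" "r = card N" using bP by (auto simp: q_def r_def m)
  have NL: "N \<subseteq> L" "finite N" using L by (auto simp: N_def)
  obtain g1 where g1: "bij_betw g1 N {..<r}"
    using NL(2) qr(2) by (metis card_lessThan finite_lessThan finite_same_card_bij)
  have "card (L - N) = card {r..<k}" using NL L qr by (simp add: card_Diff_subset)
  then obtain g2 where g2: "bij_betw g2 (L - N) {r..<k}"
    using L by (metis finite_Diff finite_atLeastLessThan finite_same_card_bij)
  obtain h where h: "bij_betw h F {k..<k + q}"
    using F(2) qr(1) by (metis card_atLeastLessThan diff_add_inverse finite_atLeastLessThan finite_same_card_bij)
  have rk: "r < k" using k by (simp add: r_def)
  \<comment> \<open>The default value \<open>k + q\<close> is also taken by vertices without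
    neighbours in \<open>L\<close>; injectivity is claimed only on
    \<open>L \<union> F \<union> P\<close>.\<close>
  define f where "f v = (if v \<in> N then g1 v else if v \<in> L then g2 v else if v \<in> F then h v else k + q)" for v
  have fN: "f v < r" if "v \<in> N" for v using that g1 by (auto simp: f_def bij_betw_def)
  have fL': "r \<le> f v \<and> f v < k" if "v \<in> L - N" for v
    using that g2 by (auto simp: f_def dest: bij_betwE)
  have fL: "f v < k" if "v \<in> L" for v using fN[of v] fL'[of v] that rk by fastforce
  have FL: "v \<notin> L \<and> v \<notin> N" if "v \<in> F \<union> P" for v using that VLR NL by (auto simp: F P)
  have fF: "k \<le> f v \<and> f v < k + q" if "v \<in> F" for v
    using that h FL[of v] by (auto simp: f_def dest: bij_betwE)
  have fP: "f v = k + q" if "v \<in> P" for v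
    using that FL[of v] by (auto simp: f_def F P)
  have "inj_on f N" using g1 by (auto simp: bij_betw_def inj_on_def f_def)
  moreover have "inj_on f (L - N)" using g2 by (auto simp: bij_betw_def inj_on_def f_def)
  moreover have "inj_on f F" using h FL by (auto simp: bij_betw_def inj_on_def f_def)
  moreover have "inj_on f P" using P(2,3) by (auto simp: inj_on_def card_le_Suc0_iff_eq)
  ultimately have inj: "inj_on f (L \<union> F \<union> P)"
  proof -
    assume i: "inj_on f N" "inj_on f (L - N)" "inj_on f F" "inj_on f P"
    show ?thesis
    proof (rule inj_onI)
      fix u v assume uv: "u \<in> L \<union> F \<union> P" "v \<in> L \<union> F \<union> P" "f u = f v"
      have cls: "w \<in> N \<and> f w < r \<or> w \<in> L - N \<and> r \<le> f w \<and> f w < k \<or> w \<in> F \<and> k \<le> f w \<and> f w < k + q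
          \<or> w \<in> P \<and> f w = k + q" if "w \<in> L \<union> F \<union> P" for w
        using that fN fL' fF fP NL by blast
      from cls[OF uv(1)] cls[OF uv(2)] uv(3) rk
      have "u \<in> N \<and> v \<in> N \<or> u \<in> L - N \<and> v \<in> L - N \<or> u \<in> F \<and> v \<in> F \<or> u \<in> P \<and> v \<in> P"
        by (elim disjE; simp)
      then show "u = v" using i uv(3) by (auto dest: inj_onD)
    qed
  qed
  have b0: "v \<in> F \<union> P" if "v \<in> R" "u \<in> L" "{u, v} \<in> edges G" for u v
  proof -
    have "{u' \<in> L. {v, u'} \<in> edges G} \<noteq> {}" using that by (auto simp: insert_commute)
    then have "1 \<le> b v" unfolding b using L by (simp add: Suc_le_eq card_gt_0_iff)
    moreover have "b v \<le> k" unfolding b L(1)[symmetric] using L by (intro card_mono) auto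
    ultimately show ?thesis using that by (auto simp: F P)
  qed
  have hom0: "{f u, f v} \<in> edges S" if "u \<in> L" "v \<in> L \<union> F \<union> P" "{u, v} \<in> edges G" for u v
  proof -
    have uv: "u \<noteq> v" using that G by (auto simp: simple_graph_def)
    consider "v \<in> L" | "v \<in> F" | "v \<in> P" using \<open>v \<in> L \<union> F \<union> P\<close> by blast
    then show ?thesis
    proof cases
      case 1
      then have "f u \<noteq> f v" using inj uv that by (auto dest: inj_onD)
      then show ?thesis using S(2) fL 1 that by auto
    next
      case 2
      then show ?thesis using S(3) fL fF that by auto
    next
      case 3
      then have "u \<in> N" using that by (auto simp: N_def insert_commute)
      then show ?thesis using S(4)[OF fN] fP[OF 3] by simp
    qed
  qed
  have "graph_radius G \<le> graph_radius S"
  proof (rule graph_radius_mono[where W = "L \<union> F \<union> P" and f = f])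
    show "verts G \<noteq> {}" using VLR L k by auto
    show "simple_graph S" unfolding S_def by (rule simple_split_graph[OF k])
    show "verts S \<noteq> {}" unfolding S(1) by auto
    show "L \<union> F \<union> P \<subseteq> verts G" using VLR by (auto simp: F P)
    show "u \<in> L \<union> F \<union> P \<and> v \<in> L \<union> F \<union> P"
      if "u \<in> verts G" "v \<in> verts G" "{u, v} \<in> edges G" for u v
      using that indep b0[of u v] b0[of v u] unfolding VLR by (auto simp: insert_commute)
    show "f ` (L \<union> F \<union> P) \<subseteq> verts S" unfolding S(1) using fL fF fP by fastforce
    show "{f u, f v} \<in> edges S" if "u \<in> L \<union> F \<union> P" "v \<in> L \<union> F \<union> P" "{u, v} \<in> edges G" for u v
    proof -
      have "u \<in> L \<or> v \<in> L" using that indep by (auto simp: F P)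
      then show ?thesis using hom0[of u v] hom0[of v u] that by (auto simp: insert_commute)
    qed
  qed (use G inj in auto)
  then show ?thesis by (simp add: S_def)
qed

text \<open>The eigenvector is almost constant on \<open>L\<close>. Every edge avoiding \<open>L\<close> and every vertex outside \<open>L\<close>
  with \<open>b\<close> neighbours in \<open>L\<close>, where \<open>0 < b < k\<close>, then costs a constant in \<open>\<rho>\<^sup>2\<close>, the latter about
  \<open>b (k - b) / k\<close>; the split graph minimises the total cost among graphs with \<open>m\<close> edges.\<close>

theorem split_graph_local_maximum:
  fixes G :: "'a::linorder graph"
  assumes k: "k \<ge> 1" and m: "m \<ge> 2048 * k ^ 6"
    and G: "simple_graph G" "card (edges G) = m"
    and L: "L \<subseteq> verts G" "card L \<le> k"
    and Q: "Q \<subseteq> verts G - L" "\<And>u v. u \<in> L \<Longrightarrow> v \<in> Q \<Longrightarrow> {u, v} \<in> edges G"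
    and LQ: "real (card L * card Q) \<ge> (1 - 1 / (256 * real k ^ 2)) * real m"
  shows "graph_radius G \<le> graph_radius (split_graph k m)"
proof (rule ccontr)
  assume neg: "\<not> ?thesis"
  define \<rho> \<sigma> where "\<rho> = graph_radius G" and "\<sigma> = graph_radius (split_graph k m)"
  have gt: "\<rho> > \<sigma>" using neg by (simp add: \<rho>_def \<sigma>_def)
  define q r where "q = (m - (k choose 2)) div k" and "r = (m - (k choose 2)) mod k"
  define \<kappa> where "\<kappa> = real k"
  have \<kappa>: "\<kappa> \<ge> 1" using k by (simp add: \<kappa>_def)
  have mk: "real m \<ge> 2048 * \<kappa> ^ 6" 
    using of_nat_mono[OF m, where 'a = real] by (simp add: \<kappa>_def)
  have pw: "\<kappa> \<le> \<kappa>\<^sup>2" "\<kappa>\<^sup>2 \<le> \<kappa> ^ 3" "\<kappa> ^ 3 \<le> \<kappa> ^ 6" "1 \<le> \<kappa>\<^sup>2"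
    by (rule self_le_power[OF \<kappa>], simp) (rule power_increasing[OF _ \<kappa>] one_le_power[OF \<kappa>], simp?)+
  have C: "real (k choose 2) = \<kappa> * (\<kappa> - 1) / 2" by (simp add: real_choose_two \<kappa>_def)
  have C2: "real (k choose 2) \<le> \<kappa>\<^sup>2 / 2" unfolding C using \<kappa> by (simp add: power2_eq_square field_simps)
  have Cm: "k choose 2 \<le> m"
  proof -
    have "real (k choose 2) \<le> real m" using C2 mk pw by linarith
    then show ?thesis by simp
  qed
  have rk: "r < k" using k by (simp add: r_def)
  have qr: "real m - real (k choose 2) = \<kappa> * real q + real r"
  proof -
    have "m - (k choose 2) = k * q + r" by (simp add: q_def r_def)
    then have "real (m - (k choose 2)) = real (k * q + r)" by simp
    then show ?thesis using Cm by (simp add: of_nat_diff \<kappa>_def)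
  qed
  have low_S: "\<sigma>\<^sup>2 \<ge> (\<kappa> - 1) * \<sigma> + \<kappa> * real q + (real r)\<^sup>2 / \<kappa>"
    using split_graph_radius_lower[OF k, of m] by (simp add: \<sigma>_def q_def r_def \<kappa>_def)
  have "0 \<le> \<sigma>" unfolding \<sigma>_def
    by (rule graph_radius_nonneg[OF simple_split_graph[OF k]]) (auto simp: split_graph_structure(1))
  have qpos: "\<kappa> * real q \<ge> real m - \<kappa>\<^sup>2 / 2 - \<kappa>"
    using qr C2 rk by (simp add: \<kappa>_def)
  \<comment> \<open>This places \<sigma> on the increasing branch of s^2 - (k - 1) s, so that \<rho>
    > \<sigma> carries over to the quadratic expressions.\<close>
  have "\<sigma> \<ge> \<kappa> - 1"
  proof (rule ccontr)
    assume a: "\<not> \<sigma> \<ge> \<kappa> - 1"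
    then have "\<sigma> * \<sigma> \<le> (\<kappa> - 1) * \<sigma>" using \<open>0 \<le> \<sigma>\<close> by (intro mult_right_mono) auto
    moreover have "\<kappa> * real q > 0" using qpos mk pw by linarith
    moreover have "(real r)\<^sup>2 / \<kappa> \<ge> 0" using \<kappa> by simp
    ultimately show False using low_S by (simp add: power2_eq_square)
  qed
  then have "(\<rho> - \<sigma>) * (\<rho> + \<sigma> - (\<kappa> - 1)) > 0" using gt \<open>0 \<le> \<sigma>\<close>
    by (intro mult_pos_pos) auto
  then have "\<rho>\<^sup>2 - (\<kappa> - 1) * \<rho> > \<sigma>\<^sup>2 - (\<kappa> - 1) * \<sigma>" by (simp add: power2_eq_square algebra_simps)
  then have low: "\<rho>\<^sup>2 > (\<kappa> - 1) * \<rho> + \<kappa> * real q + (real r)\<^sup>2 / \<kappa>" using low_S by simp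
  have \<rho>0: "\<rho> > 0" using gt \<open>0 \<le> \<sigma>\<close> by simp
  have low2: "\<rho>\<^sup>2 \<ge> (\<kappa> - 1) * \<rho> + real m - 2 * \<kappa>\<^sup>2"
  proof -
    have "(real r)\<^sup>2 / \<kappa> \<ge> 0" using \<kappa> by simp
    then show ?thesis using low qpos pw by linarith
  qed
  have \<rho>m: "\<rho>\<^sup>2 \<ge> real m / 2"
  proof -
    have "(\<kappa> - 1) * \<rho> \<ge> 0" using \<kappa> \<rho>0 by simp
    then show ?thesis using low2 mk pw by linarith
  qed
  \<comment> \<open>2048 = 2 * 32^2: \<open>m\<close> is taken so large that \<rho> >= 32 k^3, and
    losses linear in \<rho> outweigh constants of order k^3.\<close>
  have \<rho>k: "\<rho> \<ge> 32 * \<kappa> ^ 3"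
  proof (rule power2_le_imp_le)
    have "(32 * \<kappa> ^ 3)\<^sup>2 = 1024 * \<kappa> ^ 6" by (simp add: power_mult_distrib flip: power_mult)
    then show "(32 * \<kappa> ^ 3)\<^sup>2 \<le> \<rho>\<^sup>2" using \<rho>m mk by linarith
  qed (use \<rho>0 in simp)
  define R where "R = verts G - L"
  have V: "verts G = L \<union> R" "L \<inter> R = {}" using L by (auto simp: R_def)
  have fin: "finite L" "finite R" using G L by (auto simp: simple_graph_def R_def intro: finite_subset)
  have mpos: "real m > 0" using mk pw \<kappa> by linarith
  have eps: "1 / (256 * \<kappa>\<^sup>2) \<le> 1 / 256" using pw by (intro divide_left_mono) auto
  have LQ': "real (card L) * real (card Q) \<ge> (1 - 1 / (256 * \<kappa>\<^sup>2)) * real m"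
    using LQ by (simp add: \<kappa>_def)
  have half: "real (card L) * real (card Q) \<ge> real m / 2"
  proof -
    have "(1 / 2) * real m \<le> (1 - 1 / (256 * \<kappa>\<^sup>2)) * real m" using eps by (intro mult_right_mono) auto
    then show ?thesis using LQ' by linarith
  qed
  then have Lne: "L \<noteq> {}" using mpos by auto
  then have ne: "verts G \<noteq> {}" using V by auto
  have QR: "Q \<subseteq> R" using Q by (simp add: R_def)
  define b where "b v = card {u \<in> L. {v, u} \<in> edges G}" for v
  have bsum: "(\<Sum>u\<in>L. adj G v u) = real (b v)" for v using sum_adj_bool[OF fin(1)] by (simp add: b_def)
  have bL: "b v \<le> card L" for v unfolding b_def using fin by (intro card_mono) auto
  define E where "E = (\<Sum>u\<in>R. \<Sum>v\<in>R. adj G u v)"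
  define eL where "eL = (\<Sum>u\<in>L. \<Sum>v\<in>L. adj G u v)"
  have E0: "E \<ge> 0" "eL \<ge> 0" by (auto simp: E_def eL_def intro!: sum_nonneg)
  have tot: "eL + 2 * (\<Sum>v\<in>R. real (b v)) + E = 2 * real m"
    using sum_adj_split[OF G(1) V] G(2) by (simp add: E_def eL_def bsum)
  have bQ: "b v = card L" if "v \<in> Q" for v
  proof -
    have "{u \<in> L. {v, u} \<in> edges G} = L" using Q(2)[OF _ that] by (auto simp: insert_commute)
    then show ?thesis by (simp add: b_def)
  qed
  have Esmall: "E \<le> real m / (128 * \<kappa>\<^sup>2)"
  proof -
    have "real (card L) * real (card Q) = (\<Sum>v\<in>Q. real (b v))" using bQ by simp
    also have "\<dots> \<le> (\<Sum>v\<in>R. real (b v))" using QR fin by (intro sum_mono2) auto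
    finally have "E \<le> 2 * real m - 2 * ((1 - 1 / (256 * \<kappa>\<^sup>2)) * real m)" using tot LQ' E0 by linarith
    also have "\<dots> = real m / (128 * \<kappa>\<^sup>2)" by (simp add: field_simps)
    finally show ?thesis .
  qed
  have E\<rho>: "E \<le> \<rho>\<^sup>2 / (64 * \<kappa>\<^sup>2)"
  proof -
    have "real m / (128 * \<kappa>\<^sup>2) = (real m / 2) / (64 * \<kappa>\<^sup>2)" by simp
    also have "\<dots> \<le> \<rho>\<^sup>2 / (64 * \<kappa>\<^sup>2)" using \<rho>m \<kappa> by (intro divide_right_mono) auto
    finally show ?thesis using Esmall by linarith
  qed
  have E4: "(\<Sum>u\<in>R. \<Sum>v\<in>R. adj G u v) \<le> \<rho>\<^sup>2 / 4"
  proof -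
    have "\<rho>\<^sup>2 / (64 * \<kappa>\<^sup>2) \<le> \<rho>\<^sup>2 / 4" using pw by (intro divide_left_mono) auto
    then show ?thesis using E\<rho> by (simp add: E_def)
  qed
  obtain y where y: "\<And>v. 0 \<le> y v" "(\<Sum>v\<in>verts G. (y v)\<^sup>2) = 1"
    "\<And>v. v \<in> verts G \<Longrightarrow> (\<Sum>u\<in>verts G. adj G v u * y u) = graph_radius G * y v"
    "\<And>y. bform (adj G) (verts G) (verts G) y y \<le> graph_radius G * (\<Sum>v\<in>verts G. (y v)\<^sup>2)"
    by (rule graph_radius_eigenvector[OF G(1) ne]) (rule that; assumption)
  have yV: "(\<Sum>u\<in>L \<union> R. adj G v u * y u) = \<rho> * y v" if "v \<in> L \<union> R" for v
    using y(3)[of v] that unfolding V(1) \<rho>_def .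
  have a01: "adj G u v = 0 \<or> adj G u v = 1" for u v by (simp add: adj_def)
  obtain x where x: "\<And>v. 0 \<le> x v" "(\<Sum>v\<in>L. (x v)\<^sup>2) = 1"
    "\<And>v. v \<in> L \<union> R \<Longrightarrow> (\<Sum>u\<in>L \<union> R. adj G v u * x u) = \<rho> * x v"
    by (rule eigenvector_normalize_on[OF fin V(2) a01 yV \<rho>0 y(1) y(2)[unfolded V(1)] E4])
      (assumption | (rule that; assumption))+
  define A z where "A = bform (adj G) L L x x" and "z v = (\<Sum>u\<in>L. adj G v u * x u)" for v
  have up: "\<rho>\<^sup>2 \<le> \<rho> * A + (\<Sum>v\<in>R. (z v)\<^sup>2) + E / (16 * \<kappa>)"
  proof -
    have "\<rho>\<^sup>2 \<le> \<rho> * A + (\<Sum>v\<in>R. (z v)\<^sup>2) + card L * E * (1 / \<rho> + 2 * E / \<rho>\<^sup>2)"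
      unfolding A_def z_def
      by (rule eigenvalue_quadratic_upper[OF fin V(2) adj_commute a01 x(3) \<rho>0 x(2) E_def])
        (use E4 in \<open>simp_all add: E_def\<close>)
    also have "card L * E * (1 / \<rho> + 2 * E / \<rho>\<^sup>2) \<le> E / (16 * \<kappa>)"
    proof -
      have "1 / \<rho> \<le> 1 / (32 * \<kappa> ^ 3)" using \<rho>k \<rho>0 \<kappa> by (intro divide_left_mono) auto
      also have "\<dots> \<le> 1 / (32 * \<kappa>\<^sup>2)" using pw \<kappa> by (intro divide_left_mono) auto
      finally have 1: "1 / \<rho> \<le> 1 / (32 * \<kappa>\<^sup>2)" .
      have 2: "2 * E / \<rho>\<^sup>2 \<le> 1 / (32 * \<kappa>\<^sup>2)" 
      proof -
        have "2 * E / \<rho>\<^sup>2 \<le> 2 * (\<rho>\<^sup>2 / (64 * \<kappa>\<^sup>2)) / \<rho>\<^sup>2"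
          using E\<rho> by (intro divide_right_mono mult_left_mono) auto
        then show ?thesis using \<rho>0 by simp
      qed
      have "card L * E * (1 / \<rho> + 2 * E / \<rho>\<^sup>2) \<le> \<kappa> * E * (1 / (32 * \<kappa>\<^sup>2) + 1 / (32 * \<kappa>\<^sup>2))"
        using 1 2 E0 L(2) \<rho>0 \<kappa> by (intro mult_mono add_mono) (auto simp: \<kappa>_def)
      also have "\<dots> = E / (16 * \<kappa>)" using \<kappa> by (simp add: power2_eq_square field_simps)
      finally show ?thesis .
    qed
    finally show ?thesis by simp
  qed
  define s where "s = sum x L"
  have A_le: "A \<le> s\<^sup>2 - 1" unfolding A_def s_def by (rule bform_adj_unit_le[OF G(1) fin(1) x(1,2)])
  have s_le: "s\<^sup>2 \<le> real (card L)"
    using sum_squared_le_sum_of_squares[of x L] x(2) by (simp add: s_def)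
  define F where "F = {v \<in> R. b v = card L}"
  have finF: "finite F" "F \<subseteq> R" using fin by (auto simp: F_def)
  have QF: "Q \<subseteq> F" using QR bQ by (auto simp: F_def)
  have zF: "z v = s" if "v \<in> F" for v
  proof -
    have "{u \<in> L. {v, u} \<in> edges G} = L"
      using that fin by (intro card_subset_eq) (auto simp: F_def b_def)
    then have "adj G v u = 1" if "u \<in> L" for u using that by (auto simp: adj_def)
    then show ?thesis by (simp add: z_def s_def)
  qed
  have zb: "(z v)\<^sup>2 \<le> real (b v)" for v
    unfolding z_def using adj_row_square_le[OF x(2), of G v] by (simp add: bsum)
  \<comment> \<open>By Cauchy-Schwarz \<open>\<eta>\<close> vanishes exactly when \<open>x\<close>
    is constant on \<open>L\<close>; every vertex joined to all of \<open>L\<close> loses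
    \<open>\<eta>\<close> against its number of neighbours there.\<close>
  define \<eta> where "\<eta> = real (card L) - s\<^sup>2"
  have \<eta>0: "\<eta> \<ge> 0" using s_le by (simp add: \<eta>_def)
  have zsum: "(\<Sum>v\<in>R. (z v)\<^sup>2) \<le> (\<Sum>v\<in>R. real (b v)) - real (card F) * \<eta>"
  proof -
    have "(\<Sum>v\<in>R. (z v)\<^sup>2) \<le> (\<Sum>v\<in>R. real (b v) - (if v \<in> F then \<eta> else 0))"
    proof (intro sum_mono)
      fix v assume "v \<in> R"
      show "(z v)\<^sup>2 \<le> real (b v) - (if v \<in> F then \<eta> else 0)"
        using zF[of v] zb[of v] by (auto simp: F_def \<eta>_def)
    qed
    also have "\<dots> = (\<Sum>v\<in>R. real (b v)) - real (card F) * \<eta>"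
      using fin finF by (simp add: sum_subtractf sum.If_cases Int_absorb1)
    finally show ?thesis .
  qed
  have up2: "\<rho>\<^sup>2 \<le> \<rho> * A + real m - real (card F) * \<eta>"
  proof -
    have "E / (16 * \<kappa>) \<le> E / 2" using E0 \<kappa> by (intro divide_left_mono) auto
    then show ?thesis using up zsum tot E0 by linarith
  qed
  have up3: "\<rho>\<^sup>2 \<le> \<rho> * (real (card L) - 1) + real m - real (card F) * \<eta>"
  proof -
    have "\<rho> * A \<le> \<rho> * (real (card L) - 1)" using A_le s_le \<rho>0 by (intro mult_left_mono) auto
    then show ?thesis using up2 by linarith
  qed
  have big: "\<rho> > 2 * \<kappa>\<^sup>2"
    using \<rho>k pw \<kappa> by linarith
  \<comment> \<open>With fewer than \<open>k\<close> vertices in \<open>L\<close> the linear term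
    loses at least \<rho>, more than the bounded terms can repair.\<close>
  have ck: "card L = k"
  proof (rule ccontr)
    assume "card L \<noteq> k"
    then have "real (card L) \<le> \<kappa> - 1" using L(2) by (simp add: \<kappa>_def)
    then have "\<rho> * (real (card L) - 1) \<le> \<rho> * (\<kappa> - 2)" using \<rho>0 by (intro mult_left_mono) auto
    moreover have "real (card F) * \<eta> \<ge> 0" using \<eta>0 by simp
    ultimately have "(\<kappa> - 1) * \<rho> - 2 * \<kappa>\<^sup>2 \<le> \<rho> * (\<kappa> - 2)" using up3 low2 by linarith
    then have "\<rho> \<le> 2 * \<kappa>\<^sup>2" by (simp add: algebra_simps)
    then show False using big by simp
  qed
  have cF: "real (card F) \<ge> real m / (2 * \<kappa>)"
  proof -
    have "card Q \<le> card F" using QF finF by (intro card_mono)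
    then have "\<kappa> * real (card Q) \<le> \<kappa> * real (card F)" using \<kappa> by (intro mult_left_mono) auto
    then have "real m / 2 \<le> \<kappa> * real (card F)" using half ck by (simp add: \<kappa>_def)
    then show ?thesis using \<kappa> by (simp add: field_simps)
  qed
  \<comment> \<open>For card L = k the linear terms of \<open>up3\<close> and \<open>low2\<close>
    cancel, leaving card F * \<eta> <= 2 k^2 with card F at least m/(2k).\<close>
  have \<eta>: "\<eta> \<le> 1 / (512 * \<kappa> ^ 3)"
  proof -
    have "real (card F) * \<eta> \<le> 2 * \<kappa>\<^sup>2"
      using up3 low2 ck by (simp add: \<kappa>_def algebra_simps)
    moreover have "real m / (2 * \<kappa>) * \<eta> \<le> real (card F) * \<eta>" using cF \<eta>0 by (intro mult_right_mono)
    moreover have "1024 * \<kappa> ^ 5 * \<eta> \<le> real m / (2 * \<kappa>) * \<eta>"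
    proof (intro mult_right_mono \<eta>0)
      have "1024 * \<kappa> ^ 5 = (2048 * \<kappa> ^ 6) / (2 * \<kappa>)" using \<kappa> by (simp add: eval_nat_numeral)
      also have "\<dots> \<le> real m / (2 * \<kappa>)" using mk \<kappa> by (intro divide_right_mono) auto
      finally show "1024 * \<kappa> ^ 5 \<le> real m / (2 * \<kappa>)" .
    qed
    ultimately have "1024 * \<kappa> ^ 5 * \<eta> \<le> 2 * \<kappa>\<^sup>2" by linarith
    then have "\<kappa>\<^sup>2 * (512 * \<kappa> ^ 3 * \<eta>) \<le> \<kappa>\<^sup>2 * 1" by (simp add: eval_nat_numeral mult_ac)
    then have "512 * \<kappa> ^ 3 * \<eta> \<le> 1" using \<kappa> by (subst (asm) mult_le_cancel_left_pos) auto
    then show ?thesis using \<kappa> by (simp add: field_simps)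
  qed
  define \<xi> where "\<xi> u = x u - s / \<kappa>" for u
  have \<xi>: "(\<Sum>u\<in>L. (\<xi> u)\<^sup>2) = \<eta> / \<kappa>"
  proof -
    have "(\<Sum>u\<in>L. (\<xi> u)\<^sup>2) = (\<Sum>u\<in>L. (x u)\<^sup>2 - 2 * (s / \<kappa>) * x u + (s / \<kappa>)\<^sup>2)"
      by (intro sum.cong refl) (simp add: \<xi>_def power2_eq_square algebra_simps)
    also have "\<dots> = 1 - 2 * (s / \<kappa>) * s + \<kappa> * (s / \<kappa>)\<^sup>2"
      unfolding sum.distrib sum_subtractf sum_distrib_left[symmetric] x(2) s_def[symmetric]
      by (simp add: ck \<kappa>_def)
    also have "\<dots> = \<eta> / \<kappa>" using \<kappa> ck by (simp add: \<eta>_def power2_eq_square field_simps \<kappa>_def)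
    finally show ?thesis .
  qed
  have \<eta>k: "\<eta> / \<kappa> \<le> 1 / (512 * \<kappa> ^ 4)"
  proof -
    have "\<eta> / \<kappa> \<le> 1 / (512 * \<kappa> ^ 3) / \<kappa>" using \<eta> \<kappa> by (intro divide_right_mono) auto
    then show ?thesis by (simp add: eval_nat_numeral mult_ac)
  qed
  have s0: "s \<ge> 0" unfolding s_def using x(1) by (intro sum_nonneg) auto
  have s_sqrt: "s \<le> sqrt \<kappa>" using s_le ck by (intro real_le_rsqrt) (simp add: \<kappa>_def)
  \<comment> \<open>A missing edge uw inside \<open>L\<close> lowers \<open>A\<close> by 2 x_u x_w
    >= 1/(2k), as \<open>x\<close> is nearly constant on \<open>L\<close>. The loss \<rho>/(2k)
    again exceeds the bounded terms.\<close>
  have complete: "{u, w} \<in> edges G" if uw: "u \<in> L" "w \<in> L" "u \<noteq> w" for u w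
  proof (rule ccontr)
    assume no: "{u, w} \<notin> edges G"
    have lower: "x v \<ge> 1 / (2 * sqrt \<kappa>)" if "v \<in> L" for v
    proof -
      have "(\<xi> v)\<^sup>2 \<le> \<eta> / \<kappa>" unfolding \<xi>[symmetric] using that fin by (intro member_le_sum) auto
      also have "\<dots> \<le> (1 / (4 * sqrt \<kappa>))\<^sup>2"
      proof -
        have "\<kappa> \<le> \<kappa> ^ 4" using \<kappa> power_increasing[of 1 4 \<kappa>] by simp
        then have "1 / (512 * \<kappa> ^ 4) \<le> 1 / (16 * \<kappa>)" using \<kappa> by (intro divide_left_mono) auto
        then show ?thesis using \<eta>k \<kappa> by (simp add: power_divide power_mult_distrib)
      qed
      finally have "\<bar>\<xi> v\<bar>\<^sup>2 \<le> (1 / (4 * sqrt \<kappa>))\<^sup>2" by simp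
      then have "\<bar>\<xi> v\<bar> \<le> 1 / (4 * sqrt \<kappa>)"
        by (rule power2_le_imp_le) (use \<kappa> in simp)
      moreover have "s \<ge> 3 / 4 * sqrt \<kappa>"
      proof (rule power2_le_imp_le[OF _ s0])
        have "1 / (512 * \<kappa> ^ 3) \<le> 1 / 512" using \<kappa> by (simp add: one_le_power field_simps)
        then have "s\<^sup>2 \<ge> \<kappa> - 1 / 512" using \<eta> ck by (simp add: \<eta>_def \<kappa>_def)
        then show "(3 / 4 * sqrt \<kappa>)\<^sup>2 \<le> s\<^sup>2" using \<kappa> by (simp add: power_mult_distrib power2_eq_square)
      qed
      then have "s / \<kappa> \<ge> 3 / 4 * sqrt \<kappa> / \<kappa>" using \<kappa> by (intro divide_right_mono) auto
      moreover have "3 / 4 * sqrt \<kappa> / \<kappa> = 3 / 4 * (1 / sqrt \<kappa>)" using \<kappa> real_div_sqrt[of \<kappa>]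
        by (simp add: field_simps)
      moreover have "1 / (4 * sqrt \<kappa>) = 1 / 4 * (1 / sqrt \<kappa>)" "1 / (2 * sqrt \<kappa>) = 1 / 2 * (1 / sqrt \<kappa>)"
        by simp_all
      ultimately show ?thesis unfolding \<xi>_def by linarith
    qed
    have xx: "1 / (2 * \<kappa>) \<le> 2 * (x u * x w)"
    proof -
      have "1 / (2 * sqrt \<kappa>) * (1 / (2 * sqrt \<kappa>)) \<le> x u * x w"
        using lower uw \<kappa> x(1) by (intro mult_mono) auto
      moreover have "1 / (2 * sqrt \<kappa>) * (1 / (2 * sqrt \<kappa>)) = 1 / (4 * \<kappa>)" using \<kappa> by simp
      ultimately show ?thesis by simp
    qed
    have "A + 2 * (x u * x w) \<le> s\<^sup>2 - 1"
    proof -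
      \<comment> \<open>Adding the missing edge keeps the graph simple, so the general bound on the
        form applies with the edge's contribution included.\<close>
      define H where "H = Graph (verts G) (insert {u, w} (edges G))"
      have H: "simple_graph H" using G(1) uw L by (auto simp: H_def simple_graph_def)
      have "bform (adj H) L L x x = (\<Sum>i\<in>L. \<Sum>j\<in>L. adj G i j * x i * x j
          + (if i = u then if j = w then x u * x w else 0 else 0)
          + (if i = w then if j = u then x u * x w else 0 else 0))"
        unfolding bform_def using no no[unfolded insert_commute[of u w]] uw
        by (intro sum.cong refl) (auto simp: adj_def H_def doubleton_eq_iff)
      also have "\<dots> = A + 2 * (x u * x w)"
      proof -
        have "(\<Sum>i\<in>L. \<Sum>j\<in>L. if i = p then if j = p' then c else 0 else 0) = c"
          if "p \<in> L" "p' \<in> L" for p p' and c :: real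
        proof -
          have "(\<Sum>j\<in>L. if i = p then if j = p' then c else 0 else 0) = (if i = p then c else 0)" for i
            using that fin by (cases "i = p") simp_all
          then show ?thesis using that fin by simp
        qed
        then show ?thesis using uw by (simp add: sum.distrib A_def bform_def)
      qed
      finally show ?thesis using bform_adj_unit_le[OF H fin(1) x(1,2)] by (simp add: s_def)
    qed
    then have "A \<le> \<kappa> - 1 - 1 / (2 * \<kappa>)" using xx s_le ck by (simp add: \<kappa>_def)
    then have "\<rho> * A \<le> \<rho> * (\<kappa> - 1 - 1 / (2 * \<kappa>))" using \<rho>0 by (intro mult_left_mono) auto
    moreover have "real (card F) * \<eta> \<ge> 0" using \<eta>0 by simp
    ultimately have "(\<kappa> - 1) * \<rho> - 2 * \<kappa>\<^sup>2 \<le> \<rho> * (\<kappa> - 1 - 1 / (2 * \<kappa>))" using up2 low2 by linarith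
    then have "\<rho> / (2 * \<kappa>) \<le> 2 * \<kappa>\<^sup>2" by (simp add: algebra_simps)
    then have "\<rho> \<le> 4 * \<kappa> ^ 3" using \<kappa> by (simp add: field_simps eval_nat_numeral)
    then show False using \<rho>k pw \<kappa> by linarith
  qed
  have eL: "eL = \<kappa> * (\<kappa> - 1)"
  proof -
    have "eL = (\<Sum>u\<in>L. \<Sum>v\<in>L. 1 - (if v = u then 1 else 0))"
      unfolding eL_def
    proof (intro sum.cong refl)
      fix u v assume "u \<in> L" "v \<in> L"
      then show "adj G u v = 1 - (if v = u then 1 else 0)"
        using complete[of u v] adj_self[OF G(1), of u] by (cases "v = u") (simp_all add: adj_def[of G u v])
    qed
    then show ?thesis using fin ck by (simp add: sum_subtractf \<kappa>_def)
  qed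
  define P where "P = {v \<in> R. 1 \<le> b v \<and> b v < k}"
  have finP: "finite P" "P \<subseteq> R" "P \<inter> F = {}" using fin ck by (auto simp: P_def F_def)
  \<comment> \<open>Splitting \<open>x\<close> into mean and deviation: the mean contributes b s/k
    with s <= sqrt k, hence b^2/k after squaring, and the deviation part \<open>D\<close> has D^2 <=
    \<eta>. Cross term and square add up to at most 1/(11 k) + 1/(512 k), below 1/(8 k).\<close>
  have zP: "(z v)\<^sup>2 \<le> (real (b v))\<^sup>2 / \<kappa> + 1 / (8 * \<kappa>)" if "v \<in> P" for v
  proof -
    define D where "D = (\<Sum>u\<in>L. adj G v u * \<xi> u)"
    have bk: "real (b v) \<le> \<kappa>" using bL[of v] ck by (simp add: \<kappa>_def)
    have zD: "z v = real (b v) * (s / \<kappa>) + D"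
    proof -
      have "z v = (\<Sum>u\<in>L. adj G v u * (s / \<kappa>) + adj G v u * \<xi> u)"
        unfolding z_def by (intro sum.cong refl) (simp add: \<xi>_def algebra_simps)
      then show ?thesis by (simp only: D_def sum.distrib sum_distrib_right[symmetric] bsum)
    qed
    have "D\<^sup>2 \<le> (\<Sum>u\<in>L. (adj G v u)\<^sup>2) * (\<Sum>u\<in>L. (\<xi> u)\<^sup>2)"
      unfolding D_def by (rule Cauchy_Schwarz_ineq_sum)
    also have "(\<Sum>u\<in>L. (adj G v u)\<^sup>2) = (\<Sum>u\<in>L. adj G v u)"
      by (intro sum.cong refl) (auto simp: adj_def)
    also have "\<dots> * (\<Sum>u\<in>L. (\<xi> u)\<^sup>2) \<le> \<kappa> * (\<eta> / \<kappa>)"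
      unfolding bsum \<xi> using bk \<eta>0 \<kappa> by (intro mult_right_mono) auto
    also have "\<dots> = \<eta>" using \<kappa> by simp
    finally have D\<eta>: "D\<^sup>2 \<le> \<eta>" .
    have "z v \<le> real (b v) / sqrt \<kappa> + \<bar>D\<bar>" "0 \<le> z v"
    proof -
      have "real (b v) * (s / \<kappa>) \<le> real (b v) * (sqrt \<kappa> / \<kappa>)"
        using s_sqrt \<kappa> by (intro mult_left_mono divide_right_mono) auto
      also have "sqrt \<kappa> / \<kappa> = 1 / sqrt \<kappa>" using \<kappa> by (simp add: field_simps)
      finally show "z v \<le> real (b v) / sqrt \<kappa> + \<bar>D\<bar>" unfolding zD by simp
      show "0 \<le> z v" unfolding z_def using x(1) by (intro sum_nonneg mult_nonneg_nonneg) auto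
    qed
    then have "(z v)\<^sup>2 \<le> (real (b v) / sqrt \<kappa> + \<bar>D\<bar>)\<^sup>2" by (intro power_mono)
    also have "\<dots> = (real (b v))\<^sup>2 / \<kappa> + 2 * (real (b v) / sqrt \<kappa>) * \<bar>D\<bar> + D\<^sup>2"
      using \<kappa> by (simp add: power2_sum power_divide)
    also have "2 * (real (b v) / sqrt \<kappa>) * \<bar>D\<bar> \<le> 2 * sqrt \<kappa> * (1 / (22 * (\<kappa> * sqrt \<kappa>)))"
    proof (rule mult_mono)
      show "\<bar>D\<bar> \<le> 1 / (22 * (\<kappa> * sqrt \<kappa>))"
      proof (rule power2_le_imp_le)
        have "1 / (512 * \<kappa> ^ 3) \<le> 1 / (484 * \<kappa> ^ 3)" using \<kappa> by (intro divide_left_mono) auto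
        moreover have "(1 / (22 * (\<kappa> * sqrt \<kappa>)))\<^sup>2 = 1 / (484 * \<kappa> ^ 3)"
          using \<kappa> by (simp add: power_divide power_mult_distrib power3_eq_cube power2_eq_square[of \<kappa>])
        ultimately show "\<bar>D\<bar>\<^sup>2 \<le> (1 / (22 * (\<kappa> * sqrt \<kappa>)))\<^sup>2"
          using D\<eta> \<eta> by simp
      qed (use \<kappa> in simp)
      have "real (b v) / sqrt \<kappa> \<le> \<kappa> / sqrt \<kappa>" using bk \<kappa> by (intro divide_right_mono) auto
      then show "2 * (real (b v) / sqrt \<kappa>) \<le> 2 * sqrt \<kappa>" using \<kappa> by (simp add: real_div_sqrt)
    qed (use \<kappa> in auto)
    also have "2 * sqrt \<kappa> * (1 / (22 * (\<kappa> * sqrt \<kappa>))) = 1 / (11 * \<kappa>)" using \<kappa> by simp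
    also have "D\<^sup>2 \<le> 1 / (512 * \<kappa>)"
    proof -
      have "1 / (512 * \<kappa> ^ 3) \<le> 1 / (512 * \<kappa>)" using \<kappa> pw by (intro divide_left_mono) auto
      then show ?thesis using D\<eta> \<eta> by linarith
    qed
    finally have "(z v)\<^sup>2 \<le> (real (b v))\<^sup>2 / \<kappa> + (1 / (11 * \<kappa>) + 1 / (512 * \<kappa>))" by simp
    also have "1 / (11 * \<kappa>) + 1 / (512 * \<kappa>) \<le> 1 / (8 * \<kappa>)" using \<kappa> by (simp add: field_simps)
    finally show ?thesis by simp
  qed
  have Rsplit: "(\<Sum>v\<in>R. f v) = (\<Sum>v\<in>F. f v) + (\<Sum>v\<in>P. f v)" if "\<And>v. b v = 0 \<Longrightarrow> f v = 0" for f :: "'a \<Rightarrow> real"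
  proof -
    have "(\<Sum>v\<in>R. f v) = (\<Sum>v\<in>F \<union> P. f v)"
    proof (intro sum.mono_neutral_right fin ballI)
      fix v assume v: "v \<in> R - (F \<union> P)"
      then have "b v = 0" using bL[of v] ck by (auto simp: F_def P_def)
      then show "f v = 0" by (rule that)
    qed (use finF finP in auto)
    also have "\<dots> = (\<Sum>v\<in>F. f v) + (\<Sum>v\<in>P. f v)"
      using finF finP by (intro sum.union_disjoint) auto
    finally show ?thesis .
  qed
  have z0: "z v = 0" if "b v = 0" for v using zb[of v] that by simp
  have bsplit: "(\<Sum>v\<in>R. real (b v)) = \<kappa> * real (card F) + (\<Sum>v\<in>P. real (b v))"
  proof -
    have "(\<Sum>v\<in>F. real (b v)) = \<kappa> * real (card F)" using ck by (simp add: F_def \<kappa>_def)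
    then show ?thesis using Rsplit[of "\<lambda>v. real (b v)"] by simp
  qed
  have up4: "\<rho>\<^sup>2 \<le> \<rho> * (\<kappa> - 1) + \<kappa> * real (card F) + (\<Sum>v\<in>P. (real (b v))\<^sup>2) / \<kappa>
      + real (card P) / (8 * \<kappa>) + E / (16 * \<kappa>)"
  proof -
    have "(\<Sum>v\<in>R. (z v)\<^sup>2) = (\<Sum>v\<in>F. s\<^sup>2) + (\<Sum>v\<in>P. (z v)\<^sup>2)"
      using Rsplit[of "\<lambda>v. (z v)\<^sup>2"] z0 zF by simp
    also have "\<dots> \<le> (\<Sum>v\<in>F. \<kappa>) + (\<Sum>v\<in>P. (real (b v))\<^sup>2 / \<kappa> + 1 / (8 * \<kappa>))"
      using s_le ck zP by (intro add_mono sum_mono) (auto simp: \<kappa>_def)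
    also have "\<dots> = \<kappa> * real (card F) + (\<Sum>v\<in>P. (real (b v))\<^sup>2) / \<kappa> + real (card P) / (8 * \<kappa>)"
      by (simp add: sum.distrib sum_divide_distrib)
    finally have "(\<Sum>v\<in>R. (z v)\<^sup>2) \<le> \<kappa> * real (card F) + (\<Sum>v\<in>P. (real (b v))\<^sup>2) / \<kappa> + real (card P) / (8 * \<kappa>)" .
    moreover have "\<rho> * A \<le> \<rho> * (\<kappa> - 1)"
      using A_le s_le \<rho>0 ck by (intro mult_left_mono) (auto simp: \<kappa>_def)
    ultimately show ?thesis using up by linarith
  qed
  \<comment> \<open>The number of edges avoiding \<open>L\<close>; \<open>E\<close> counts each of
    them twice.\<close>
  define e where "e = m - (k choose 2) - (k * card F + sum b P)"
  have eE: "E = 2 * real e" and me: "m - (k choose 2) = k * card F + sum b P + e"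
  proof -
    have "2 * real m = \<kappa> * (\<kappa> - 1) + 2 * (\<kappa> * real (card F) + real (sum b P)) + E"
      using tot bsplit by (simp add: eL)
    then have 1: "real m = real (k choose 2) + real (k * card F + sum b P) + E / 2"
      by (simp add: C \<kappa>_def)
    then have "real ((k choose 2) + (k * card F + sum b P)) \<le> real m" using E0 by simp
    then have 2: "(k choose 2) + (k * card F + sum b P) \<le> m" by (simp only: of_nat_le_iff)
    then show "m - (k choose 2) = k * card F + sum b P + e" by (simp add: e_def)
    have "real m = real ((k choose 2) + (k * card F + sum b P) + e)" using 2 by (simp add: e_def)
    then show "E = 2 * real e" using 1 by simp
  qed
  have r_eq: "r = (sum b P + e) mod k" unfolding r_def me by (simp only: add.assoc mod_mult_self4)
  have defect: "r * (k - r) + e + (card P - 1) \<le> k * e + (\<Sum>v\<in>P. b v * (k - b v))"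
    unfolding r_eq by (rule residue_defect_sum[OF k finP(1)]) (simp add: P_def)
  have defect': "real r * (\<kappa> - real r) + real e + real (card P - 1)
      \<le> \<kappa> * real e + \<kappa> * real (sum b P) - (\<Sum>v\<in>P. (real (b v))\<^sup>2)"
  proof -
    have "real (r * (k - r) + e + (card P - 1)) \<le> real (k * e + (\<Sum>v\<in>P. b v * (k - b v)))"
      using defect by (simp only: of_nat_le_iff)
    moreover have "real (\<Sum>v\<in>P. b v * (k - b v)) = (\<Sum>v\<in>P. \<kappa> * real (b v) - (real (b v))\<^sup>2)"
      unfolding of_nat_sum
    proof (intro sum.cong refl)
      fix v assume "v \<in> P"
      then have "b v \<le> k" by (simp add: P_def)
      then show "real (b v * (k - b v)) = \<kappa> * real (b v) - (real (b v))\<^sup>2"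
        by (simp add: \<kappa>_def of_nat_diff algebra_simps power2_eq_square)
    qed
    ultimately show ?thesis using rk by (simp add: \<kappa>_def of_nat_diff sum_subtractf flip: sum_distrib_left)
  qed
  have "\<kappa> * real q + (real r)\<^sup>2 / \<kappa> < \<kappa> * real (card F) + (\<Sum>v\<in>P. (real (b v))\<^sup>2) / \<kappa>
      + real (card P) / (8 * \<kappa>) + real e / (8 * \<kappa>)"
    using low up4 by (simp add: eE mult.commute)
  then have "\<kappa> * (\<kappa> * real q + (real r)\<^sup>2 / \<kappa>) < \<kappa> * (\<kappa> * real (card F) + (\<Sum>v\<in>P. (real (b v))\<^sup>2) / \<kappa>
      + real (card P) / (8 * \<kappa>) + real e / (8 * \<kappa>))"
    using \<kappa> by (intro mult_strict_left_mono) auto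
  then have "\<kappa> * (\<kappa> * real q) + (real r)\<^sup>2 < \<kappa> * (\<kappa> * real (card F)) + (\<Sum>v\<in>P. (real (b v))\<^sup>2)
      + real (card P) / 8 + real e / 8"
    using \<kappa> by (simp add: distrib_left)
  moreover have "\<kappa> * real q + real r = \<kappa> * real (card F) + real (sum b P) + real e"
  proof -
    have "real (m - (k choose 2)) = real (k * card F + sum b P + e)" unfolding me ..
    then show ?thesis using qr Cm by (simp add: of_nat_diff \<kappa>_def)
  qed
  then have "\<kappa> * (\<kappa> * real q) + \<kappa> * real r = \<kappa> * (\<kappa> * real (card F)) + \<kappa> * real (sum b P) + \<kappa> * real e"
    by (metis (no_types, opaque_lifting) distrib_left)
  \<comment> \<open>After multiplication by \<open>k\<close> the analytic errors are 1/8 per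
    partially joined vertex and per edge avoiding \<open>L\<close>, whereas \<open>defect'\<close>
    gains 1 for each such edge and for each such vertex but one. Only e = 0 with card P <= 1 can
    survive.\<close>
  ultimately have fin_ineq: "real e + real (card P - 1) < real (card P) / 8 + real e / 8"
    using defect' by (simp add: algebra_simps power2_eq_square)
  have "e = 0 \<and> card P \<le> 1"
  proof (rule ccontr)
    assume "\<not> ?thesis"
    then have "e \<ge> 1 \<or> card P \<ge> 2" by auto
    then have "real (card P) / 8 + real e / 8 \<le> real e + real (card P - 1)" by auto
    then show False using fin_ineq by simp
  qed
  then have e: "e = 0" and P1: "card P \<le> 1" by auto
  have indep: "{u, v} \<notin> edges G" if "u \<in> R" "v \<in> R" for u v
  proof -
    have "(\<Sum>u\<in>R. \<Sum>v\<in>R. adj G u v) = 0" using e eE by (simp add: E_def)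
    then have "adj G u v = 0" using that fin by (simp add: sum_nonneg_eq_0_iff sum_nonneg)
    then show ?thesis by (simp add: adj_def split: if_splits)
  qed
  have "\<rho> \<le> \<sigma>" unfolding \<rho>_def \<sigma>_def
    by (rule near_split_graph_radius_le[OF k G(1) V ck fin(1) indep b_def P_def P1 finP(1) F_def[unfolded ck] finF(1)])
      (use me e in simp_all)
  then show False using gt by simp
qed

section \<open>Counting bicliques\<close>

text \<open>An injective homomorphism of K_{t,t} cut into its two sides. Disjointness of the two
  images is implied in a simple graph: \<open>U i\<close> and \<open>W j\<close> are adjacent, hence
  distinct.\<close>

definition biclique_pairs :: "nat \<Rightarrow> 'a graph \<Rightarrow> ((nat \<Rightarrow> 'a) \<times> (nat \<Rightarrow> 'a)) set" where
  "biclique_pairs t G = {(U, W). U \<in> {..<t} \<rightarrow>\<^sub>E verts G \<and> W \<in> {..<t} \<rightarrow>\<^sub>E verts G \<and>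
     inj_on U {..<t} \<and> inj_on W {..<t} \<and> (\<forall>i<t. \<forall>j<t. {U i, W j} \<in> edges G)}"

lemma finite_inj_homs:
  assumes "finite (verts G)" "finite (verts H)"
  shows "finite (inj_homs H G)"
  by (rule finite_subset[of _ "verts H \<rightarrow>\<^sub>E verts G"]) (use assms in \<open>auto simp: inj_homs_def intro: finite_PiE\<close>)

lemma finite_biclique_pairs:
  assumes "finite (verts G)"
  shows "finite (biclique_pairs t G)"
  by (rule finite_subset[of _ "({..<t} \<rightarrow>\<^sub>E verts G) \<times> ({..<t} \<rightarrow>\<^sub>E verts G)"])
    (use assms in \<open>auto simp: biclique_pairs_def intro: finite_PiE\<close>)

lemma card_biclique_pairs_le:
  assumes G: "simple_graph G"
  shows "card (biclique_pairs t G) \<le> card (inj_homs (complete_bipartite t t) G)"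
proof -
  define \<phi> where "\<phi> = (\<lambda>(U :: nat \<Rightarrow> 'a, W). \<lambda>l\<in>{..<t + t}. if l < t then U l else W (l - t))"
  have fin: "finite (verts G)" using G by (simp add: simple_graph_def)
  have V: "verts (complete_bipartite t t) = {..<t + t}" by (simp add: complete_bipartite_def)
  show ?thesis
  proof (rule card_inj_on_le)
    show "finite (inj_homs (complete_bipartite t t) G)" using fin by (intro finite_inj_homs) (auto simp: V)
    show "inj_on \<phi> (biclique_pairs t G)"
    proof (rule inj_onI, clarify)
      fix U W U' W' assume a: "(U, W) \<in> biclique_pairs t G" "(U', W') \<in> biclique_pairs t G" "\<phi> (U, W) = \<phi> (U', W')"
      have "U i = U' i" if "i < t" for i using fun_cong[OF a(3), of i] that by (simp add: \<phi>_def)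
      moreover have "W i = W' i" if "i < t" for i
        using fun_cong[OF a(3), of "t + i"] that by (simp add: \<phi>_def)
      moreover have "U i = U' i \<and> W i = W' i" if "\<not> i < t" for i
        using a(1,2) that by (auto simp: biclique_pairs_def PiE_def extensional_def)
      ultimately show "U = U' \<and> W = W'" by blast
    qed
    show "\<phi> ` biclique_pairs t G \<subseteq> inj_homs (complete_bipartite t t) G"
    proof clarify
      fix U W assume UW: "(U, W) \<in> biclique_pairs t G"
      then have U: "\<And>i. i < t \<Longrightarrow> U i \<in> verts G" "inj_on U {..<t}"
        and W: "\<And>i. i < t \<Longrightarrow> W i \<in> verts G" "inj_on W {..<t}"
        and e: "\<And>i j. i < t \<Longrightarrow> j < t \<Longrightarrow> {U i, W j} \<in> edges G"
        by (auto simp: biclique_pairs_def PiE_def)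
      have ne: "U i \<noteq> W j" if "i < t" "j < t" for i j
        using e[OF that] G by (auto simp: simple_graph_def)
      show "\<phi> (U, W) \<in> inj_homs (complete_bipartite t t) G"
        unfolding inj_homs_def V
      proof (intro CollectI conjI ballI impI)
        show "\<phi> (U, W) \<in> {..<t + t} \<rightarrow>\<^sub>E verts G" using U W by (auto simp: \<phi>_def)
        show "inj_on (\<phi> (U, W)) {..<t + t}"
        proof (rule inj_onI)
          fix i j assume ij: "i \<in> {..<t + t}" "j \<in> {..<t + t}" "\<phi> (U, W) i = \<phi> (U, W) j"
          show "i = j"
          proof (cases "i < t")
            case True
            show ?thesis
            proof (cases "j < t")
              case True
              then show ?thesis using ij \<open>i < t\<close> U(2) by (auto simp: \<phi>_def inj_on_def)
            next
              case False
              then have "U i = W (j - t)" using ij \<open>i < t\<close> by (simp add: \<phi>_def)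
              moreover have "j - t < t" using False ij by auto
              ultimately show ?thesis using ne[OF \<open>i < t\<close>] by auto
            qed
          next
            case False
            then have it: "i - t < t" using ij by auto
            show ?thesis
            proof (cases "j < t")
              case True
              then have "W (i - t) = U j" using ij False by (simp add: \<phi>_def)
              then show ?thesis using ne[OF True it] by auto
            next
              case jF: False
              then have "W (i - t) = W (j - t)" "j - t < t" using ij False by (auto simp: \<phi>_def)
              then have "i - t = j - t" using W(2) it by (auto simp: inj_on_def)
              then show ?thesis using False jF by simp
            qed
          qed
        qed
        fix u v assume uv: "u \<in> {..<t + t}" "v \<in> {..<t + t}" "{u, v} \<in> edges (complete_bipartite t t)"
        then obtain i j where ij: "{u, v} = {i, j}" "i < t" "t \<le> j" "j < t + t"
          by (auto simp: complete_bipartite_def)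
        then have "\<phi> (U, W) i = U i" "\<phi> (U, W) j = W (j - t)" "j - t < t" by (auto simp: \<phi>_def)
        then have "{\<phi> (U, W) i, \<phi> (U, W) j} \<in> edges G" using e[OF ij(2)] by simp
        moreover have "{\<phi> (U, W) u, \<phi> (U, W) v} = {\<phi> (U, W) i, \<phi> (U, W) j}"
          using ij(1) by (auto simp: doubleton_eq_iff)
        ultimately show "{\<phi> (U, W) u, \<phi> (U, W) v} \<in> edges G" by simp
      qed
    qed
  qed
qed

text \<open>Coordinate \<open>j\<close> is determined by coordinate \<open>i\<close>, so its factor
  is bounded by \<Delta> while the other t - 1 coordinates run freely; restriction to them is
  injective.\<close>

lemma sum_hom_star_coincidence_le:
  fixes d :: "'a \<Rightarrow> real"
  assumes R: "finite R" and ij: "i < t" "j < t" "i \<noteq> j"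
    and d: "\<And>u. u \<in> R \<Longrightarrow> 0 \<le> d u" "\<And>u. u \<in> R \<Longrightarrow> d u \<le> \<Delta>" and \<Delta>: "0 \<le> \<Delta>"
  shows "(\<Sum>U\<in>{U \<in> {..<t} \<rightarrow>\<^sub>E R. U i = U j}. \<Prod>l<t. d (U l)) \<le> \<Delta> * (\<Sum>u\<in>R. d u) ^ (t - 1)"
proof -
  define J where "J = {..<t} - {j}"
  define A where "A = {U \<in> {..<t} \<rightarrow>\<^sub>E R. U i = U j}"
  have J: "finite J" "card J = t - 1" "insert j J = {..<t}" "j \<notin> J" using ij by (auto simp: J_def)
  have inj: "inj_on (\<lambda>U. restrict U J) A"
  proof (rule inj_onI)
    fix U U' assume U: "U \<in> A" "U' \<in> A" "restrict U J = restrict U' J"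
    have eq: "U l = U' l" if "l \<in> J" for l using fun_cong[OF U(3), of l] that by simp
    have "i \<in> J" using ij by (simp add: J_def)
    then have "U j = U' j" using eq U(1,2) by (auto simp: A_def)
    then have "U l = U' l" if "l < t" for l using eq that by (cases "l = j") (auto simp: J_def)
    moreover have "U l = U' l" if "\<not> l < t" for l
      using U(1,2) that by (auto simp: A_def PiE_def extensional_def)
    ultimately show "U = U'" by blast
  qed
  have "(\<Sum>U\<in>A. \<Prod>l<t. d (U l)) \<le> (\<Sum>U\<in>A. \<Delta> * (\<Prod>l\<in>J. d (restrict U J l)))"
  proof (intro sum_mono)
    fix U assume U: "U \<in> A"
    have R': "U l \<in> R" if "l < t" for l using U that by (auto simp: A_def)
    have "(\<Prod>l<t. d (U l)) = d (U j) * (\<Prod>l\<in>J. d (U l))"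
      unfolding J(3)[symmetric] using J(1,4) by simp
    also have "\<dots> \<le> \<Delta> * (\<Prod>l\<in>J. d (U l))"
      using R' d ij by (intro mult_right_mono prod_nonneg) (auto simp: J_def)
    finally show "(\<Prod>l<t. d (U l)) \<le> \<Delta> * (\<Prod>l\<in>J. d (restrict U J l))" by simp
  qed
  also have "\<dots> = \<Delta> * (\<Sum>U\<in>(\<lambda>U. restrict U J) ` A. \<Prod>l\<in>J. d (U l))"
    by (simp add: sum.reindex[OF inj] sum_distrib_left)
  also have "(\<Sum>U\<in>(\<lambda>U. restrict U J) ` A. \<Prod>l\<in>J. d (U l)) \<le> (\<Sum>U\<in>J \<rightarrow>\<^sub>E R. \<Prod>l\<in>J. d (U l))"
  proof (intro sum_mono2)
    show "finite (J \<rightarrow>\<^sub>E R)" using J R by (intro finite_PiE) auto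
    have "U l \<in> R" if "U \<in> A" "l \<in> J" for U l
      using that by (auto simp: A_def J_def)
    then show "(\<lambda>U. restrict U J) ` A \<subseteq> J \<rightarrow>\<^sub>E R"
      by (intro image_subsetI) (simp add: restrict_PiE_iff)
    fix U assume "U \<in> (J \<rightarrow>\<^sub>E R) - (\<lambda>U. restrict U J) ` A"
    then have "U l \<in> R" if "l \<in> J" for l using that by auto
    then show "0 \<le> (\<Prod>l\<in>J. d (U l))" using d(1) by (intro prod_nonneg) auto
  qed
  also have "(\<Sum>U\<in>J \<rightarrow>\<^sub>E R. \<Prod>l\<in>J. d (U l)) = (\<Prod>l\<in>J. \<Sum>u\<in>R. d u)"
    using J R by (intro prod_sum_PiE[symmetric]) auto
  also have "\<dots> = (\<Sum>u\<in>R. d u) ^ (t - 1)" by (simp add: J)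
  finally show ?thesis using \<Delta> by (simp add: A_def mult_left_mono)
qed

text \<open>The left side counts all homomorphisms of K_{t,t} into \<open>R\<close>. A non-injective
  one has a coincidence at one of fewer than t^2 index pairs on one of the two sides, and each kind
  is of lower order when \<Delta> is small against \<open>D\<close>.\<close>

lemma hom_count_le_biclique_pairs:
  assumes G: "simple_graph G" and R: "R \<subseteq> verts G" and t: "t \<ge> 1"
    and \<Delta>: "\<And>v. v \<in> R \<Longrightarrow> (\<Sum>u\<in>R. adj G v u) \<le> \<Delta>" "0 \<le> \<Delta>"
    and D: "(\<Sum>u\<in>R. \<Sum>v\<in>R. adj G u v) \<le> D"
  shows "(\<Sum>U\<in>{..<t} \<rightarrow>\<^sub>E R. (\<Sum>v\<in>R. \<Prod>i<t. adj G (U i) v) ^ t)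
    \<le> real (card (biclique_pairs t G)) + 2 * (real t)\<^sup>2 * (\<Delta> * D ^ (t - 1))"
proof -
  have fin: "finite (verts G)" using G by (simp add: simple_graph_def)
  have finR: "finite R" using R fin by (rule finite_subset)
  define T where "T = ({..<t} \<rightarrow>\<^sub>E R)"
  have finT: "finite T" unfolding T_def using finR by (intro finite_PiE) auto
  define N where "N U = {v \<in> R. \<forall>i<t. {U i, v} \<in> edges G}" for U
  define Hom where "Hom = (SIGMA U:T. {..<t} \<rightarrow>\<^sub>E N U)"
  have finHom: "finite Hom" unfolding Hom_def N_def using finT finR by (intro finite_SigmaI finite_PiE) auto
  have HomD: "(U, W) \<in> Hom \<longleftrightarrow> U \<in> T \<and> W \<in> T \<and> (\<forall>i<t. \<forall>j<t. {U i, W j} \<in> edges G)" for U W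
    by (auto simp: Hom_def N_def T_def PiE_def Pi_def)
  have "(\<Sum>v\<in>R. \<Prod>i<t. adj G (U i) v) = real (card (N U))" for U
  proof -
    have "(\<Prod>i<t. adj G (U i) v) = (if \<forall>i<t. {U i, v} \<in> edges G then 1 else 0)" for v
    proof (cases "\<forall>i<t. {U i, v} \<in> edges G")
      case True
      then show ?thesis by (simp add: adj_def)
    next
      case False
      then obtain i where "i < t" "adj G (U i) v = 0" by (auto simp: adj_def)
      then have "(\<Prod>i<t. adj G (U i) v) = 0" by (intro prod_zero) auto
      then show ?thesis unfolding if_not_P[OF False] .
    qed
    then show ?thesis using finR by (simp add: N_def sum.inter_filter[symmetric])
  qed
  then have "(\<Sum>U\<in>T. (\<Sum>v\<in>R. \<Prod>i<t. adj G (U i) v) ^ t) = real (\<Sum>U\<in>T. card (N U) ^ t)"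
    by simp
  also have "(\<Sum>U\<in>T. card (N U) ^ t) = card Hom"
    unfolding Hom_def using finT finR by (subst card_SigmaI) (auto simp: card_PiE N_def intro!: finite_PiE)
  also have "card Hom \<le> card (biclique_pairs t G)
      + (\<Sum>(i, j)\<in>{(i, j). i < t \<and> j < t \<and> i \<noteq> j}. card {(U, W) \<in> Hom. U i = U j} + card {(U, W) \<in> Hom. W i = W j})"
  proof -
    define I where "I = {(i, j). i < t \<and> j < t \<and> i \<noteq> j}"
    have finI: "finite I" by (rule finite_subset[of _ "{..<t} \<times> {..<t}"]) (auto simp: I_def)
    have "Hom \<subseteq> biclique_pairs t G
      \<union> (\<Union>(i, j)\<in>I. {(U, W) \<in> Hom. U i = U j} \<union> {(U, W) \<in> Hom. W i = W j})"
    proof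
      fix p assume p: "p \<in> Hom"
      obtain U W where UW: "p = (U, W)" by (cases p)
      show "p \<in> biclique_pairs t G
        \<union> (\<Union>(i, j)\<in>I. {(U, W) \<in> Hom. U i = U j} \<union> {(U, W) \<in> Hom. W i = W j})"
      proof (cases "inj_on U {..<t} \<and> inj_on W {..<t}")
        case True
        have "T \<subseteq> {..<t} \<rightarrow>\<^sub>E verts G" unfolding T_def using R by (intro PiE_mono)
        then show ?thesis using True p UW HomD by (auto simp: biclique_pairs_def)
      next
        case False
        then obtain i j where "i < t" "j < t" "i \<noteq> j" "U i = U j \<or> W i = W j"
          by (auto simp: inj_on_def)
        then have "(i, j) \<in> I \<and> (U i = U j \<or> W i = W j)" by (simp add: I_def)
        then show ?thesis using p UW by blast
      qed
    qed
    then have "card Hom \<le> card (biclique_pairs t G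
      \<union> (\<Union>(i, j)\<in>I. {(U, W) \<in> Hom. U i = U j} \<union> {(U, W) \<in> Hom. W i = W j}))"
      using finI finHom by (intro card_mono finite_UnI finite_biclique_pairs fin finite_UN_I)
        (auto intro: finite_subset[OF _ finHom])
    also have "\<dots> \<le> card (biclique_pairs t G)
      + card (\<Union>(i, j)\<in>I. {(U, W) \<in> Hom. U i = U j} \<union> {(U, W) \<in> Hom. W i = W j})"
      by (rule card_Un_le)
    also have "card (\<Union>(i, j)\<in>I. {(U, W) \<in> Hom. U i = U j} \<union> {(U, W) \<in> Hom. W i = W j})
      \<le> (\<Sum>(i, j)\<in>I. card ({(U, W) \<in> Hom. U i = U j} \<union> {(U, W) \<in> Hom. W i = W j}))"
      unfolding split_def by (rule card_UN_le[OF finI])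
    also have "\<dots> \<le> (\<Sum>(i, j)\<in>I. card {(U, W) \<in> Hom. U i = U j} + card {(U, W) \<in> Hom. W i = W j})"
      unfolding split_def by (intro sum_mono card_Un_le)
    finally show ?thesis by (simp add: I_def)
  qed
  finally have 1: "(\<Sum>U\<in>T. (\<Sum>v\<in>R. \<Prod>i<t. adj G (U i) v) ^ t) \<le> real (card (biclique_pairs t G))
      + (\<Sum>(i, j)\<in>{(i, j). i < t \<and> j < t \<and> i \<noteq> j}.
          real (card {(U, W) \<in> Hom. U i = U j}) + real (card {(U, W) \<in> Hom. W i = W j}))"
    by (simp add: split_def) (metis (no_types, lifting) of_nat_add of_nat_le_iff of_nat_sum sum.cong)?
  \<comment> \<open>Of all t^2 adjacencies only the matching between \<open>U l\<close> and
    \<open>W l\<close> is kept. The count becomes a sum of products of degrees, to which the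
    coincidence bound applies.\<close>
  have A: "real (card {(U, W) \<in> Hom. U i = U j}) \<le> \<Delta> * D ^ (t - 1)" if ij: "i < t" "j < t" "i \<noteq> j" for i j
  proof -
    define d where "d u = card {v \<in> R. {u, v} \<in> edges G}" for u
    have dd: "(\<Sum>v\<in>R. adj G u v) = real (d u)" for u
      unfolding d_def by (rule sum_adj_bool[OF finR])
    define A where "A = {U \<in> T. U i = U j}"
    have finA: "finite A" using finT by (simp add: A_def)
    have "{(U, W) \<in> Hom. U i = U j} \<subseteq> (SIGMA U:A. PiE {..<t} (\<lambda>l. {v \<in> R. {U l, v} \<in> edges G}))"
      by (auto simp: HomD A_def T_def PiE_def Pi_def)
    then have "card {(U, W) \<in> Hom. U i = U j} \<le> card (SIGMA U:A. PiE {..<t} (\<lambda>l. {v \<in> R. {U l, v} \<in> edges G}))"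
      using finA finR by (intro card_mono finite_SigmaI finite_PiE) auto
    also have "\<dots> = (\<Sum>U\<in>A. \<Prod>l<t. d (U l))"
      using finA finR by (subst card_SigmaI) (auto simp: card_PiE d_def intro!: finite_PiE)
    finally have "real (card {(U, W) \<in> Hom. U i = U j}) \<le> real (\<Sum>U\<in>A. \<Prod>l<t. d (U l))"
      by (simp only: of_nat_le_iff)
    also have "\<dots> = (\<Sum>U\<in>{U \<in> {..<t} \<rightarrow>\<^sub>E R. U i = U j}. \<Prod>l<t. real (d (U l)))"
      by (simp add: A_def T_def)
    also have "\<dots> \<le> \<Delta> * (\<Sum>u\<in>R. real (d u)) ^ (t - 1)"
      using \<Delta>(1)[unfolded dd] \<Delta>(2) by (intro sum_hom_star_coincidence_le[OF finR ij]) auto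
    also have "\<dots> \<le> \<Delta> * D ^ (t - 1)"
      using D \<Delta>(2) by (intro mult_left_mono power_mono) (auto simp: dd intro: sum_nonneg)
    finally show ?thesis .
  qed
  have B: "real (card {(U, W) \<in> Hom. W i = W j}) \<le> \<Delta> * D ^ (t - 1)" if ij: "i < t" "j < t" "i \<noteq> j" for i j
  proof -
    have "prod.swap ` {(U, W) \<in> Hom. U i = U j} = {(U, W) \<in> Hom. W i = W j}"
      by (auto simp: HomD insert_commute image_iff)
    then have "card {(U, W) \<in> Hom. W i = W j} = card {(U, W) \<in> Hom. U i = U j}"
      by (metis (no_types, lifting) card_image inj_on_subset inj_swap subset_UNIV)
    then show ?thesis using A[OF ij] by simp
  qed
  have "(\<Sum>(i, j)\<in>{(i, j). i < t \<and> j < t \<and> i \<noteq> j}.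
          real (card {(U, W) \<in> Hom. U i = U j}) + real (card {(U, W) \<in> Hom. W i = W j}))
      \<le> (\<Sum>(i, j)\<in>{(i, j). i < t \<and> j < t \<and> i \<noteq> j}. 2 * (\<Delta> * D ^ (t - 1)))"
  proof (intro sum_mono, clarify)
    fix i j assume ij: "i < t" "j < t" "i \<noteq> j"
    show "real (card {(U, W) \<in> Hom. U i = U j}) + real (card {(U, W) \<in> Hom. W i = W j}) \<le> 2 * (\<Delta> * D ^ (t - 1))"
      using A[OF ij] B[OF ij] by simp
  qed
  also have "\<dots> = real (card {(i, j). i < t \<and> j < t \<and> i \<noteq> j}) * (2 * (\<Delta> * D ^ (t - 1)))"
    by simp
  also have "\<dots> \<le> real (card ({..<t} \<times> {..<t})) * (2 * (\<Delta> * D ^ (t - 1)))"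
  proof (intro mult_right_mono)
    show "real (card {(i, j). i < t \<and> j < t \<and> i \<noteq> j}) \<le> real (card ({..<t} \<times> {..<t}))"
      unfolding of_nat_le_iff by (intro card_mono) auto
    have "0 \<le> D" using D by (rule order_trans[rotated]) (auto intro!: sum_nonneg)
    then show "0 \<le> 2 * (\<Delta> * D ^ (t - 1))" using \<Delta>(2) by simp
  qed
  also have "\<dots> = 2 * (real t)\<^sup>2 * (\<Delta> * D ^ (t - 1))" by (simp add: power2_eq_square)
  finally show ?thesis using 1 by (simp add: T_def)
qed

text \<open>For \<open>card A < t\<close> the truncated factor at \<open>i = card A\<close> is 0, in
  agreement with the absence of injections.\<close>

lemma card_inj_PiE:
  assumes "finite A"
  shows "card {f \<in> {..<t} \<rightarrow>\<^sub>E A. inj_on f {..<t}} = (\<Prod>i<t. card A - i)"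
  using card_inj_on_subset_funcset[of "{..<t}" A "{..<t}"] assms by (simp add: atLeast0LessThan)

text \<open>Choose the tuple in \<open>S\<close> first, then the other one in its common
  neighbourhood. The factor 2 counts both orders of the sides; the values at index 0, in the
  disjoint sets \<open>N\<close> and \<open>S\<close>, keep the two families apart.\<close>

lemma card_biclique_pairs_ge:
  assumes G: "simple_graph G" and t: "t \<ge> 1" and sub: "N \<subseteq> verts G" "S \<subseteq> verts G" "N \<inter> S = {}"
    and common: "\<And>W. W \<in> {..<t} \<rightarrow> S \<Longrightarrow> h \<le> card {u \<in> N. \<forall>j<t. {u, W j} \<in> edges G}"
  shows "2 * ((\<Prod>i<t. card S - i) * (\<Prod>i<t. h - i)) \<le> card (biclique_pairs t G)"
proof -
  have fin: "finite (verts G)" using G by (simp add: simple_graph_def)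
  have finN: "finite N" "finite S" using sub fin by (auto intro: finite_subset)
  define C where "C W = {u \<in> N. \<forall>j<t. {u, W j} \<in> edges G}" for W
  define I where "I A = {f \<in> {..<t} \<rightarrow>\<^sub>E A. inj_on f {..<t}}" for A :: "'a set"
  have finI: "finite (I A)" if "finite A" for A using that by (auto simp: I_def intro!: finite_PiE)
  have finC: "finite (C W)" for W using finN by (simp add: C_def)
  define X where "X = (SIGMA W:I S. I (C W))"
  have finX: "finite X" unfolding X_def using finN finC by (intro finite_SigmaI finI)
  have cX: "(\<Prod>i<t. card S - i) * (\<Prod>i<t. h - i) \<le> card X"
  proof -
    have "(\<Prod>i<t. card S - i) * (\<Prod>i<t. h - i) = (\<Sum>W\<in>I S. \<Prod>i<t. h - i)"
      using card_inj_PiE[OF finN(2), of t] by (simp add: I_def)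
    also have "\<dots> \<le> (\<Sum>W\<in>I S. card (I (C W)))"
    proof (intro sum_mono)
      fix W assume "W \<in> I S"
      then have "h \<le> card (C W)" unfolding C_def by (intro common) (auto simp: I_def)
      then have "(\<Prod>i<t. h - i) \<le> (\<Prod>i<t. card (C W) - i)" by (intro prod_mono) auto
      then show "(\<Prod>i<t. h - i) \<le> card (I (C W))" unfolding I_def card_inj_PiE[OF finC] .
    qed
    also have "\<dots> = card X" unfolding X_def using finN finC by (subst card_SigmaI) (auto intro: finI)
    finally show ?thesis .
  qed
  have XP: "X \<subseteq> biclique_pairs t G" "prod.swap ` X \<subseteq> biclique_pairs t G"
  proof -
    have CV: "C W \<subseteq> verts G" for W using sub by (auto simp: C_def)
    have *: "W \<in> {..<t} \<rightarrow>\<^sub>E verts G \<and> U \<in> {..<t} \<rightarrow>\<^sub>E verts G \<and> inj_on W {..<t} \<and> inj_on U {..<t}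
      \<and> (\<forall>i<t. \<forall>j<t. {U i, W j} \<in> edges G)" if "(W, U) \<in> X" for W U
    proof -
      have W: "W \<in> {..<t} \<rightarrow>\<^sub>E S" "inj_on W {..<t}" and U: "U \<in> {..<t} \<rightarrow>\<^sub>E C W" "inj_on U {..<t}"
        using that by (auto simp: X_def I_def)
      have "U i \<in> C W" if "i < t" for i using U that by auto
      then show ?thesis using W U PiE_mono[of "{..<t}" "\<lambda>_. S" "\<lambda>_. verts G"] sub(2)
          PiE_mono[of "{..<t}" "\<lambda>_. C W" "\<lambda>_. verts G"] CV[of W] by (auto simp: C_def)
    qed
    have P: "(W, U) \<in> biclique_pairs t G \<and> (U, W) \<in> biclique_pairs t G" if "(W, U) \<in> X" for W U
    proof -
      have "{W i, U j} \<in> edges G" if "i < t" "j < t" for i j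
        using *[OF \<open>(W, U) \<in> X\<close>] that by (simp add: insert_commute[of "W i"])
      then show ?thesis using *[OF that] unfolding biclique_pairs_def by blast
    qed
    show "X \<subseteq> biclique_pairs t G" using P by (intro subrelI) blast
    show "prod.swap ` X \<subseteq> biclique_pairs t G"
    proof (rule image_subsetI)
      fix p assume "p \<in> X"
      then show "prod.swap p \<in> biclique_pairs t G" using P[of "fst p" "snd p"] by (simp add: prod.swap_def)
    qed
  qed
  have "X \<inter> prod.swap ` X = {}"
  proof -
    have "W 0 \<in> S \<and> U 0 \<in> N" if "(W, U) \<in> X" for W U
    proof -
      have "W \<in> {..<t} \<rightarrow>\<^sub>E S" "U \<in> {..<t} \<rightarrow>\<^sub>E C W"
        using that by (simp_all add: X_def I_def)
      then have "W 0 \<in> S" "U 0 \<in> C W" using t PiE_mem[of _ "{..<t}" _ 0] by (simp_all add: PiE_mem)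
      then show ?thesis by (simp add: C_def)
    qed
    then have "fst p 0 \<in> S \<and> snd p 0 \<in> N" if "p \<in> X" for p using that by (cases p) simp
    then have mem: "fst p 0 \<in> S" "snd p 0 \<in> N" if "p \<in> X" for p using that by blast+
    show ?thesis
    proof (rule equals0I)
      fix p assume p: "p \<in> X \<inter> prod.swap ` X"
      then obtain p' where "p' \<in> X" "p = prod.swap p'" by blast
      then have "fst p 0 \<in> N" using mem(2)[of p'] by simp
      then show False using mem(1)[of p] p sub(3) by blast
    qed
  qed
  then have "card X + card (prod.swap ` X) = card (X \<union> prod.swap ` X)"
    using finX by (simp add: card_Un_disjoint)
  also have "\<dots> \<le> card (biclique_pairs t G)"
    using XP by (intro card_mono finite_biclique_pairs fin) auto
  finally have "2 * card X \<le> card (biclique_pairs t G)" by (simp add: card_image)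
  then show ?thesis using cX by simp
qed

section \<open>Eigenvectors concentrated on few vertices\<close>

text \<open>For i < t <= a one has a/(a - i) <= i + 1 <= 2^i, and the sum of all i < t is t (t -
  1)/2 <= (t - 1)^2. Equality holds throughout for t = a = 2.\<close>

lemma falling_ratio_ge:
  fixes a t :: nat
  assumes "t \<le> a" "t \<ge> 2"
  shows "real a ^ t / 2 ^ (t - 1)\<^sup>2 \<le> (\<Prod>i<t. real a - real i)"
proof -
  have "real a ^ t / 2 ^ (t - 1)\<^sup>2 \<le> real a ^ t / 2 ^ (\<Sum>i<t. i)"
  proof (intro divide_left_mono power_increasing)
    have "2 * (\<Sum>i<t. i) = t * (t - 1)"
      using gauss_sum_nat[of "t - 1"] assms(2) by (cases t) (simp_all add: lessThan_Suc_atMost atMost_atLeast0 algebra_simps)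
    moreover have "t * (t - 1) \<le> 2 * (t - 1)\<^sup>2"
      using assms(2) by (cases t) (simp_all add: power2_eq_square)
    ultimately show "(\<Sum>i<t. i) \<le> (t - 1)\<^sup>2" by simp
  qed auto
  also have "\<dots> = (\<Prod>i<t. real a / 2 ^ i)"
    by (simp add: prod_dividef power_sum)
  also have "\<dots> \<le> (\<Prod>i<t. real a - real i)"
  proof (intro prod_mono conjI)
    fix i assume "i \<in> {..<t}"
    then have i: "i + 1 \<le> a" using assms by auto
    have "i + 1 \<le> (2::nat) ^ i" by (induction i) auto
    then have "(i + 1) * (a - i) \<le> 2 ^ i * (a - i)" by (intro mult_right_mono) auto
    moreover have "a \<le> (i + 1) * (a - i)"
    proof -
      obtain j where "a = i + 1 + j" using i le_iff_add by blast
      then show ?thesis by simp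
    qed
    ultimately have "real a \<le> real (2 ^ i * (a - i))" by (simp only: of_nat_le_iff)
    then show "real a / 2 ^ i \<le> real a - real i" using i by (simp add: field_simps of_nat_diff)
  qed auto
  finally show ?thesis .
qed

text \<open>The bound for \<open>a\<close> itself has no slack at t = a = 2, so a relative error
  cannot simply be absorbed. If the absolute error is below 1, integrality gives
  \<open>h \<ge> a\<close>; otherwise \<open>a\<close> is at least 64 t^2 and the falling factorial
  of \<open>h\<close> is at least a^t/2.\<close>

lemma falling_ratio_ge_perturbed:
  fixes a t h :: nat and e :: real
  assumes a: "t \<le> a" and t: "t \<ge> 2" and e: "0 \<le> e" "e \<le> 1 / (512 * real t ^ 3)"
    and h: "real h \<ge> (1 - 8 * real t * e) * real a"
  shows "real a ^ t / 2 ^ (t - 1)\<^sup>2 \<le> real (\<Prod>i<t. h - i)"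
proof (cases "8 * real t * e * real a < 1")
  case True
  then have "real h > real a - 1" using h by (simp add: algebra_simps)
  then have ha: "a \<le> h" by linarith
  have "real a ^ t / 2 ^ (t - 1)\<^sup>2 \<le> (\<Prod>i<t. real a - real i)" by (rule falling_ratio_ge[OF a t])
  also have "\<dots> \<le> (\<Prod>i<t. real (h - i))"
    using ha a by (intro prod_mono) (auto simp: of_nat_diff)
  finally show ?thesis by simp
next
  case False
  \<comment> \<open>Two losses of at most 8 t^2 e each, relative to \<open>a\<close>: the term 8 t e
    in the bound on \<open>h\<close>, and the shift by i < t, which is at most 8 t^2 e a in this
    case.\<close>
  define s where "s = 16 * (real t)\<^sup>2 * e"
  have t0: "real t \<ge> 2" using t by simp
  have s: "0 \<le> s" "real t * s \<le> 1 / 2"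
  proof -
    show "0 \<le> s" using e by (simp add: s_def)
    have "real t * s = 16 * real t ^ 3 * e" by (simp add: s_def eval_nat_numeral)
    also have "\<dots> \<le> 16 * real t ^ 3 * (1 / (512 * real t ^ 3))" using e by (intro mult_left_mono) auto
    also have "\<dots> \<le> 1 / 2" using t0 by simp
    finally show "real t * s \<le> 1 / 2" .
  qed
  have "1 * s \<le> real t * s" using t0 s by (intro mult_right_mono) auto
  then have s1: "s \<le> 1 / 2" using s by simp
  have step: "real a * (1 - s) \<le> real (h - i)" if "i < t" for i
  proof -
    have "real t * 1 \<le> real t * (8 * real t * e * real a)"
      using False by (intro mult_left_mono) auto
    moreover have "real i \<le> real t * 1" using that by simp
    ultimately have "real i \<le> real t * (8 * real t * e * real a)" by linarith
    moreover have "8 * real t * e * real a * 1 \<le> 8 * real t * e * real a * real t"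
      using t0 e by (intro mult_left_mono) auto
    ultimately have "(1 - 8 * real t * e) * real a - real i \<ge> real a * (1 - s)"
      by (simp add: s_def power2_eq_square algebra_simps)
    then show ?thesis using h by linarith
  qed
  have "1 / 2 ^ (t - 1)\<^sup>2 \<le> (1 / 2 :: real)"
  proof -
    have "(2::real) ^ 1 \<le> 2 ^ (t - 1)\<^sup>2" using t by (intro power_increasing) auto
    then show ?thesis by (intro divide_left_mono) auto
  qed
  also have "(1 / 2 :: real) \<le> 1 + real t * (- s)" using s by simp
  also have "\<dots> \<le> (1 + (- s)) ^ t" using s1 by (intro Bernoulli_inequality) simp
  finally have "real a ^ t * (1 / 2 ^ (t - 1)\<^sup>2) \<le> real a ^ t * (1 - s) ^ t"
    by (intro mult_left_mono) auto
  also have "\<dots> = (\<Prod>i<t. real a * (1 - s))" by (simp add: power_mult_distrib)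
  also have "\<dots> \<le> (\<Prod>i<t. real (h - i))"
    using step s1 by (intro prod_mono) auto
  finally show ?thesis by simp
qed

text \<open>Both normalised indicator functions are close to \<open>x\<close>, hence to each other.\<close>

lemma neighbourhood_overlap:
  fixes x :: "'a \<Rightarrow> real" and e :: real
  assumes L: "finite L" and N: "N \<subseteq> L" "N' \<subseteq> L" "N \<noteq> {}" "N' \<noteq> {}"
    and x: "\<And>v. 0 \<le> x v" "(\<Sum>v\<in>L. (x v)\<^sup>2) = 1" and e: "0 \<le> e" "e \<le> 1 / 8"
    and z: "(sum x N)\<^sup>2 \<ge> (1 - e) * card N" "(sum x N')\<^sup>2 \<ge> (1 - e) * card N'"
  shows "real (card (N \<inter> N')) \<ge> (1 - 8 * e) * real (card N)"
proof -
  define g where "g M u = (if u \<in> M then 1 / sqrt (card M) else 0)" for M :: "'a set" and u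
  have fin: "finite N" "finite N'" using L N finite_subset by blast+
  have pos: "card N > 0" "card N' > 0" using fin N by (auto simp: card_gt_0_iff)
  have gg: "(\<Sum>u\<in>L. (g M u)\<^sup>2) = 1" if "M \<subseteq> L" "M \<noteq> {}" for M
  proof -
    have "finite M" using that L finite_subset by blast
    have "(\<Sum>u\<in>L. (g M u)\<^sup>2) = (\<Sum>u\<in>M. 1 / card M)"
      using that L by (intro sum.mono_neutral_cong_right) (auto simp: g_def power_divide)
    then show ?thesis using that \<open>finite M\<close> by simp
  qed
  have close: "(\<Sum>u\<in>L. (x u - g M u)\<^sup>2) \<le> 2 * e"
    if M: "M \<subseteq> L" "M \<noteq> {}" and zM: "(sum x M)\<^sup>2 \<ge> (1 - e) * card M" for M
  proof -
    have finM: "finite M" using M L finite_subset by blast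
    have cM: "real (card M) > 0" using M finM by (simp add: card_gt_0_iff)
    have "(\<Sum>u\<in>L. x u * g M u) = (\<Sum>u\<in>M. x u / sqrt (card M))"
      using M L by (intro sum.mono_neutral_cong_right) (auto simp: g_def)
    then have dot: "(\<Sum>u\<in>L. x u * g M u) = sum x M / sqrt (card M)" by (simp add: sum_divide_distrib)
    \<comment> \<open>As (1 - e)^2 <= 1 - e, the hypothesis on the square yields a scalar product of
      at least 1 - e.\<close>
    have "(1 - e)\<^sup>2 \<le> (1 - e) * 1" unfolding power2_eq_square using e by (intro mult_left_mono) auto
    also have "\<dots> \<le> (sum x M / sqrt (card M))\<^sup>2" using zM cM by (simp add: power_divide field_simps)
    finally have "1 - e \<le> sum x M / sqrt (card M)"
      by (rule power2_le_imp_le) (use x in \<open>auto intro!: divide_nonneg_nonneg sum_nonneg\<close>)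
    moreover have "(\<Sum>u\<in>L. (x u - g M u)\<^sup>2) = 2 - 2 * (\<Sum>u\<in>L. x u * g M u)"
    proof -
      have "(\<Sum>u\<in>L. (x u - g M u)\<^sup>2) = (\<Sum>u\<in>L. (x u)\<^sup>2 + (g M u)\<^sup>2 - 2 * (x u * g M u))"
        by (intro sum.cong refl) (simp add: power2_eq_square algebra_simps)
      then show ?thesis using x(2) gg[OF M] by (simp add: sum.distrib sum_subtractf flip: sum_distrib_left)
    qed
    ultimately show ?thesis using dot by simp
  qed
  have "(\<Sum>u\<in>L. (g N u - g N' u)\<^sup>2) \<le> (\<Sum>u\<in>L. 2 * (x u - g N u)\<^sup>2 + 2 * (x u - g N' u)\<^sup>2)"
  proof (intro sum_mono)
    fix u
    have "0 \<le> ((x u - g N u) + (x u - g N' u))\<^sup>2" by simp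
    then show "(g N u - g N' u)\<^sup>2 \<le> 2 * (x u - g N u)\<^sup>2 + 2 * (x u - g N' u)\<^sup>2"
      by (simp add: power2_eq_square algebra_simps)
  qed
  also have "\<dots> \<le> 8 * e"
    using close[OF N(1,3) z(1)] close[OF N(2,4) z(2)] by (simp add: sum.distrib flip: sum_distrib_left)
  finally have 1: "(\<Sum>u\<in>L. (g N u - g N' u)\<^sup>2) \<le> 8 * e" .
  have "(\<Sum>u\<in>L. (g N u - g N' u)\<^sup>2) = (\<Sum>u\<in>L. (g N u)\<^sup>2 + (g N' u)\<^sup>2 - 2 * (g N u * g N' u))"
    by (intro sum.cong refl) (simp add: power2_eq_square algebra_simps)
  also have "\<dots> = 2 - 2 * (\<Sum>u\<in>L. g N u * g N' u)"
    using gg[OF N(1,3)] gg[OF N(2,4)] by (simp add: sum.distrib sum_subtractf flip: sum_distrib_left)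
  also have "(\<Sum>u\<in>L. g N u * g N' u) = (\<Sum>u\<in>N \<inter> N'. 1 / (sqrt (card N) * sqrt (card N')))"
    using N L by (intro sum.mono_neutral_cong_right) (auto simp: g_def)
  also have "\<dots> = real (card (N \<inter> N')) / (sqrt (card N) * sqrt (card N'))" by simp
  finally have "1 - 4 * e \<le> real (card (N \<inter> N')) / (sqrt (card N) * sqrt (card N'))" using 1 by linarith
  then have 2: "(1 - 4 * e) * (sqrt (card N) * sqrt (card N')) \<le> real (card (N \<inter> N'))"
    using pos by (simp add: pos_le_divide_eq)
  have e4: "0 < 1 - 4 * e" using e by simp
  define I where "I = real (card (N \<inter> N'))"
  have I: "I \<le> real (card N')" unfolding I_def of_nat_le_iff using fin by (intro card_mono) auto
  have "0 < (1 - 4 * e) * (sqrt (card N) * sqrt (card N'))" using e4 pos by simp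
  then have I0: "I > 0" using 2 unfolding I_def by linarith
  \<comment> \<open>Replacing card N' by the smaller \<open>I\<close> in I^2 >= (1 - 4e)^2 |N| |N'|
    cancels one factor \<open>I\<close>, and the size of \<open>N'\<close> disappears from the
    bound.\<close>
  have "((1 - 4 * e) * (sqrt (card N) * sqrt (card N')))\<^sup>2 \<le> I\<^sup>2"
    using 2 e4 unfolding I_def by (intro power_mono) auto
  then have "(1 - 4 * e)\<^sup>2 * (real (card N) * real (card N')) \<le> I\<^sup>2" by (simp add: power_mult_distrib)
  moreover have "(1 - 4 * e)\<^sup>2 * (real (card N) * I) \<le> (1 - 4 * e)\<^sup>2 * (real (card N) * real (card N'))"
    using I by (intro mult_left_mono) auto
  ultimately have "((1 - 4 * e)\<^sup>2 * real (card N)) * I \<le> I * I" by (simp add: power2_eq_square[of I] mult_ac)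
  then have "(1 - 4 * e)\<^sup>2 * real (card N) \<le> I" using I0 by simp
  moreover have "(1 - 8 * e) * real (card N) \<le> (1 - 4 * e)\<^sup>2 * real (card N)"
    by (intro mult_right_mono) (auto simp: power2_eq_square algebra_simps)
  ultimately show ?thesis unfolding I_def by linarith
qed

text \<open>By Cauchy-Schwarz z^2 <= b, with near equality only if \<open>x\<close> is close to the
  normalised indicator of the neighbourhood of \<open>v\<close> in \<open>L\<close>. Hypothesis
  \<open>z\<close> makes this true for vertices carrying most edges, so their neighbourhoods nearly
  agree and have about the same size \<open>a\<close>. For a <= t - 1 they agree exactly and
  \<open>split_graph_local_maximum\<close> applies; for a >= t bicliques are counted
  directly.\<close>

lemma split_graph_radius_or_many_bicliques:
  fixes G :: "'a::linorder graph"
  assumes t: "t \<ge> 2" and e: "0 < e" "e \<le> 1 / (512 * real t ^ 3)"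
    and G: "simple_graph G" "card (edges G) = m" and m: "m \<ge> 2048 * (t - 1) ^ 6"
    and L: "L \<subseteq> verts G" "real (card L) \<le> K" and R: "R \<subseteq> verts G - L"
    and x: "\<And>v. 0 \<le> x v" "(\<Sum>v\<in>L. (x v)\<^sup>2) = 1"
    and z: "(\<Sum>v\<in>R. (\<Sum>u\<in>L. adj G v u * x u)\<^sup>2) \<ge> (1 - e\<^sup>2) * real m"
    and mK: "10 * e + real t * K / real m \<le> 1"
  shows "graph_radius G \<le> graph_radius (split_graph (t - 1) m)
    \<or> real (card (biclique_pairs t G)) \<ge> 2 / 2 ^ (t - 1)\<^sup>2 * (1 - 10 * e - real t * K / real m) ^ t * real m ^ t"
proof -
  have t0: "real t \<ge> 2" using t by simp
  have t3: "real t ^ 3 \<ge> 8"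
  proof -
    have "(2::real) ^ 3 \<le> real t ^ 3" using t0 by (intro power_mono) auto
    then show ?thesis by simp
  qed
  have e1: "e \<le> 1 / 4096"
  proof -
    have "1 / (512 * real t ^ 3) \<le> 1 / (512 * 8)" using t3 t0 by (intro divide_left_mono) auto
    then show ?thesis using e by simp
  qed
  have mpos: "real m > 0"
  proof -
    have "1 ^ 6 \<le> (t - 1) ^ 6" using t by (intro power_mono) auto
    then have "m > 0" using m by simp
    then show ?thesis by simp
  qed
  have finV: "finite (verts G)" using G by (simp add: simple_graph_def)
  have fin: "finite L" "finite R" using finV L R by (auto intro: finite_subset)
  define N where "N v = {u \<in> L. {v, u} \<in> edges G}" for v
  have NL: "N v \<subseteq> L" "finite (N v)" for v using fin by (auto simp: N_def)
  define b where "b v = real (card (N v))" for v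
  define z where "z v = (\<Sum>u\<in>L. adj G v u * x u)" for v
  have zN: "z v = sum x (N v)" for v
    unfolding z_def N_def using fin by (intro sum.mono_neutral_cong_right) (auto simp: adj_def)
  have bsum: "(\<Sum>u\<in>L. adj G v u) = b v" for v unfolding b_def N_def by (rule sum_adj_bool[OF fin(1)])
  have zb: "(z v)\<^sup>2 \<le> b v" for v
    unfolding z_def bsum[symmetric] by (rule adj_row_square_le[OF x(2)])
  have bR: "(\<Sum>v\<in>R. b v) \<le> real m"
  proof -
    have V: "verts G = L \<union> (verts G - L)" "L \<inter> (verts G - L) = {}" using L by auto
    have "0 \<le> (\<Sum>u\<in>L. \<Sum>v\<in>L. adj G u v)" "0 \<le> (\<Sum>u\<in>verts G - L. \<Sum>v\<in>verts G - L. adj G u v)"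
      by (auto intro!: sum_nonneg)
    then have "(\<Sum>v\<in>verts G - L. b v) \<le> real m" using sum_adj_split[OF G(1) V] G(2) by (simp add: bsum)
    moreover have "(\<Sum>v\<in>R. b v) \<le> (\<Sum>v\<in>verts G - L. b v)"
      using R finV by (intro sum_mono2) (auto simp: b_def)
    ultimately show ?thesis by simp
  qed
  have zsum: "(\<Sum>v\<in>R. (z v)\<^sup>2) \<ge> (1 - e\<^sup>2) * real m" using z by (simp add: z_def)
  define S where "S = {v \<in> R. N v \<noteq> {} \<and> (z v)\<^sup>2 \<ge> (1 - e) * b v}"
  have SR: "S \<subseteq> R" by (auto simp: S_def)
  have finS: "finite S" using SR fin finite_subset by blast
  \<comment> \<open>Markov: the total loss of z^2 against b is at most e^2 m, while each vertex
    outside \<open>S\<close> loses at least e b, so these vertices account for at most e m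
    edges.\<close>
  have Ssum: "(\<Sum>v\<in>S. b v) \<ge> (1 - 2 * e) * real m"
  proof -
    have "e * (\<Sum>v\<in>R - S. b v) \<le> (\<Sum>v\<in>R - S. b v - (z v)\<^sup>2)"
      unfolding sum_distrib_left
    proof (intro sum_mono)
      fix v assume "v \<in> R - S"
      then have "N v = {} \<or> (z v)\<^sup>2 < (1 - e) * b v" by (auto simp: S_def)
      then show "e * b v \<le> b v - (z v)\<^sup>2" by (auto simp: b_def zN algebra_simps)
    qed
    also have "\<dots> \<le> (\<Sum>v\<in>R. b v - (z v)\<^sup>2)" using fin zb by (intro sum_mono2) auto
    also have "\<dots> \<le> e\<^sup>2 * real m" using zsum bR by (simp add: sum_subtractf algebra_simps)
    finally have "e * (\<Sum>v\<in>R - S. b v) \<le> e * (e * real m)" by (simp add: power2_eq_square mult.assoc)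
    then have "(\<Sum>v\<in>R - S. b v) \<le> e * real m" using e by simp
    moreover have "(\<Sum>v\<in>R. b v) = (\<Sum>v\<in>R - S. b v) + (\<Sum>v\<in>S. b v)"
      by (rule sum.subset_diff[OF SR fin(2)])
    moreover have "(\<Sum>v\<in>R. b v) \<ge> (1 - e\<^sup>2) * real m"
      using zsum sum_mono[of R "\<lambda>v. (z v)\<^sup>2" b] zb by fastforce
    moreover have "e\<^sup>2 * real m \<le> e * real m"
      using e e1 mult_right_mono[of e 1 e] by (intro mult_right_mono) (auto simp: power2_eq_square)
    ultimately show ?thesis by (simp add: algebra_simps)
  qed
  have overlap: "real (card (N v \<inter> N v')) \<ge> (1 - 8 * e) * b v" if "v \<in> S" "v' \<in> S" for v v'
    unfolding b_def
    by (rule neighbourhood_overlap[OF fin(1) NL(1) NL(1) _ _ x])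
      (use that e e1 in \<open>auto simp: S_def zN b_def\<close>)
  have "S \<noteq> {}"
  proof
    assume "S = {}"
    then have "(1 - 2 * e) * real m \<le> 0" using Ssum by simp
    moreover have "(1 - 2 * e) * real m > 0" using e1 mpos by simp
    ultimately show False by simp
  qed
  then obtain v0 where v0: "v0 \<in> S" by auto
  define a where "a = card (N v0)"
  have a1: "a \<ge> 1" using v0 NL by (simp add: a_def S_def Suc_le_eq card_gt_0_iff)
  have ba: "(1 - 8 * e) * b v \<le> real a" if "v \<in> S" for v
  proof -
    have "card (N v \<inter> N v0) \<le> a" unfolding a_def using NL by (intro card_mono) auto
    then have "real (card (N v \<inter> N v0)) \<le> real a" by simp
    then show ?thesis using overlap[OF that v0] by linarith
  qed
  show ?thesis
  proof (cases "a \<le> t - 1")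
    case True
    have at: "real a \<le> real t - 1" using True t by (simp add: of_nat_diff le_diff_conv2)
    have te: "8 * e * real t \<le> 1 / 64"
    proof -
      have "8 * e * real t \<le> 8 * (1 / (512 * real t ^ 3)) * real t"
        using e by (intro mult_right_mono mult_left_mono) auto
      also have "\<dots> = 1 / (64 * (real t)\<^sup>2)" using t0 by (simp add: eval_nat_numeral)
      also have "\<dots> \<le> 1 / 64" using t0 by (simp add: one_le_power field_simps)
      finally show ?thesis .
    qed
    \<comment> \<open>The overlap misses at most 8 e a < 1 vertices, hence none: this gives one
      inclusion, and comparing sizes in the same way gives equality.\<close>
    have eq: "N v = N v0" if v: "v \<in> S" for v
    proof -
      have ea: "8 * e * real a \<le> 1 / 64"
      proof -
        have "8 * e * real a \<le> 8 * e * real t" using at e by (intro mult_left_mono) auto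
        then show ?thesis using te by linarith
      qed
      have "real (card (N v0 \<inter> N v)) > real a - 1"
        using overlap[OF v0 v] ea by (simp add: b_def a_def[symmetric] algebra_simps)
      then have "card (N v0 \<inter> N v) \<ge> card (N v0)" by (simp add: a_def)
      then have "N v0 \<inter> N v = N v0" by (intro card_seteq) (auto simp: NL)
      then have sub: "N v0 \<subseteq> N v" by auto
      have "b v < real a + 1"
      proof (rule ccontr)
        assume "\<not> b v < real a + 1"
        then have "(1 - 8 * e) * (real a + 1) \<le> (1 - 8 * e) * b v" using e1 by (intro mult_left_mono) auto
        then have "(1 - 8 * e) * (real a + 1) \<le> real a" using ba[OF v] by simp
        then have "1 \<le> 8 * e * real a + 8 * e" by (simp add: algebra_simps)
        then show False using ea e1 by simp
      qed
      then have "card (N v) \<le> card (N v0)" by (simp add: b_def a_def)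
      then show ?thesis using sub NL by (metis card_seteq)
    qed
    have "graph_radius G \<le> graph_radius (split_graph (t - 1) m)"
    proof (rule split_graph_local_maximum[where L = "N v0" and Q = S])
      show "1 \<le> t - 1" using t by simp
      show "2048 * (t - 1) ^ 6 \<le> m" by (rule m)
      show "N v0 \<subseteq> verts G" using NL L by blast
      show "card (N v0) \<le> t - 1" using True by (simp add: a_def)
      show "S \<subseteq> verts G - N v0" using SR R NL by blast
      show "{u, v} \<in> edges G" if "u \<in> N v0" "v \<in> S" for u v
        using that eq[OF that(2)] by (auto simp: N_def insert_commute)
      have "(\<Sum>v\<in>S. b v) = real a * real (card S)" using eq by (simp add: b_def a_def)
      then have 1: "real (card (N v0) * card S) \<ge> (1 - 2 * e) * real m" using Ssum by (simp add: a_def)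
      have "2 * e \<le> 1 / (256 * real (t - 1) ^ 2)"
      proof -
        have "real (t - 1) ^ 2 \<le> real t ^ 2" by (intro power_mono) auto
        also have "\<dots> \<le> real t ^ 3" using t0 by (intro power_increasing) auto
        finally have "1 / (256 * real t ^ 3) \<le> 1 / (256 * real (t - 1) ^ 2)"
          using t by (intro divide_left_mono) auto
        then show ?thesis using e by simp
      qed
      then have "(1 - 1 / (256 * real (t - 1) ^ 2)) * real m \<le> (1 - 2 * e) * real m"
        by (intro mult_right_mono) auto
      then show "(1 - 1 / (256 * real (t - 1) ^ 2)) * real m \<le> real (card (N v0) * card S)"
        using 1 by linarith
    qed (use G in auto)
    then show ?thesis ..
  next
    case False
    then have ta: "t \<le> a" by simp
    \<comment> \<open>Size guaranteed for the common neighbourhood of \<open>t\<close> vertices of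
      \<open>S\<close>: each misses at most 8 e a vertices of \<open>N v0\<close>. Rounding up is
      legitimate as an integer is bounded.\<close>
    define h where "h = nat \<lceil>(1 - 8 * real t * e) * real a\<rceil>"
    have hge: "real h \<ge> (1 - 8 * real t * e) * real a" unfolding h_def by (rule real_nat_ceiling_ge)
    have pairs: "2 * ((\<Prod>i<t. card S - i) * (\<Prod>i<t. h - i)) \<le> card (biclique_pairs t G)"
    proof (rule card_biclique_pairs_ge[where N = "N v0"])
      show "N v0 \<subseteq> verts G" using NL L by blast
      show "S \<subseteq> verts G" "N v0 \<inter> S = {}" using SR R NL by blast+
      show "t \<ge> 1" using t by simp
      fix W assume W: "W \<in> {..<t} \<rightarrow> S"
      define C where "C = {u \<in> N v0. \<forall>j<t. {u, W j} \<in> edges G}"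
      have "N v0 - C \<subseteq> (\<Union>j<t. N v0 - N (W j))"
        using NL by (auto simp: C_def N_def insert_commute)
      then have "card (N v0 - C) \<le> card (\<Union>j<t. N v0 - N (W j))"
        using NL by (intro card_mono) auto
      also have "\<dots> \<le> (\<Sum>j<t. card (N v0 - N (W j)))" by (rule card_UN_le) simp
      finally have "real (card (N v0 - C)) \<le> (\<Sum>j<t. real (card (N v0 - N (W j))))"
        by (simp flip: of_nat_sum)
      also have "\<dots> \<le> (\<Sum>j<t. 8 * e * real a)"
      proof (intro sum_mono)
        fix j assume "j \<in> {..<t}"
        then have "W j \<in> S" using W by auto
        have "card (N v0 - N (W j)) = a - card (N v0 \<inter> N (W j))"
          using NL by (simp add: card_Diff_subset_Int a_def)
        moreover have "card (N v0 \<inter> N (W j)) \<le> a" unfolding a_def using NL by (intro card_mono) auto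
        ultimately show "real (card (N v0 - N (W j))) \<le> 8 * e * real a"
          using overlap[OF v0 \<open>W j \<in> S\<close>] by (simp add: of_nat_diff b_def a_def[symmetric] algebra_simps)
      qed
      also have "\<dots> = 8 * real t * e * real a" by simp
      finally have "real (card (N v0 - C)) \<le> 8 * real t * e * real a" .
      moreover have "real (card (N v0 - C)) = real a - real (card C)"
        using NL by (subst card_Diff_subset) (auto simp: C_def a_def of_nat_diff card_mono)
      ultimately have "(1 - 8 * real t * e) * real a \<le> real (card C)" by (simp add: algebra_simps)
      then show "h \<le> card {u \<in> N v0. \<forall>j<t. {u, W j} \<in> edges G}"
        unfolding h_def C_def by linarith
    qed (use G in auto)
    have aK: "real a \<le> K"
    proof -
      have "a \<le> card L" unfolding a_def using NL fin by (intro card_mono)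
      then show ?thesis using L by simp
    qed
    \<comment> \<open>At least (1 - 2e) m edges end in \<open>S\<close>, each vertex taking at most
      a/(1 - 8e) of them.\<close>
    have g: "real (card S) \<ge> (1 - 10 * e) * real m / real a"
    proof -
      have "(1 - 8 * e) * (\<Sum>v\<in>S. b v) \<le> (\<Sum>v\<in>S. real a)"
        unfolding sum_distrib_left using ba by (intro sum_mono)
      then have "(1 - 8 * e) * (\<Sum>v\<in>S. b v) \<le> real (card S) * real a" by simp
      moreover have "(1 - 8 * e) * ((1 - 2 * e) * real m) \<le> (1 - 8 * e) * (\<Sum>v\<in>S. b v)"
        using Ssum e1 by (intro mult_left_mono) auto
      moreover have "(1 - 10 * e) * real m \<le> (1 - 8 * e) * ((1 - 2 * e) * real m)"
      proof -
        have "1 - 10 * e \<le> (1 - 8 * e) * (1 - 2 * e)" using e by (simp add: algebra_simps)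
        then have "(1 - 10 * e) * real m \<le> ((1 - 8 * e) * (1 - 2 * e)) * real m" by (intro mult_right_mono) auto
        then show ?thesis by (simp add: mult.assoc)
      qed
      ultimately have "(1 - 10 * e) * real m \<le> real (card S) * real a" by linarith
      then show ?thesis using a1 by (simp add: pos_divide_le_eq)
    qed
    \<comment> \<open>The shift by i < t in the falling factorial of card S is at most a fraction t
      a/m <= t K/m of m/a.\<close>
    define y where "y = 1 - 10 * e - real t * K / real m"
    have y0: "y \<ge> 0" using mK by (simp add: y_def)
    have gi: "y * real m / real a \<le> real (card S - i)" if "i < t" for i
    proof -
      have "y * real m = (1 - 10 * e) * real m - real t * K" using mpos by (simp add: y_def algebra_simps)
      also have "\<dots> \<le> (1 - 10 * e) * real m - real t * real a" using aK by (simp add: mult_left_mono)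
      finally have "y * real m / real a \<le> ((1 - 10 * e) * real m - real t * real a) / real a"
        using a1 by (intro divide_right_mono) auto
      also have "\<dots> = (1 - 10 * e) * real m / real a - real t" using a1 by (simp add: diff_divide_distrib)
      also have "\<dots> \<le> real (card S) - real i" using g that by simp
      finally show ?thesis by linarith
    qed
    have "(y * real m / real a) ^ t = (\<Prod>i<t. y * real m / real a)" by simp
    also have "\<dots> \<le> (\<Prod>i<t. real (card S - i))" using gi y0 by (intro prod_mono) auto
    finally have 1: "(y * real m / real a) ^ t \<le> real (\<Prod>i<t. card S - i)" by simp
    have 2: "real a ^ t / 2 ^ (t - 1)\<^sup>2 \<le> real (\<Prod>i<t. h - i)"
      by (rule falling_ratio_ge_perturbed[OF ta t _ e(2) hge]) (use e in simp)
    \<comment> \<open>The powers of \<open>a\<close> cancel, so the bound is uniform in the unknown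
      size \<open>a\<close>.\<close>
    have "2 / 2 ^ (t - 1)\<^sup>2 * y ^ t * real m ^ t = 2 * ((y * real m / real a) ^ t * (real a ^ t / 2 ^ (t - 1)\<^sup>2))"
      using a1 by (simp add: power_mult_distrib power_divide)
    also have "\<dots> \<le> 2 * (real (\<Prod>i<t. card S - i) * real (\<Prod>i<t. h - i))"
      using 1 2 y0 by (intro mult_left_mono mult_mono) (auto intro!: prod_nonneg)
    also have "\<dots> = real (2 * ((\<Prod>i<t. card S - i) * (\<Prod>i<t. h - i)))" by simp
    also have "\<dots> \<le> real (card (biclique_pairs t G))" using pairs by (simp only: of_nat_le_iff)
    finally show ?thesis unfolding y_def ..
  qed
qed

section \<open>Supersaturation\<close>

lemma graph_radius_sq_le:
  fixes G :: "'a::linorder graph"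
  assumes G: "simple_graph G" "verts G \<noteq> {}"
  shows "(graph_radius G)\<^sup>2 \<le> 2 * real (card (edges G))"
proof -
  obtain x where x: "\<And>v. 0 \<le> x v" "(\<Sum>v\<in>verts G. (x v)\<^sup>2) = 1"
    "\<And>v. v \<in> verts G \<Longrightarrow> (\<Sum>u\<in>verts G. adj G v u * x u) = graph_radius G * x v"
    "\<And>y. bform (adj G) (verts G) (verts G) y y \<le> graph_radius G * (\<Sum>v\<in>verts G. (y v)\<^sup>2)"
    by (rule graph_radius_eigenvector[OF G]) (rule that; assumption)
  have "(graph_radius G)\<^sup>2 = (\<Sum>v\<in>verts G. (graph_radius G * x v)\<^sup>2)"
    using x(2) by (simp add: power_mult_distrib flip: sum_distrib_left)
  also have "\<dots> = (\<Sum>v\<in>verts G. (\<Sum>u\<in>verts G. adj G v u * x u)\<^sup>2)"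
    by (intro sum.cong refl) (simp add: x(3))
  also have "\<dots> \<le> (\<Sum>v\<in>verts G. \<Sum>u\<in>verts G. adj G v u)"
    by (intro sum_mono adj_row_square_le x(2))
  also have "\<dots> = 2 * real (card (edges G))" by (rule sum_adj_eq_edges(2)[OF G(1)])
  finally show ?thesis .
qed

text \<open>The \<open>N\<close> windows between consecutive thresholds are pairwise disjoint, so
  not all of them can carry more than 1/N.\<close>

lemma exists_light_level:
  fixes d :: "'a \<Rightarrow> real" and f :: "'a \<Rightarrow> real"
  assumes V: "finite V" and f: "\<And>v. v \<in> V \<Longrightarrow> 0 \<le> f v" "sum f V \<le> 1"
    and s: "antimono s" and N: "N > 0"
  obtains i where "i < N" "(\<Sum>v\<in>{v \<in> V. s (Suc i) \<le> d v \<and> d v < s i}. f v) \<le> 1 / real N"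
proof (rule ccontr)
  define M where "M i = {v \<in> V. s (Suc i) \<le> d v \<and> d v < s i}" for i
  assume neg: "\<not> thesis"
  have gt: "\<And>i. i < N \<Longrightarrow> sum f (M i) > 1 / real N"
  proof (rule ccontr)
    fix i assume "i < N" "\<not> sum f (M i) > 1 / real N"
    then have thesis using that[of i] by (simp add: M_def)
    then show False using neg by simp
  qed
  have disj: "M i \<inter> M j = {}" if "i \<noteq> j" for i j
  proof -
    have "M i \<inter> M j = {}" if "i < j" for i j
    proof -
      have "s j \<le> s (Suc i)" using s that by (auto simp: antimono_def)
      then show ?thesis by (auto simp: M_def)
    qed
    then show ?thesis using \<open>i \<noteq> j\<close> by (metis Int_commute nat_neq_iff)
  qed
  have "1 = (\<Sum>i<N. 1 / real N)" using N by simp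
  also have "\<dots> < (\<Sum>i<N. sum f (M i))"
    using gt N by (intro sum_strict_mono) auto
  also have "\<dots> = sum f (\<Union>i<N. M i)"
    using V disj by (intro sum.UNION_disjoint[symmetric]) (auto simp: M_def)
  also have "\<dots> \<le> sum f V" using V f by (intro sum_mono2) (auto simp: M_def)
  finally show False using f by simp
qed

text \<open>The dense case. With the form close to sqrt m and at most 2m ordered adjacent pairs,
  \<open>hom_biclique_lower_bound\<close> leaves m^t / 2^(t(t-2)), up to powers of 1 - \<tau> and 1
  - \<eta>; the term with \<theta> pays for non-injective homomorphisms.\<close>

lemma biclique_pairs_low_degree_lower_bound:
  fixes G :: "'a graph"
  assumes t: "t \<ge> 2" and G: "simple_graph G" "card (edges G) = m" and m: "m > 0"
    and R: "R \<subseteq> verts G" and \<theta>: "0 \<le> \<theta>" "\<And>v. v \<in> R \<Longrightarrow> (\<Sum>u\<in>R. adj G v u) \<le> \<theta> * real m"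
    and w: "\<And>v. v \<in> R \<Longrightarrow> 0 \<le> w v" "(\<Sum>v\<in>R. (w v)\<^sup>2) = 1"
    and \<rho>: "\<rho> \<ge> 0" "\<rho>\<^sup>2 \<ge> (1 - \<eta>) * real m" and \<eta>: "0 \<le> \<eta>" "\<eta> \<le> 1" and \<tau>: "0 \<le> \<tau>" "\<tau> \<le> 1"
    and ray: "bform (adj G) R R w w \<ge> \<rho> * (1 - \<tau>)"
  shows "real (card (biclique_pairs t G)) \<ge>
    (2 / 2 ^ (t - 1)\<^sup>2 * (1 - 2 * (real t)\<^sup>2 * \<tau> - (real t)\<^sup>2 * \<eta>) - (real t)\<^sup>2 * 2 ^ t * \<theta>) * real m ^ t"
proof -
  have fin: "finite (verts G)" using G by (simp add: simple_graph_def)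
  have finR: "finite R" using R fin by (rule finite_subset)
  define P where "P = (\<Sum>U\<in>{..<t} \<rightarrow>\<^sub>E R. (\<Sum>v\<in>R. \<Prod>i<t. adj G (U i) v) ^ t)"
  define D where "D = (\<Sum>u\<in>R. \<Sum>v\<in>R. adj G u v)"
  define \<mu> where "\<mu> = bform (adj G) R R w w"
  have P0: "P \<ge> 0" unfolding P_def by (intro sum_nonneg zero_le_power prod_nonneg) auto
  have D0: "D \<ge> 0" unfolding D_def by (intro sum_nonneg) auto
  have Dm: "D \<le> 2 * real m"
  proof -
    have "D \<le> (\<Sum>u\<in>verts G. \<Sum>v\<in>verts G. adj G u v)"
      unfolding D_def sum.cartesian_product using R fin by (intro sum_mono2) auto
    then show ?thesis using sum_adj_eq_edges(2)[OF G(1)] G(2) by simp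
  qed
  define n n' r where "n = 2 * t * (t - 1)" and "n' = t * (t - 1)" and "r = t * (t - 2)"
  have nr: "n = 2 * n'" "n' = r + t"
  proof -
    show "n = 2 * n'" by (simp add: n_def n'_def)
    obtain j where "t = j + 2" using t by (metis add.commute le_Suc_ex)
    then show "n' = r + t" by (simp add: n'_def r_def)
  qed
  have "\<mu> ^ n \<le> P * D ^ r"
    unfolding \<mu>_def n_def P_def D_def r_def
    by (rule hom_biclique_lower_bound[OF finR t _ adj_commute w]) (auto simp: adj_def)
  also have "\<dots> \<le> P * (2 * real m) ^ r" using Dm D0 P0 by (intro mult_left_mono power_mono)
  finally have 1: "\<mu> ^ n \<le> P * 2 ^ r * real m ^ r" by (simp add: power_mult_distrib)
  have "(1 - \<tau>) ^ n * ((1 - \<eta>) * real m) ^ n' \<le> (1 - \<tau>) ^ n * (\<rho>\<^sup>2) ^ n'"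
    using \<rho> \<eta> \<tau> by (intro mult_left_mono power_mono) auto
  also have "\<dots> = (\<rho> * (1 - \<tau>)) ^ n"
    by (simp only: nr(1) power_mult_distrib power_mult[of \<rho> 2] mult.commute[of "\<rho> ^ _"])
      (simp add: power_mult[of \<rho> 2] mult.commute)
  also have "\<dots> \<le> \<mu> ^ n" unfolding \<mu>_def using ray \<rho> \<tau> by (intro power_mono) auto
  also note 1
  finally have "(1 - \<tau>) ^ n * (1 - \<eta>) ^ n' * real m ^ t * real m ^ r \<le> P * 2 ^ r * real m ^ r"
    by (simp add: power_mult_distrib nr(2) power_add mult_ac)
  then have 2: "(1 - \<tau>) ^ n * (1 - \<eta>) ^ n' * real m ^ t \<le> P * 2 ^ r" using m by simp
  have "1 - real n * \<tau> - real n' * \<eta> \<le> (1 - \<tau>) ^ n * (1 - \<eta>) ^ n'"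
  proof -
    have a: "1 + real n * (- \<tau>) \<le> (1 + (- \<tau>)) ^ n" using \<tau> by (intro Bernoulli_inequality) simp
    have b: "1 + real n' * (- \<eta>) \<le> (1 + (- \<eta>)) ^ n'" using \<eta> by (intro Bernoulli_inequality) simp
    define p q where "p = (1 - \<tau>) ^ n" and "q = (1 - \<eta>) ^ n'"
    have pq: "0 \<le> p" "p \<le> 1" "0 \<le> q" "q \<le> 1" using \<tau> \<eta> by (auto simp: p_def q_def power_le_one)
    have "0 \<le> (1 - p) * (1 - q)" using pq by simp
    then have "p + q - 1 \<le> p * q" by (simp add: algebra_simps)
    then show ?thesis using a b by (simp add: p_def q_def)
  qed
  moreover have "real n * \<tau> \<le> 2 * (real t)\<^sup>2 * \<tau>" "real n' * \<eta> \<le> (real t)\<^sup>2 * \<eta>"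
    using \<tau> \<eta> t by (auto simp: n_def n'_def power2_eq_square of_nat_diff intro!: mult_right_mono mult_left_mono)
  ultimately have "1 - 2 * (real t)\<^sup>2 * \<tau> - (real t)\<^sup>2 * \<eta> \<le> (1 - \<tau>) ^ n * (1 - \<eta>) ^ n'" by linarith
  then have "(1 - 2 * (real t)\<^sup>2 * \<tau> - (real t)\<^sup>2 * \<eta>) * real m ^ t \<le> P * 2 ^ r"
    using 2 by (meson mult_right_mono of_nat_0_le_iff order_trans zero_le_power)
  then have "(1 / 2 ^ r) * ((1 - 2 * (real t)\<^sup>2 * \<tau> - (real t)\<^sup>2 * \<eta>) * real m ^ t) \<le> P"
    by (simp add: field_simps)
  moreover have "2 / 2 ^ (t - 1)\<^sup>2 = 1 / (2 ^ r :: real)"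
  proof -
    \<comment> \<open>(t - 1)^2 = t (t - 2) + 1; the resulting factor 2 later cancels against the
      exchange of the sides in the automorphism group.\<close>
    have "(t - 1)\<^sup>2 = Suc r" using t
      by (auto simp: r_def power2_eq_square dest!: le_Suc_ex)
    then show ?thesis by simp
  qed
  ultimately have 3: "2 / 2 ^ (t - 1)\<^sup>2 * (1 - 2 * (real t)\<^sup>2 * \<tau> - (real t)\<^sup>2 * \<eta>) * real m ^ t \<le> P"
    by (simp add: mult.assoc)
  have "P \<le> real (card (biclique_pairs t G)) + 2 * (real t)\<^sup>2 * ((\<theta> * real m) * D ^ (t - 1))"
    unfolding P_def by (rule hom_count_le_biclique_pairs[OF G(1) R]) (use t \<theta> in \<open>auto simp: D_def\<close>)
  also have "\<dots> \<le> real (card (biclique_pairs t G)) + 2 * (real t)\<^sup>2 * ((\<theta> * real m) * (2 * real m) ^ (t - 1))"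
    using Dm D0 \<theta> by (intro add_left_mono mult_left_mono power_mono) auto
  also have "2 * (real t)\<^sup>2 * ((\<theta> * real m) * (2 * real m) ^ (t - 1)) = (real t)\<^sup>2 * 2 ^ t * \<theta> * real m ^ t"
    using t by (cases t) (simp_all add: power_mult_distrib)
  finally have "P \<le> real (card (biclique_pairs t G)) + (real t)\<^sup>2 * 2 ^ t * \<theta> * real m ^ t" .
  then show ?thesis using 3 by (simp add: left_diff_distrib)
qed

theorem biclique_pairs_supersaturation:
  fixes \<epsilon> :: real
  assumes t: "t \<ge> 2" and \<epsilon>: "\<epsilon> > 0"
  obtains m0 where "\<And>m (G :: 'a::linorder graph). m \<ge> m0 \<Longrightarrow> simple_graph G \<Longrightarrow> card (edges G) = m \<Longrightarrow>
    graph_radius G > graph_radius (split_graph (t - 1) m) \<Longrightarrow>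
    real (card (biclique_pairs t G)) \<ge> (2 / 2 ^ (t - 1)\<^sup>2 - \<epsilon>) * real m ^ t"
proof -
  define T where "T = real t"
  have T: "T \<ge> 2" using t by (simp add: T_def)
  define c where "c = (2 / 2 ^ (t - 1)\<^sup>2 :: real)"
  have c: "0 \<le> c" "c \<le> 1"
  proof -
    have "(2::real) ^ 1 \<le> 2 ^ (t - 1)\<^sup>2" using t by (intro power_increasing) auto
    then show "c \<le> 1" by (simp add: c_def field_simps)
  qed (simp add: c_def)
  \<comment> \<open>The first bound is required by
    \<open>split_graph_radius_or_many_bicliques\<close>; the second covers its relative loss 10 e +
    t K/m <= 11 e in each of t factors.\<close>
  define e where "e = min (1 / (512 * T ^ 3)) (\<epsilon> / (11 * T))"
  have e: "0 < e" "e \<le> 1 / (512 * T ^ 3)" "11 * T * e \<le> \<epsilon>"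
  proof -
    show "0 < e" "e \<le> 1 / (512 * T ^ 3)" using \<epsilon> T by (auto simp: e_def)
    have "e \<le> \<epsilon> / (11 * T)" by (simp add: e_def)
    then show "11 * T * e \<le> \<epsilon>" using T by (simp add: pos_le_divide_eq mult.commute)
  qed
  have e_small: "11 * e \<le> 1"
  proof -
    have "1 \<le> T ^ 3" using T by (simp add: one_le_power)
    then have "1 / (512 * T ^ 3) \<le> 1 / (512 * 1)" using T by (intro divide_left_mono) auto
    then show ?thesis using e(2) by simp
  qed
  \<comment> \<open>108 = 2 * 54: the dense case loses 2 t^2 \<tau> with \<tau> <= 54 \<omega>, and
    t^2 2^t \<theta> with \<theta> <= \<omega>.\<close>
  define A where "A = 108 * T\<^sup>2 + T\<^sup>2 * 2 ^ t"
  have A: "A \<ge> 432"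
  proof -
    have "2\<^sup>2 \<le> T\<^sup>2" using T by (intro power_mono) auto
    then have "4 \<le> T\<^sup>2" by simp
    moreover have "0 \<le> T\<^sup>2 * 2 ^ t" by simp
    ultimately show ?thesis unfolding A_def by linarith
  qed
  \<comment> \<open>The mass allowed on the middle vertices; e^2/24 keeps the error 12 \<omega> of
    the star case within e^2/2.\<close>
  define \<omega> where "\<omega> = min (1 / 100) (min (e\<^sup>2 / 24) (\<epsilon> / (2 * A)))"
  have \<omega>: "0 < \<omega>" "\<omega> \<le> 1 / 100" "12 * \<omega> \<le> e\<^sup>2 / 2" "A * \<omega> \<le> \<epsilon> / 2"
  proof -
    show "0 < \<omega>" using e \<epsilon> A by (auto simp: \<omega>_def)
    have le: "\<omega> \<le> 1 / 100" "\<omega> \<le> e\<^sup>2 / 24" "\<omega> \<le> \<epsilon> / (2 * A)" by (auto simp: \<omega>_def)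
    show "\<omega> \<le> 1 / 100" by (rule le)
    show "12 * \<omega> \<le> e\<^sup>2 / 2" using le(2) by simp
    have "A * \<omega> \<le> A * (\<epsilon> / (2 * A))" using le(3) A by (intro mult_left_mono) auto
    then show "A * \<omega> \<le> \<epsilon> / 2" using A by simp
  qed
  \<comment> \<open>Ratio of consecutive thresholds, chosen such that the orthogonality error
    \<open>B\<close> becomes 2 m \<omega> at every level.\<close>
  define \<theta> where "\<theta> = \<omega>\<^sup>2"
  have \<theta>: "0 < \<theta>" "\<theta> < 1" "sqrt \<theta> = \<omega>"
  proof -
    have "\<omega>\<^sup>2 \<le> (1 / 100)\<^sup>2" using \<omega> by (intro power_mono) auto
    then show "\<theta> < 1" by (simp add: \<theta>_def power_divide)
  qed (use \<omega> in \<open>simp_all add: \<theta>_def\<close>)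
  define N where "N = nat \<lceil>1 / \<omega>\<rceil>"
  have N: "N > 0" "1 / real N \<le> \<omega>"
  proof -
    have "0 < 1 / \<omega>" using \<omega> by simp
    then show "N > 0" by (simp add: N_def)
    have "1 / \<omega> \<le> real N" unfolding N_def by (rule real_nat_ceiling_ge)
    then show "1 / real N \<le> \<omega>" using \<omega> \<open>N > 0\<close> by (simp add: field_simps)
  qed
  \<comment> \<open>Bounds card L at every admissible level. It does not depend on \<open>m\<close>,
    so t K/m and K/sqrt m tend to 0.\<close>
  define K where "K = 2 / \<theta> ^ N"
  have K: "K > 0" using \<theta> by (simp add: K_def)
  define k where "k = t - 1"
  have "\<forall>\<^sub>F m in sequentially. real (2048 * k ^ 6) / real m < 1"
    by (rule order_tendstoD(2)[OF lim_const_over_n]) simp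
  moreover have "\<forall>\<^sub>F m in sequentially. (T * K) / real m < e"
    by (rule order_tendstoD(2)[OF lim_const_over_n]) (use e in simp)
  moreover have "\<forall>\<^sub>F m in sequentially. (2 * real k ^ 2) / real m < min (1 / 2) (min (e\<^sup>2 / 4) (\<epsilon> / (2 * T\<^sup>2)))"
    by (rule order_tendstoD(2)[OF lim_const_over_n]) (use e \<epsilon> T in simp)
  moreover have "\<forall>\<^sub>F m in sequentially. (3 * K * sqrt 2) / sqrt (real m) < e\<^sup>2 / 4"
    by (rule order_tendstoD(2)[OF tendsto_divide_0[OF tendsto_const
        filterlim_at_top_imp_at_infinity[OF filterlim_compose[OF sqrt_at_top filterlim_real_sequentially]]]]) (use e in simp)
  moreover have "\<forall>\<^sub>F m in sequentially. m > (0::nat)" by (rule eventually_gt_at_top)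
  ultimately have "\<forall>\<^sub>F m in sequentially. real (2048 * k ^ 6) / real m < 1 \<and> (T * K) / real m < e
      \<and> (2 * real k ^ 2) / real m < min (1 / 2) (min (e\<^sup>2 / 4) (\<epsilon> / (2 * T\<^sup>2)))
      \<and> (3 * K * sqrt 2) / sqrt (real m) < e\<^sup>2 / 4 \<and> m > 0"
    by eventually_elim simp
  then obtain m0 where m0: "\<And>m. m \<ge> m0 \<Longrightarrow> real (2048 * k ^ 6) / real m < 1 \<and> (T * K) / real m < e
      \<and> (2 * real k ^ 2) / real m < min (1 / 2) (min (e\<^sup>2 / 4) (\<epsilon> / (2 * T\<^sup>2)))
      \<and> (3 * K * sqrt 2) / sqrt (real m) < e\<^sup>2 / 4 \<and> m > 0"
    unfolding eventually_sequentially by blast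
  show thesis
  proof (rule that[of m0])
    fix m and G :: "'a graph"
    assume mm: "m \<ge> m0" and G: "simple_graph G" "card (edges G) = m"
      and gt: "graph_radius G > graph_radius (split_graph (t - 1) m)"
    have k1: "k \<ge> 1" using t by (simp add: k_def)
    have mpos: "real m > 0" using m0[OF mm] by simp
    have mk: "m \<ge> 2048 * k ^ 6"
    proof -
      have "real (2048 * k ^ 6) < real m" using m0[OF mm] mpos by (simp add: divide_less_eq)
      then show ?thesis by (simp only: of_nat_less_iff)
    qed
    define \<eta> where "\<eta> = (2 * real k ^ 2) / real m"
    have \<eta>: "0 \<le> \<eta>" "\<eta> \<le> 1 / 2" "\<eta> \<le> e\<^sup>2 / 4" "T\<^sup>2 * \<eta> \<le> \<epsilon> / 2"
    proof -
      show "0 \<le> \<eta>" "\<eta> \<le> 1 / 2" "\<eta> \<le> e\<^sup>2 / 4" using m0[OF mm] by (auto simp: \<eta>_def)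
      have "\<eta> \<le> \<epsilon> / (2 * T\<^sup>2)" using m0[OF mm] by (auto simp: \<eta>_def)
      then have "T\<^sup>2 * \<eta> \<le> T\<^sup>2 * (\<epsilon> / (2 * T\<^sup>2))" by (intro mult_left_mono) auto
      then show "T\<^sup>2 * \<eta> \<le> \<epsilon> / 2" using T by simp
    qed
    define \<rho> where "\<rho> = graph_radius G"
    define \<sigma> where "\<sigma> = graph_radius (split_graph k m)"
    have fin: "finite (verts G)" using G by (simp add: simple_graph_def)
    have ne: "verts G \<noteq> {}"
    proof
      assume "verts G = {}"
      then have "edges G = {}" using G by (auto simp: simple_graph_def)
      then show False using G mpos by simp
    qed
    have \<sigma>0: "0 \<le> \<sigma>" unfolding \<sigma>_def
      by (rule graph_radius_nonneg[OF simple_split_graph[OF k1]]) (auto simp: split_graph_structure(1))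
    have \<rho>0: "\<rho> > 0" using gt \<sigma>0 by (simp add: \<rho>_def \<sigma>_def k_def)
    \<comment> \<open>The common neighbours in the split graph alone give \<sigma>^2 >= k q, and m -
      k q is at most 2 k^2.\<close>
    have \<rho>lo: "\<rho>\<^sup>2 \<ge> (1 - \<eta>) * real m"
    proof -
      define q r where "q = (m - (k choose 2)) div k" and "r = (m - (k choose 2)) mod k"
      have "r < k" "m - (k choose 2) = k * q + r" using k1 by (simp_all add: q_def r_def)
      then have "real m \<le> real (k * q) + real k + real (k choose 2)" by linarith
      moreover have "real (k choose 2) \<le> real k ^ 2" "real k \<le> real k ^ 2"
        using k1 by (simp_all add: real_choose_two power2_eq_square field_simps)
      moreover have "real (k * q) \<le> \<sigma>\<^sup>2"
      proof -
        have "\<sigma>\<^sup>2 \<ge> (real k - 1) * \<sigma> + real (k * q) + (real r)\<^sup>2 / real k"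
          unfolding \<sigma>_def q_def r_def by (rule split_graph_radius_lower[OF k1])
        moreover have "(real k - 1) * \<sigma> \<ge> 0" using k1 \<sigma>0 by simp
        moreover have "(real r)\<^sup>2 / real k \<ge> 0" by simp
        ultimately show ?thesis by linarith
      qed
      moreover have "\<sigma>\<^sup>2 \<le> \<rho>\<^sup>2" using gt \<sigma>0 by (intro power_mono) (auto simp: \<rho>_def \<sigma>_def k_def)
      ultimately have "real m - 2 * real k ^ 2 \<le> \<rho>\<^sup>2" by linarith
      then show ?thesis using mpos by (simp add: \<eta>_def left_diff_distrib)
    qed
    have \<rho>hi: "\<rho>\<^sup>2 \<le> 2 * real m" using graph_radius_sq_le[OF G(1) ne] G(2) by (simp add: \<rho>_def)
    have \<rho>half: "\<rho>\<^sup>2 \<ge> real m / 2"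
    proof -
      have "1 / 2 * real m \<le> (1 - \<eta>) * real m" using \<eta> by (intro mult_right_mono) auto
      then show ?thesis using \<rho>lo by simp
    qed
    obtain x where x: "\<And>v. 0 \<le> x v" "(\<Sum>v\<in>verts G. (x v)\<^sup>2) = 1"
      "\<And>v. v \<in> verts G \<Longrightarrow> (\<Sum>u\<in>verts G. adj G v u * x u) = graph_radius G * x v"
      "\<And>y. bform (adj G) (verts G) (verts G) y y \<le> graph_radius G * (\<Sum>v\<in>verts G. (y v)\<^sup>2)"
      by (rule graph_radius_eigenvector[OF G(1) ne]) (rule that; assumption)
    define d where "d v = (\<Sum>u\<in>verts G. adj G v u)" for v
    define s where "s i = \<theta> ^ i * real m" for i
    have anti: "antimono s" unfolding s_def
      using \<theta> by (intro antimonoI mult_right_mono power_decreasing) auto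
    obtain i where i: "i < N" "(\<Sum>v\<in>{v \<in> verts G. s (Suc i) \<le> d v \<and> d v < s i}. (x v)\<^sup>2) \<le> 1 / real N"
      by (rule exists_light_level[OF fin _ _ anti N(1), of "\<lambda>v. (x v)\<^sup>2"]) (use x(2) in auto)
    define L where "L = {v \<in> verts G. s i \<le> d v}"
    define M where "M = {v \<in> verts G. s (Suc i) \<le> d v \<and> d v < s i}"
    define R where "R = {v \<in> verts G. d v < s (Suc i)}"
    have si: "s (Suc i) \<le> s i" using anti by (simp add: antimono_def)
    have VLMR: "verts G = L \<union> M \<union> R" using si by (auto simp: L_def M_def R_def)
    have disj: "L \<inter> M = {}" "L \<inter> R = {}" "M \<inter> R = {}" using si by (auto simp: L_def M_def R_def)
    have finLMR: "finite L" "finite M" "finite R" using fin by (auto simp: L_def M_def R_def)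
    have dsum: "(\<Sum>v\<in>verts G. d v) = 2 * real m"
      unfolding d_def using sum_adj_eq_edges(2)[OF G(1)] G(2) by simp
    have d0: "0 \<le> d v" for v unfolding d_def by (intro sum_nonneg) auto
    have thi: "\<theta> ^ i > 0" using \<theta> by simp
    define K' where "K' = 2 / \<theta> ^ i"
    have K': "real (card L) \<le> K'" "K' \<le> K" "0 < K'"
    proof -
      have "real (card L) * s i = (\<Sum>v\<in>L. s i)" by simp
      also have "\<dots> \<le> (\<Sum>v\<in>L. d v)" by (intro sum_mono) (auto simp: L_def)
      also have "\<dots> \<le> (\<Sum>v\<in>verts G. d v)" using fin d0 by (intro sum_mono2) (auto simp: L_def)
      finally have "(real (card L) * \<theta> ^ i) * real m \<le> 2 * real m" using dsum by (simp add: s_def mult.assoc)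
      then have "real (card L) * \<theta> ^ i \<le> 2" using mpos by simp
      then show "real (card L) \<le> K'" using thi by (simp add: K'_def pos_le_divide_eq)
      have "\<theta> ^ N \<le> \<theta> ^ i" using i(1) \<theta> by (intro power_decreasing) auto
      then show "K' \<le> K" unfolding K'_def K_def using \<theta> by (intro divide_left_mono) auto
      show "0 < K'" using thi by (simp add: K'_def)
    qed
    have \<Delta>: "(\<Sum>u\<in>R. adj G v u) \<le> s (Suc i)" if "v \<in> R" for v
    proof -
      have "(\<Sum>u\<in>R. adj G v u) \<le> d v" unfolding d_def using fin by (intro sum_mono2) (auto simp: R_def)
      then show ?thesis using that by (simp add: R_def)
    qed
    have DR: "(\<Sum>u\<in>R. \<Sum>v\<in>R. adj G u v) \<le> 2 * real m"
    proof -
      have "(\<Sum>u\<in>R. \<Sum>v\<in>R. adj G u v) \<le> (\<Sum>u\<in>verts G. \<Sum>v\<in>verts G. adj G u v)"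
        unfolding sum.cartesian_product using fin by (intro sum_mono2) (auto simp: R_def)
      then show ?thesis using dsum by (simp add: d_def)
    qed
    define B where "B = 2 * real m * \<omega>"
    \<comment> \<open>card L is at most 2/\<theta>^i and degrees in \<open>R\<close> are below
      \<theta>^(i+1) m; the level \<open>i\<close> cancels in the product.\<close>
    have B: "B = sqrt (K' * (s (Suc i) * (2 * real m)))"
    proof -
      have "K' * (s (Suc i) * (2 * real m)) = B\<^sup>2"
        using thi by (simp add: K'_def s_def B_def \<theta>_def power2_eq_square)
      then show ?thesis using \<omega> by (simp add: B_def)
    qed
    \<comment> \<open>The dichotomy is applied with 1/6 for its parameter \<open>\<sigma>\<close>;
      the bound 54 below is 6 * (1 + 8).\<close>
    define \<tau> where "\<tau> = (\<omega> + 2 * B / \<rho>\<^sup>2) / (1 / 6)"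
    have \<tau>: "0 \<le> \<tau>" "\<tau> \<le> 54 * \<omega>"
    proof -
      show "0 \<le> \<tau>" using \<omega> by (simp add: \<tau>_def B_def)
      have "2 * B / \<rho>\<^sup>2 \<le> 2 * B / (real m / 2)"
        using \<rho>half \<rho>0 mpos \<omega> by (intro divide_left_mono) (auto simp: B_def)
      also have "\<dots> = 8 * \<omega>" using mpos by (simp add: B_def)
      finally show "\<tau> \<le> 54 * \<omega>" by (simp add: \<tau>_def)
    qed
    have \<tau>1: "\<tau> < 1" using \<tau> \<omega> by linarith
    have x1: "(\<Sum>v\<in>L \<union> M \<union> R. (x v)\<^sup>2) = 1" using x(2) unfolding VLMR .
    have eig: "(\<Sum>u\<in>L \<union> M \<union> R. adj G v u * x u) = \<rho> * x v" if "v \<in> L \<union> M \<union> R" for v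
      using x(3)[of v] that unfolding VLMR \<rho>_def .
    have lightM: "(\<Sum>v\<in>M. (x v)\<^sup>2) \<le> \<omega>" using i(2) N(2) by (simp add: M_def)
    have s0: "0 \<le> s (Suc i)" using \<theta> by (simp add: s_def)
    show "real (card (biclique_pairs t G)) \<ge> (2 / 2 ^ (t - 1)\<^sup>2 - \<epsilon>) * real m ^ t"
    proof (rule spectral_dichotomy[OF finLMR disj adj_commute adj_nonneg adj_le_1 x(1) x1 eig \<rho>0 lightM \<Delta> s0 DR K'(1) B _ \<tau>_def \<tau>1])
      show "v \<in> L \<union> M \<union> R" if "v \<in> L \<union> M \<union> R" for v by (rule that)
      show "v \<in> R" if "v \<in> R" for v by (rule that)
      show "(0::real) < 1 / 6" by simp
    next
      fix w assume w: "\<And>v. v \<in> R \<Longrightarrow> 0 \<le> w v" "(\<Sum>v\<in>R. (w v)\<^sup>2) = 1"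
        "bform (adj G) R R w w \<ge> \<rho> * (1 - \<tau>)"
      have "real (card (biclique_pairs t G)) \<ge>
        (2 / 2 ^ (t - 1)\<^sup>2 * (1 - 2 * (real t)\<^sup>2 * \<tau> - (real t)\<^sup>2 * \<eta>) - (real t)\<^sup>2 * 2 ^ t * \<theta>) * real m ^ t"
      proof (rule biclique_pairs_low_degree_lower_bound[OF t G _ _ _ _ w(1,2) _ \<rho>lo _ _ \<tau>(1) _ w(3)])
        show "R \<subseteq> verts G" by (auto simp: R_def)
        have "s (Suc i) \<le> \<theta> * real m"
          using \<theta> mpos by (simp add: s_def power_le_one mult_left_le)
        then show "(\<Sum>u\<in>R. adj G v u) \<le> \<theta> * real m" if "v \<in> R" for v using \<Delta>[OF that] by linarith
      qed (use mpos \<theta> \<eta> \<rho>0 \<tau>1 in auto)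
      moreover have "2 / 2 ^ (t - 1)\<^sup>2 - \<epsilon>
        \<le> 2 / 2 ^ (t - 1)\<^sup>2 * (1 - 2 * (real t)\<^sup>2 * \<tau> - (real t)\<^sup>2 * \<eta>) - (real t)\<^sup>2 * 2 ^ t * \<theta>"
      proof -
        define X Y W where "X = 2 * T\<^sup>2 * (54 * \<omega>)" and "Y = T\<^sup>2 * 2 ^ t * \<theta>" and "W = T\<^sup>2 * 2 ^ t * \<omega>"
        have "c * (2 * T\<^sup>2 * \<tau> + T\<^sup>2 * \<eta>) \<le> 1 * (X + \<epsilon> / 2)"
          unfolding X_def using c \<tau> \<eta> \<omega> by (intro mult_mono add_mono mult_left_mono) auto
        moreover have "Y \<le> W"
          unfolding Y_def W_def \<theta>_def power2_eq_square[of \<omega>] using \<omega> by (intro mult_left_mono) auto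
        moreover have "X + W \<le> \<epsilon> / 2"
          using \<omega>(4) by (simp add: A_def X_def W_def algebra_simps)
        ultimately have "c * (2 * T\<^sup>2 * \<tau> + T\<^sup>2 * \<eta>) + Y \<le> \<epsilon>" by simp
        then have "c * (2 * T\<^sup>2 * \<tau> + T\<^sup>2 * \<eta>) + T\<^sup>2 * 2 ^ t * \<theta> \<le> \<epsilon>" by (simp add: Y_def)
        then show ?thesis unfolding c_def[symmetric] T_def[symmetric] by (simp add: algebra_simps)
      qed
      then have "(2 / 2 ^ (t - 1)\<^sup>2 - \<epsilon>) * real m ^ t
        \<le> (2 / 2 ^ (t - 1)\<^sup>2 * (1 - 2 * (real t)\<^sup>2 * \<tau> - (real t)\<^sup>2 * \<eta>) - (real t)\<^sup>2 * 2 ^ t * \<theta>) * real m ^ t"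
        by (intro mult_right_mono) auto
      ultimately show ?thesis by linarith
    next
      define p where "p = (\<Sum>v\<in>L. (x v)\<^sup>2)"
      assume p: "(\<Sum>v\<in>L. (x v)\<^sup>2) > (1 - \<omega> - 1 / 6) / 2"
        and z: "(\<Sum>v\<in>R. (\<Sum>u\<in>L. adj G v u * x u)\<^sup>2)
          \<ge> \<rho>\<^sup>2 * (\<Sum>v\<in>L. (x v)\<^sup>2) - \<rho> * K' - 2 * \<rho>\<^sup>2 * \<omega> - B"
      \<comment> \<open>Half of 1 - 1/100 - 1/6 exceeds 1/3, so normalising \<open>x\<close> on
        \<open>L\<close> inflates the errors at most threefold.\<close>
      have p3: "p \<ge> 1 / 3" using p \<omega> by (simp add: p_def)
      define x' where "x' v = x v / sqrt p" for v
      have x'0: "0 \<le> x' v" for v using x(1) p3 by (simp add: x'_def)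
      have x'1: "(\<Sum>v\<in>L. (x' v)\<^sup>2) = 1"
        using p3 by (simp add: x'_def power_divide p_def flip: sum_divide_distrib)
      have "(\<Sum>v\<in>R. (\<Sum>u\<in>L. adj G v u * x' u)\<^sup>2) = (\<Sum>v\<in>R. (\<Sum>u\<in>L. adj G v u * x u)\<^sup>2) / p"
        using p3 by (simp add: x'_def power_divide flip: sum_divide_distrib)
      also have "\<dots> \<ge> (\<rho>\<^sup>2 * p - \<rho> * K' - 2 * \<rho>\<^sup>2 * \<omega> - B) / p"
        using z p3 unfolding p_def[symmetric] by (intro divide_right_mono) auto
      also have "(\<rho>\<^sup>2 * p - \<rho> * K' - 2 * \<rho>\<^sup>2 * \<omega> - B) / p = \<rho>\<^sup>2 - (\<rho> * K' + 2 * \<rho>\<^sup>2 * \<omega> + B) / p"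
        using p3 by (simp add: diff_divide_distrib add_divide_distrib)
      also have "\<dots> \<ge> \<rho>\<^sup>2 - 3 * (\<rho> * K' + 2 * \<rho>\<^sup>2 * \<omega> + B)"
      proof -
        have "0 \<le> \<rho> * K' + 2 * \<rho>\<^sup>2 * \<omega> + B" using \<rho>0 K' \<omega> by (simp add: B_def)
        then have "(\<rho> * K' + 2 * \<rho>\<^sup>2 * \<omega> + B) / p \<le> (\<rho> * K' + 2 * \<rho>\<^sup>2 * \<omega> + B) / (1 / 3)"
          using p3 by (intro divide_left_mono) auto
        then show ?thesis by simp
      qed
      \<comment> \<open>Error budget e^2 m: a quarter for \<rho> K', a quarter for \<eta>, and half
        for 12 \<omega>.\<close>
      also have "\<rho>\<^sup>2 - 3 * (\<rho> * K' + 2 * \<rho>\<^sup>2 * \<omega> + B) \<ge> (1 - e\<^sup>2) * real m"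
      proof -
        have "\<rho> \<le> sqrt 2 * sqrt (real m)" using \<rho>hi by (simp add: real_le_rsqrt flip: real_sqrt_mult)
        then have "3 * (\<rho> * K') \<le> 3 * ((sqrt 2 * sqrt (real m)) * K)"
          using \<rho>0 K' K by (intro mult_left_mono mult_mono) auto
        also have "\<dots> = ((3 * K * sqrt 2) / sqrt (real m)) * real m"
          using mpos by (simp add: real_div_sqrt field_simps)
        also have "\<dots> \<le> e\<^sup>2 / 4 * real m" using m0[OF mm] by (intro mult_right_mono) auto
        finally have 1: "3 * (\<rho> * K') \<le> e\<^sup>2 / 4 * real m" .
        have 2: "\<rho>\<^sup>2 * (1 - 6 * \<omega>) \<ge> ((1 - \<eta>) * real m) * (1 - 6 * \<omega>)"
          using \<rho>lo \<omega> by (intro mult_right_mono) auto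
        have 3: "(1 - \<eta>) * (1 - 6 * \<omega>) \<ge> 1 - \<eta> - 6 * \<omega>" using \<eta> \<omega> by (simp add: algebra_simps)
        have "((1 - \<eta>) * real m) * (1 - 6 * \<omega>) - 6 * \<omega> * real m \<ge> (1 - \<eta> - 12 * \<omega>) * real m"
          using mult_right_mono[OF 3, of "real m"] by (simp add: algebra_simps)
        moreover have "(1 - \<eta> - 12 * \<omega>) * real m \<ge> (1 - e\<^sup>2 / 4 - e\<^sup>2 / 2) * real m"
          using \<eta> \<omega> by (intro mult_right_mono) auto
        ultimately show ?thesis using 1 2 by (simp add: B_def algebra_simps)
      qed
      finally have z': "(\<Sum>v\<in>R. (\<Sum>u\<in>L. adj G v u * x' u)\<^sup>2) \<ge> (1 - e\<^sup>2) * real m" .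
      have TK: "T * K / real m < e" using m0[OF mm] by simp
      have "graph_radius G \<le> graph_radius (split_graph (t - 1) m)
        \<or> real (card (biclique_pairs t G)) \<ge> 2 / 2 ^ (t - 1)\<^sup>2 * (1 - 10 * e - real t * K / real m) ^ t * real m ^ t"
        by (rule split_graph_radius_or_many_bicliques[OF t e(1) _ G _ _ _ _ x'0 x'1 z'])
          (use e mk K' e_small TK si in \<open>auto simp: T_def k_def L_def R_def\<close>)
      then have "real (card (biclique_pairs t G)) \<ge> c * (1 - 10 * e - T * K / real m) ^ t * real m ^ t"
        using gt by (simp add: c_def T_def)
      moreover have "(c - \<epsilon>) \<le> c * (1 - 10 * e - T * K / real m) ^ t"
      proof -
        have "1 + real t * (- (11 * e)) \<le> (1 + (- (11 * e))) ^ t"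
          using e_small by (intro Bernoulli_inequality) simp
        also have "\<dots> \<le> (1 - 10 * e - T * K / real m) ^ t"
          using TK e_small by (intro power_mono) auto
        finally have "c * (1 - 11 * T * e) \<le> c * (1 - 10 * e - T * K / real m) ^ t"
          using c by (intro mult_left_mono) (auto simp: T_def)
        moreover have "c * (11 * T * e) \<le> 1 * (11 * T * e)" using c e T by (intro mult_right_mono) auto
        ultimately show ?thesis using e(3) by (simp add: right_diff_distrib)
      qed
      then have "(c - \<epsilon>) * real m ^ t \<le> c * (1 - 10 * e - T * K / real m) ^ t * real m ^ t"
        by (intro mult_right_mono) auto
      ultimately show ?thesis by (simp add: c_def)
    qed
  qed
qed

section \<open>Uniform random graphs\<close>

lemma edge_complete_bipartite_iff:
  assumes "u < t + t" "v < t + t"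
  shows "{u, v} \<in> edges (complete_bipartite t t) \<longleftrightarrow> (u < t) \<noteq> (v < t)"
proof
  assume "{u, v} \<in> edges (complete_bipartite t t)"
  then obtain i j where "{u, v} = {i, j}" "i < t" "t \<le> j" by (auto simp: complete_bipartite_def)
  then show "(u < t) \<noteq> (v < t)" by (auto simp: doubleton_eq_iff)
next
  assume "(u < t) \<noteq> (v < t)"
  then consider "u < t" "t \<le> v" | "v < t" "t \<le> u" by linarith
  then show "{u, v} \<in> edges (complete_bipartite t t)"
    using assms by cases (auto simp: complete_bipartite_def insert_commute[of u v])
qed

lemma simple_complete_bipartite: "simple_graph (complete_bipartite t t)"
  by (auto simp: simple_graph_def complete_bipartite_def card_insert_if)

lemma card_edges_complete_bipartite: "card (edges (complete_bipartite t t)) = t\<^sup>2"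
proof -
  have "edges (complete_bipartite t t) = (\<lambda>(i, j). {i, j}) ` ({..<t} \<times> {t..<t + t})"
    unfolding complete_bipartite_def by (auto; metis)
  moreover have "inj_on (\<lambda>(i, j). {i, j}) ({..<t} \<times> {t..<t + t})"
    by (auto simp: inj_on_def doubleton_eq_iff)
  ultimately show ?thesis by (simp add: card_image power2_eq_square)
qed

lemma prod_falling_fact: "(\<Prod>i<t. t - i) = fact t"
  by (subst fact_prod_rev) (simp add: atLeast0LessThan)

text \<open>Both bounds compare with pairs of injections into opposite sides, in either order: such
  a pair glues to an injective endomorphism, and an automorphism preserves or exchanges the sides.
  For t >= 1 the two orders are distinct, whence the factor 2.\<close>

lemma card_automorphisms_complete_bipartite:
  assumes t: "t \<ge> 1"
  shows "card (automorphisms (complete_bipartite t t)) = 2 * (fact t)\<^sup>2"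
proof -
  define H where "H = complete_bipartite t t"
  define A B where "A = {..<t}" and "B = {t..<t + t}"
  define I where "I S = {f \<in> {..<t} \<rightarrow>\<^sub>E S. inj_on f {..<t}}" for S :: "nat set"
  have V: "verts H = {..<t + t}" by (simp add: H_def complete_bipartite_def)
  have finI: "finite (I S)" if "finite S" for S using that by (auto simp: I_def intro!: finite_PiE)
  have cI: "card (I S) = fact t" if "finite S" "card S = t" for S
    using card_inj_PiE[OF that(1), of t] that(2) by (simp add: I_def prod_falling_fact)
  have fAB: "finite A" "card A = t" "finite B" "card B = t" by (auto simp: A_def B_def)
  define X where "X = I A \<times> I B \<union> I B \<times> I A"
  have disj: "I A \<times> I B \<inter> I B \<times> I A = {}"
  proof -
    have False if "U \<in> I A" "U \<in> I B" for U
      using that t PiE_mem[of U "{..<t}" "\<lambda>_. A" 0] PiE_mem[of U "{..<t}" "\<lambda>_. B" 0] by (simp add: I_def A_def B_def)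
    then show ?thesis by blast
  qed
  have cX: "card X = 2 * (fact t)\<^sup>2"
    unfolding X_def using disj fAB cI finI by (simp add: card_Un_disjoint power2_eq_square)
  have finAut: "finite (automorphisms H)"
    by (rule finite_subset[of _ "verts H \<rightarrow>\<^sub>E verts H"]) (auto simp: automorphisms_def V intro: finite_PiE)
  have edge: "{u, v} \<in> edges H \<longleftrightarrow> (u < t) \<noteq> (v < t)" if "u < t + t" "v < t + t" for u v
    unfolding H_def by (rule edge_complete_bipartite_iff[OF that])
  have "card X \<le> card (automorphisms H)"
  proof -
    have IS: "f \<in> {..<t} \<rightarrow>\<^sub>E verts H" "inj_on f {..<t}" "\<And>i. i < t \<Longrightarrow> f i \<in> S"
      if "f \<in> I S" "S \<subseteq> verts H" for f S
    proof -
      have f: "f \<in> {..<t} \<rightarrow>\<^sub>E S" "inj_on f {..<t}" using that(1) by (simp_all add: I_def)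
      show "inj_on f {..<t}" by (rule f)
      show "f i \<in> S" if "i < t" for i using PiE_mem[OF f(1)] that by simp
      have "({..<t} \<rightarrow>\<^sub>E S) \<subseteq> ({..<t} \<rightarrow>\<^sub>E verts H)" using that(2) by (intro PiE_mono)
      then show "f \<in> {..<t} \<rightarrow>\<^sub>E verts H" using f(1) by blast
    qed
    have AV: "A \<subseteq> verts H" "B \<subseteq> verts H" by (auto simp: A_def B_def V)
    have opp: "{u, v} \<in> edges H" if "u \<in> A \<and> v \<in> B \<or> u \<in> B \<and> v \<in> A" for u v
      using that edge[of u v] by (auto simp: A_def B_def)
    have "(U, W) \<in> biclique_pairs t H" if "(U, W) \<in> X" for U W
    proof -
      from that consider "U \<in> I A" "W \<in> I B" | "U \<in> I B" "W \<in> I A" by (auto simp: X_def)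
      then show ?thesis
      proof cases
        case 1
        then show ?thesis using IS[OF 1(1) AV(1)] IS[OF 1(2) AV(2)] opp
          by (simp add: biclique_pairs_def)
      next
        case 2
        then show ?thesis using IS[OF 2(1) AV(2)] IS[OF 2(2) AV(1)] opp
          by (simp add: biclique_pairs_def)
      qed
    qed
    then have "X \<subseteq> biclique_pairs t H" by (intro subrelI)
    then have "card X \<le> card (biclique_pairs t H)"
      by (intro card_mono finite_biclique_pairs) (auto simp: V)
    also have "\<dots> \<le> card (inj_homs H H)"
      unfolding H_def by (intro card_biclique_pairs_le simple_complete_bipartite)
    also have "\<dots> \<le> card (automorphisms H)"
    proof (intro card_mono finAut subsetI)
      fix f assume f: "f \<in> inj_homs H H"
      then have fV: "f \<in> verts H \<rightarrow>\<^sub>E verts H" and inj: "inj_on f (verts H)"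
        and hom: "\<And>u v. u < t + t \<Longrightarrow> v < t + t \<Longrightarrow> {u, v} \<in> edges H \<Longrightarrow> {f u, f v} \<in> edges H"
        by (auto simp: inj_homs_def V)
      have fb: "f u < t + t" if "u < t + t" for u using fV that by (auto simp: V)
      have "f ` verts H = verts H"
        using fV inj by (intro endo_inj_surj) (auto simp: V)
      then have bij: "bij_betw f (verts H) (verts H)" using inj by (simp add: bij_betw_def)
      \<comment> \<open>Vertices on opposite sides have images on opposite sides. With only two
        sides this forces vertices of one side to stay together, so non-edges are preserved as
        well.\<close>
      have side: "(f u < t) \<noteq> (f v < t)" if "u < t" "t \<le> v" "v < t + t" for u v
        using hom[of u v] edge[of u v] edge[of "f u" "f v"] fb that by auto
      have "{u, v} \<in> edges H \<longleftrightarrow> {f u, f v} \<in> edges H" if uv: "u < t + t" "v < t + t" for u v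
      proof -
        have tt: "t \<le> t" "t < t + t" "0 < t" using t by auto
        have "(u < t) \<noteq> (v < t) \<longleftrightarrow> (f u < t) \<noteq> (f v < t)"
        proof (cases "u < t")
          case True
          then show ?thesis using side[OF True, of v] side[OF True tt(1,2)] side[of v t] tt uv
            by (cases "v < t") auto
        next
          case False
          then show ?thesis using side[of v u] side[OF tt(3), of u] side[OF tt(3), of v] uv
            by (cases "v < t") auto
        qed
        then show ?thesis using edge[OF uv] edge[OF fb fb, OF uv] by simp
      qed
      then show "f \<in> automorphisms H" using fV bij by (auto simp: automorphisms_def V)
    qed
    finally show ?thesis .
  qed
  moreover have "card (automorphisms H) \<le> card X"
  proof (rule card_inj_on_le)
    define \<psi> where "\<psi> f = (\<lambda>i\<in>{..<t}. f i :: nat, \<lambda>i\<in>{..<t}. f (t + i) :: nat)" for f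
    show "finite X" unfolding X_def using finI fAB by auto
    show "inj_on \<psi> (automorphisms H)"
    proof (rule inj_onI)
      fix f g assume fg: "f \<in> automorphisms H" "g \<in> automorphisms H" "\<psi> f = \<psi> g"
      show "f = g"
      proof
        fix i
        have a: "f i = g i" if "i < t" for i
          using fun_cong[OF arg_cong[OF fg(3), of fst], of i] that by (simp add: \<psi>_def)
        have b: "f (t + i) = g (t + i)" if "i < t" for i
          using fun_cong[OF arg_cong[OF fg(3), of snd], of i] that by (simp add: \<psi>_def)
        consider "i < t" | "t \<le> i" "i < t + t" | "t + t \<le> i" by linarith
        then show "f i = g i"
        proof cases
          case 2
          then show ?thesis using b[of "i - t"] by simp
        next
          case 3
          then show ?thesis using fg(1,2) by (auto simp: automorphisms_def V PiE_def extensional_def)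
        qed (rule a)
      qed
    qed
    show "\<psi> ` automorphisms H \<subseteq> X"
    proof (rule image_subsetI)
      fix f assume f: "f \<in> automorphisms H"
      then have fb: "f u < t + t" if "u < t + t" for u
        using that by (auto simp: automorphisms_def V)
      have inj: "inj_on f {..<t + t}" using f by (auto simp: automorphisms_def V bij_betw_def)
      have side: "(u < t) \<noteq> (v < t) \<longleftrightarrow> (f u < t) \<noteq> (f v < t)" if uv: "u < t + t" "v < t + t" for u v
        using f uv edge[OF uv] edge[OF fb fb, OF uv] by (auto simp: automorphisms_def V)
      have in1: "inj_on (\<lambda>i\<in>{..<t}. f i) {..<t}" "inj_on (\<lambda>i\<in>{..<t}. f (t + i)) {..<t}"
      proof -
        show "inj_on (\<lambda>i\<in>{..<t}. f i) {..<t}"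
        proof (rule inj_onI)
          fix i j assume "i \<in> {..<t}" "j \<in> {..<t}" "(\<lambda>i\<in>{..<t}. f i) i = (\<lambda>i\<in>{..<t}. f i) j"
          then show "i = j" using inj_onD[OF inj, of i j] by simp
        qed
        show "inj_on (\<lambda>i\<in>{..<t}. f (t + i)) {..<t}"
        proof (rule inj_onI)
          fix i j assume "i \<in> {..<t}" "j \<in> {..<t}" "(\<lambda>i\<in>{..<t}. f (t + i)) i = (\<lambda>i\<in>{..<t}. f (t + i)) j"
          then show "i = j" using inj_onD[OF inj, of "t + i" "t + j"] by simp
        qed
      qed
      \<comment> \<open>The image of vertex 0 decides whether the sides are kept or
        exchanged.\<close>
      have s0: "(u < t) \<longleftrightarrow> ((f u < t) = (f 0 < t))" if "u < t + t" for u
        using side[of u 0] that t by auto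
      show "\<psi> f \<in> X"
      proof (cases "f 0 < t")
        case True
        then have "f i \<in> A" "f (t + i) \<in> B" if "i < t" for i
          using s0[of i] s0[of "t + i"] fb[of "t + i"] that by (auto simp: A_def B_def)
        then have "(\<lambda>i\<in>{..<t}. f i) \<in> I A" "(\<lambda>i\<in>{..<t}. f (t + i)) \<in> I B"
          using in1 unfolding I_def by (simp_all only: mem_Collect_eq restrict_PiE_iff simp_thms lessThan_iff Ball_def) blast+
        then show ?thesis by (simp add: X_def \<psi>_def)
      next
        case False
        then have "f i \<in> B" "f (t + i) \<in> A" if "i < t" for i
          using s0[of i] s0[of "t + i"] fb[of i] that by (auto simp: A_def B_def)
        then have "(\<lambda>i\<in>{..<t}. f i) \<in> I B" "(\<lambda>i\<in>{..<t}. f (t + i)) \<in> I A"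
          using in1 unfolding I_def by (simp_all only: mem_Collect_eq restrict_PiE_iff simp_thms lessThan_iff Ball_def) blast+
        then show ?thesis by (simp add: X_def \<psi>_def)
      qed
    qed
  qed
  ultimately show ?thesis using cX by (simp add: H_def)
qed

text \<open>The quotient of the binomial coefficients is the probability that \<open>s\<close> given
  elements lie in a uniform m-subset of \<open>N\<close> elements, the product of (m - i)/(N - i),
  with each factor at most m/N. Written without division to stay in the naturals.\<close>

lemma binomial_ratio_le:
  fixes N m s :: nat
  assumes "s \<le> m" "m \<le> N"
  shows "((N - s) choose (m - s)) * N ^ s \<le> (N choose m) * m ^ s"
  using assms(1)
proof (induction s)
  case 0
  then show ?case by simp
next
  case (Suc s)
  define M l where "M = N - Suc s" and "l = m - Suc s"
  have Ml: "N - s = Suc M" "m - s = Suc l" using Suc.prems assms(2) by (auto simp: M_def l_def)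
  have "Suc M * (M choose l) = (Suc M choose Suc l) * Suc l" by (rule Suc_times_binomial_eq)
  have "N * Suc l \<le> m * Suc M"
  proof -
    have "Suc l = m - s" "Suc M = N - s" using Ml by auto
    moreover have "N * (m - s) \<le> m * (N - s)"
      using assms(2) by (simp add: diff_mult_distrib2 mult.commute[of N m] diff_le_mono2)
    ultimately show ?thesis by simp
  qed
  have "Suc M * ((M choose l) * N) = (Suc M choose Suc l) * (N * Suc l)"
    using \<open>Suc M * (M choose l) = (Suc M choose Suc l) * Suc l\<close> by (metis mult.assoc mult.commute)
  also have "\<dots> \<le> (Suc M choose Suc l) * (m * Suc M)"
    using \<open>N * Suc l \<le> m * Suc M\<close> by (intro mult_left_mono) auto
  also have "\<dots> = Suc M * ((Suc M choose Suc l) * m)" by (simp only: mult_ac)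
  finally have "(M choose l) * N \<le> (Suc M choose Suc l) * m" by (simp only: Suc_mult_le_cancel1)
  then have "(M choose l) * N * N ^ s \<le> (Suc M choose Suc l) * m * N ^ s" by (intro mult_right_mono) auto
  also have "\<dots> = ((N - s choose (m - s)) * N ^ s) * m" by (simp add: Ml)
  also have "\<dots> \<le> ((N choose m) * m ^ s) * m" using Suc by (intro mult_right_mono) auto
  finally show ?case by (simp add: M_def l_def mult_ac)
qed

lemma card_supersets_of_size:
  assumes P: "finite P" and F: "F \<subseteq> P" "card F \<le> m"
  shows "card {E. E \<subseteq> P \<and> card E = m \<and> F \<subseteq> E} = (card P - card F) choose (m - card F)"
proof -
  have finF: "finite F" using P F finite_subset by blast
  have "bij_betw (\<lambda>E. E \<union> F) {E. E \<subseteq> P - F \<and> card E = m - card F} {E. E \<subseteq> P \<and> card E = m \<and> F \<subseteq> E}"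
  proof (rule bij_betw_byWitness[where f' = "\<lambda>E. E - F"])
    show "\<forall>E\<in>{E. E \<subseteq> P - F \<and> card E = m - card F}. E \<union> F - F = E" by auto
    show "\<forall>E\<in>{E. E \<subseteq> P \<and> card E = m \<and> F \<subseteq> E}. E - F \<union> F = E" by auto
    show "(\<lambda>E. E \<union> F) ` {E. E \<subseteq> P - F \<and> card E = m - card F} \<subseteq> {E. E \<subseteq> P \<and> card E = m \<and> F \<subseteq> E}"
    proof (clarsimp)
      fix E assume E: "E \<subseteq> P - F" "card E = m - card F"
      then have "finite E" "E \<inter> F = {}" using P finite_subset by blast+
      then have "card (E \<union> F) = m" using E finF F(2) by (simp add: card_Un_disjoint)
      then show "E \<subseteq> P \<and> F \<subseteq> P \<and> card (E \<union> F) = m" using E F by auto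
    qed
    show "(\<lambda>E. E - F) ` {E. E \<subseteq> P \<and> card E = m \<and> F \<subseteq> E} \<subseteq> {E. E \<subseteq> P - F \<and> card E = m - card F}"
      using finF by (auto simp: card_Diff_subset)
  qed
  then have "card {E. E \<subseteq> P \<and> card E = m \<and> F \<subseteq> E} = card {E. E \<subseteq> P - F \<and> card E = m - card F}"
    by (simp add: bij_betw_same_card)
  also have "\<dots> = (card (P - F)) choose (m - card F)" using P by (intro n_subsets) auto
  finally show ?thesis using finF F by (simp add: card_Diff_subset)
qed

definition vertex_pairs :: "nat \<Rightarrow> nat set set" where
  "vertex_pairs n = {e. e \<subseteq> {1..n} \<and> card e = 2}"

lemma finite_vertex_pairs: "finite (vertex_pairs n)"
  by (rule finite_subset[of _ "Pow {1..n}"]) (auto simp: vertex_pairs_def)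

lemma card_vertex_pairs: "card (vertex_pairs n) = n choose 2"
  unfolding vertex_pairs_def using n_subsets[of "{1..n}" 2] by simp

lemma gnm_eq: "gnm n m = Graph {1..n} ` {E. E \<subseteq> vertex_pairs n \<and> card E = m}"
proof (intro equalityI subsetI)
  fix G assume "G \<in> gnm n m"
  then have G: "simple_graph G" "verts G = {1..n}" "card (edges G) = m" by (auto simp: gnm_def)
  then have "G = Graph {1..n} (edges G)" by (cases G) simp
  moreover have "edges G \<subseteq> vertex_pairs n"
    using G by (auto simp: simple_graph_def vertex_pairs_def)
  ultimately show "G \<in> Graph {1..n} ` {E. E \<subseteq> vertex_pairs n \<and> card E = m}" using G(3) by blast
next
  fix G assume "G \<in> Graph {1..n} ` {E. E \<subseteq> vertex_pairs n \<and> card E = m}"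
  then obtain E where "G = Graph {1..n} E" "E \<subseteq> vertex_pairs n" "card E = m" by blast
  then show "G \<in> gnm n m" by (auto simp: gnm_def simple_graph_def vertex_pairs_def)
qed

lemma finite_gnm: "finite (gnm n m)"
  unfolding gnm_eq by (intro finite_imageI finite_subset[OF _ finite_Pow_iff[THEN iffD2, OF finite_vertex_pairs]]) auto

lemma card_gnm: "card (gnm n m) = (n choose 2) choose m"
proof -
  have "inj_on (Graph {1..n}) {E. E \<subseteq> vertex_pairs n \<and> card E = m}" by (auto simp: inj_on_def)
  then have "card (gnm n m) = card {E. E \<subseteq> vertex_pairs n \<and> card E = m}" unfolding gnm_eq by (rule card_image)
  then show ?thesis using n_subsets[OF finite_vertex_pairs] card_vertex_pairs by simp
qed

text \<open>First moment by double counting. An injective map sends distinct edges of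
  \<open>H\<close> to distinct pairs, so it is a homomorphism into the random graph with probability
  at most (m/N)^|E(H)|, where N = n choose 2; there are at most n^|V(H)| such maps.\<close>

lemma sum_inj_homs_gnm_le:
  assumes H: "simple_graph H" and m: "card (edges H) \<le> m" "m \<le> n choose 2"
  shows "(\<Sum>G\<in>gnm n m. card (inj_homs H G)) * (n choose 2) ^ card (edges H)
    \<le> card (gnm n m) * m ^ card (edges H) * n ^ card (verts H)"
proof -
  define PE where "PE = {E. E \<subseteq> vertex_pairs n \<and> card E = m}"
  define F where "F = {f \<in> verts H \<rightarrow>\<^sub>E {1..n}. inj_on f (verts H)}"
  define img where "img f = (\<lambda>e. f ` e) ` edges H" for f :: "'a \<Rightarrow> nat"
  define s where "s = card (edges H)"
  have finH: "finite (verts H)" using H by (simp add: simple_graph_def)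
  have finE: "finite (edges H)" by (rule sum_adj_eq_edges(1)[OF H])
  have finF: "finite F" unfolding F_def using finH by (auto intro!: finite_PiE)
  have finPE: "finite PE" unfolding PE_def
    by (rule finite_subset[of _ "Pow (vertex_pairs n)"]) (auto simp: finite_vertex_pairs)
  have e2: "\<exists>u v. e = {u, v} \<and> u \<noteq> v \<and> u \<in> verts H \<and> v \<in> verts H" if "e \<in> edges H" for e
    using that H unfolding simple_graph_def by (metis card_2_iff insert_subset)
  have homs: "inj_homs H (Graph {1..n} E) = {f \<in> F. img f \<subseteq> E}" for E
  proof -
    have "(\<forall>u\<in>verts H. \<forall>v\<in>verts H. {u, v} \<in> edges H \<longrightarrow> {f u, f v} \<in> E) \<longleftrightarrow> img f \<subseteq> E" for f
    proof
      assume a: "\<forall>u\<in>verts H. \<forall>v\<in>verts H. {u, v} \<in> edges H \<longrightarrow> {f u, f v} \<in> E"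
      show "img f \<subseteq> E"
      proof
        fix e' assume "e' \<in> img f"
        then obtain e where e: "e \<in> edges H" "e' = f ` e" by (auto simp: img_def)
        then obtain u v where "e = {u, v}" "u \<in> verts H" "v \<in> verts H" using e2 by blast
        then show "e' \<in> E" using a e by auto
      qed
    next
      assume "img f \<subseteq> E"
      then have "f ` e \<in> E" if "e \<in> edges H" for e using that by (auto simp: img_def)
      then show "\<forall>u\<in>verts H. \<forall>v\<in>verts H. {u, v} \<in> edges H \<longrightarrow> {f u, f v} \<in> E"
      proof (intro ballI impI)
        fix u v assume "{u, v} \<in> edges H"
        then show "{f u, f v} \<in> E" using \<open>\<And>e. e \<in> edges H \<Longrightarrow> f ` e \<in> E\<close>[of "{u, v}"] by simp
      qed
    qed
    then show ?thesis by (auto simp: inj_homs_def F_def)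
  qed
  have img: "img f \<subseteq> vertex_pairs n" "card (img f) = s" if f: "f \<in> F" for f
  proof -
    have inj: "inj_on f (verts H)" and fV: "\<And>v. v \<in> verts H \<Longrightarrow> f v \<in> {1..n}"
      using f by (auto simp: F_def)
    show "img f \<subseteq> vertex_pairs n"
    proof
      fix e' assume "e' \<in> img f"
      then obtain e where e: "e \<in> edges H" "e' = f ` e" by (auto simp: img_def)
      then obtain u v where uv: "e = {u, v}" "u \<noteq> v" "u \<in> verts H" "v \<in> verts H" using e2 by blast
      then have "f u \<noteq> f v" using inj by (auto dest: inj_onD)
      then show "e' \<in> vertex_pairs n" using e uv fV[of u] fV[of v] by (auto simp: vertex_pairs_def)
    qed
    have "edges H \<subseteq> Pow (verts H)" using H by (auto simp: simple_graph_def)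
    then have "inj_on (\<lambda>e. f ` e) (edges H)" using inj_on_image_Pow[OF inj] inj_on_subset by blast
    then show "card (img f) = s" unfolding img_def s_def by (rule card_image)
  qed
  have "(\<Sum>G\<in>gnm n m. card (inj_homs H G)) = (\<Sum>E\<in>PE. card {f \<in> F. img f \<subseteq> E})"
  proof -
    have inj: "inj_on (Graph {1..n}) PE" by (auto simp: inj_on_def)
    show ?thesis unfolding gnm_eq PE_def[symmetric] sum.reindex[OF inj] o_def homs ..
  qed
  also have "\<dots> = (\<Sum>f\<in>F. card {E \<in> PE. img f \<subseteq> E})"
  proof -
    have "(\<Sum>E\<in>PE. card {f \<in> F. img f \<subseteq> E}) = (\<Sum>E\<in>PE. \<Sum>f\<in>F. if img f \<subseteq> E then 1 else 0)"
      using finF by (simp add: sum.inter_filter[symmetric])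
    also have "\<dots> = (\<Sum>f\<in>F. \<Sum>E\<in>PE. if img f \<subseteq> E then 1 else 0)" by (rule sum.swap)
    also have "\<dots> = (\<Sum>f\<in>F. card {E \<in> PE. img f \<subseteq> E})"
      using finPE by (simp add: sum.inter_filter[symmetric])
    finally show ?thesis .
  qed
  also have "\<dots> = (\<Sum>f\<in>F. ((n choose 2) - s) choose (m - s))"
  proof (intro sum.cong refl)
    fix f assume f: "f \<in> F"
    have "{E \<in> PE. img f \<subseteq> E} = {E. E \<subseteq> vertex_pairs n \<and> card E = m \<and> img f \<subseteq> E}" by (auto simp: PE_def)
    then show "card {E \<in> PE. img f \<subseteq> E} = ((n choose 2) - s) choose (m - s)"
      using card_supersets_of_size[OF finite_vertex_pairs img(1)[OF f], of m] img(2)[OF f] m(1)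
      by (simp add: card_vertex_pairs s_def)
  qed
  also have "\<dots> = card F * (((n choose 2) - s) choose (m - s))" by simp
  finally have "(\<Sum>G\<in>gnm n m. card (inj_homs H G)) * (n choose 2) ^ s
      = card F * ((((n choose 2) - s) choose (m - s)) * (n choose 2) ^ s)" by simp
  also have "\<dots> \<le> n ^ card (verts H) * (((n choose 2) choose m) * m ^ s)"
  proof (rule mult_mono)
    have "card F \<le> card (verts H \<rightarrow>\<^sub>E {1..n})"
      unfolding F_def using finH by (intro card_mono finite_PiE) auto
    then show "card F \<le> n ^ card (verts H)" using finH by (simp add: card_funcsetE)
    show "(((n choose 2) - s) choose (m - s)) * (n choose 2) ^ s \<le> ((n choose 2) choose m) * m ^ s"
      using m by (intro binomial_ratio_le) (auto simp: s_def)
  qed auto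
  finally show ?thesis by (simp add: s_def card_gnm mult_ac)
qed

section \<open>Average degree, number of copies and concentration\<close>

lemma graph_radius_ge_average_degree:
  fixes G :: "'a::linorder graph"
  assumes "simple_graph G" "verts G \<noteq> {}"
  shows "graph_radius G * real (card (verts G)) \<ge> 2 * real (card (edges G))"
  using graph_radius_rayleigh[OF assms, of "\<lambda>_. 1"] sum_adj_eq_edges(2)[OF assms(1)]
  by (simp add: bform_def)

lemma num_copies_complete_bipartite:
  assumes "t \<ge> 1"
  shows "num_copies (complete_bipartite t t) G
    = real (card (inj_homs (complete_bipartite t t) G)) / (2 * (fact t)\<^sup>2)"
  unfolding num_copies_def card_automorphisms_complete_bipartite[OF assms] by simp

lemma num_copies_supersaturation:
  fixes \<epsilon> :: real
  assumes t: "t \<ge> 2" and \<epsilon>: "\<epsilon> > 0"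
  obtains m0 where "\<And>m (G :: 'a::linorder graph). m \<ge> m0 \<Longrightarrow> simple_graph G \<Longrightarrow> card (edges G) = m \<Longrightarrow>
    graph_radius G > graph_radius (split_graph (t - 1) m) \<Longrightarrow>
    num_copies (complete_bipartite t t) G \<ge> (1 / 2 ^ (t - 1)\<^sup>2 / (fact t)\<^sup>2 - \<epsilon>) * real m ^ t"
proof -
  define a where "a = (2 * (fact t)\<^sup>2 :: real)"
  have a: "a > 0" by (simp add: a_def)
  obtain m0 where m0: "\<And>m (G :: 'a graph). m \<ge> m0 \<Longrightarrow> simple_graph G \<Longrightarrow> card (edges G) = m \<Longrightarrow>
    graph_radius G > graph_radius (split_graph (t - 1) m) \<Longrightarrow>
    real (card (biclique_pairs t G)) \<ge> (2 / 2 ^ (t - 1)\<^sup>2 - a * \<epsilon>) * real m ^ t"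
    by (rule biclique_pairs_supersaturation[OF t, of "a * \<epsilon>", where 'a = 'a]) (use a \<epsilon> in auto)
  show thesis
  proof (rule that[of m0])
    fix m and G :: "'a graph"
    assume G: "m \<ge> m0" "simple_graph G" "card (edges G) = m"
      "graph_radius G > graph_radius (split_graph (t - 1) m)"
    have "(2 / 2 ^ (t - 1)\<^sup>2 - a * \<epsilon>) * real m ^ t \<le> real (card (inj_homs (complete_bipartite t t) G))"
      using m0[OF G] card_biclique_pairs_le[OF G(2), of t] by linarith
    then have "(2 / 2 ^ (t - 1)\<^sup>2 - a * \<epsilon>) * real m ^ t / a \<le> num_copies (complete_bipartite t t) G"
      using a t by (simp add: num_copies_complete_bipartite a_def divide_right_mono)
    also have "(2 / 2 ^ (t - 1)\<^sup>2 - a * \<epsilon>) * real m ^ t / a = (2 / 2 ^ (t - 1)\<^sup>2 / a - \<epsilon>) * real m ^ t"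
      using a by (simp add: field_simps)
    also have "2 / 2 ^ (t - 1)\<^sup>2 / a = 1 / 2 ^ (t - 1)\<^sup>2 / (fact t)\<^sup>2" by (simp add: a_def)
    finally show "num_copies (complete_bipartite t t) G \<ge> (1 / 2 ^ (t - 1)\<^sup>2 / (fact t)\<^sup>2 - \<epsilon>) * real m ^ t" .
  qed
qed

text \<open>Markov's inequality for the nonnegative variable Y - (c - \<delta>) M, whose mean is at
  most 2 \<delta> M. The pointwise lower bound takes the place of a second moment.\<close>

lemma fraction_exceeding_le:
  fixes Y :: "'a \<Rightarrow> real"
  assumes S: "finite S" "S \<noteq> {}" and M: "M > 0" and \<delta>: "\<delta> \<ge> 0" and \<epsilon>: "\<epsilon> > 0"
    and low: "\<And>G. G \<in> S \<Longrightarrow> (c - \<delta>) * M \<le> Y G" and avg: "(\<Sum>G\<in>S. Y G) \<le> real (card S) * ((c + \<delta>) * M)"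
  shows "real (card {G \<in> S. Y G > (c + \<epsilon>) * M}) / real (card S) \<le> 2 * \<delta> / \<epsilon>"
proof -
  define B where "B = {G \<in> S. Y G > (c + \<epsilon>) * M}"
  have "real (card B) * (\<epsilon> * M) = (\<Sum>G\<in>B. \<epsilon> * M)" by simp
  also have "\<dots> \<le> (\<Sum>G\<in>B. Y G - (c - \<delta>) * M)"
  proof (intro sum_mono)
    fix G assume "G \<in> B"
    then have "(c + \<epsilon>) * M < Y G" by (simp add: B_def)
    moreover have "0 \<le> \<delta> * M" using \<delta> M by simp
    ultimately show "\<epsilon> * M \<le> Y G - (c - \<delta>) * M" by (simp add: algebra_simps)
  qed
  also have "\<dots> \<le> (\<Sum>G\<in>S. Y G - (c - \<delta>) * M)"
    using S low by (intro sum_mono2) (auto simp: B_def)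
  also have "\<dots> \<le> real (card S) * (2 * \<delta> * M)" using avg by (simp add: sum_subtractf algebra_simps)
  finally have "(real (card B) * \<epsilon>) * M \<le> (real (card S) * (2 * \<delta>)) * M" by (simp add: mult_ac)
  then have "real (card B) * \<epsilon> \<le> real (card S) * (2 * \<delta>)" using M by simp
  moreover have "real (card S) > 0" using S by (simp add: card_gt_0_iff)
  ultimately show ?thesis using \<epsilon> by (simp add: B_def field_simps)
qed

text \<open>The number of vertices is a little below \<open>2 sqrt m\<close>, so that the average degree alone already
  exceeds the spectral radius of the split graph.\<close>

definition vertex_number :: "nat \<Rightarrow> nat \<Rightarrow> nat" where
  "vertex_number t m = nat \<lfloor>2 * sqrt (real m)\<rfloor> - 4 * t"

lemma vertex_number_bounds:
  assumes "sqrt (real m) \<ge> 8 * real t + 4"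
  shows "real (vertex_number t m) \<le> 2 * sqrt (real m) - 4 * real t"
    and "real (vertex_number t m) \<ge> 2 * sqrt (real m) - 4 * real t - 1"
    and "m \<le> vertex_number t m choose 2"
proof -
  define r where "r = sqrt (real m)"
  have r: "r \<ge> 8 * real t + 4" using assms by (simp add: r_def)
  have "\<lfloor>2 * r\<rfloor> \<ge> 4 * int t" using r by (simp add: le_floor_iff)
  then have "real (vertex_number t m) = real_of_int \<lfloor>2 * r\<rfloor> - 4 * real t"
    by (simp add: vertex_number_def r_def[symmetric] of_nat_diff nat_le_eq_zle le_nat_iff)
  then show 1: "real (vertex_number t m) \<le> 2 * sqrt (real m) - 4 * real t"
    "real (vertex_number t m) \<ge> 2 * sqrt (real m) - 4 * real t - 1"
    unfolding r_def[symmetric] by linarith+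
  \<comment> \<open>The threshold 8t + 4 gives r/2 >= 4t + 2. Consequently n (n - 1)/2 >= 9/8 m, and
    graphs with \<open>m\<close> edges exist on these vertices.\<close>
  have "3 / 2 * r \<le> real (vertex_number t m) - 1" using 1(2) r by (simp add: r_def)
  then have "(3 / 2 * r) * (3 / 2 * r) \<le> real (vertex_number t m) * (real (vertex_number t m) - 1)"
    using r by (intro mult_mono) auto
  moreover have "r * r = real m" by (simp add: r_def)
  then have "(3 / 2 * r) * (3 / 2 * r) = 9 / 4 * real m" by simp
  ultimately have "real m \<le> real (vertex_number t m choose 2)"
    unfolding real_choose_two by simp
  then show "m \<le> vertex_number t m choose 2" by simp
qed

lemma eventually_sqrt_ge: "\<forall>\<^sub>F m in sequentially. sqrt (real m) \<ge> C"
  using filterlim_compose[OF sqrt_at_top filterlim_real_sequentially]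
  by (simp add: filterlim_at_top)

lemma gnm_graph_radius_gt:
  assumes t: "t \<ge> 2" and m: "sqrt (real m) \<ge> 8 * real t + 4" and G: "G \<in> gnm (vertex_number t m) m"
  shows "graph_radius G > graph_radius (split_graph (t - 1) m)"
proof -
  define r where "r = sqrt (real m)"
  have r: "r \<ge> 8 * real t + 4" "r * r = real m" using m by (simp_all add: r_def)
  have SG: "simple_graph G" "card (verts G) = vertex_number t m" "card (edges G) = m"
    using G by (auto simp: gnm_def)
  have n: "real (vertex_number t m) \<le> 2 * r - 4 * real t" "real (vertex_number t m) > 0"
    using vertex_number_bounds(1,2)[OF m] r by (auto simp: r_def)
  have ne: "verts G \<noteq> {}" using SG(2) n(2) by auto
  have "graph_radius G * (2 * r - 4 * real t) \<ge> graph_radius G * real (vertex_number t m)"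
    using n graph_radius_nonneg[OF SG(1) ne] by (intro mult_left_mono) auto
  then have "graph_radius G * (2 * r - 4 * real t) \<ge> 2 * real m"
    using graph_radius_ge_average_degree[OF SG(1) ne] SG by simp
  then have avg: "graph_radius G * (r - 2 * real t) \<ge> real m" by (simp add: algebra_simps)
  \<comment> \<open>The left side is m - 4 t^2. So the average degree is above r + 2t for every
    graph considered, while the radius of the split graph is at most r + t - 1.\<close>
  have "(r + 2 * real t) * (r - 2 * real t) < real m"
    using t r by (simp add: algebra_simps)
  then have "(r + 2 * real t) * (r - 2 * real t) < graph_radius G * (r - 2 * real t)" using avg by simp
  then have "r + 2 * real t < graph_radius G" using r by (simp add: mult_less_cancel_right)
  moreover have "graph_radius (split_graph (t - 1) m) \<le> r + real (t - 1)"
    unfolding r_def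
  proof (rule split_graph_radius_upper)
    have "t - 1 choose 2 \<le> (t - 1)\<^sup>2" by (cases "t - 1") (auto simp: choose_two power2_eq_square)
    also have "\<dots> \<le> m"
    proof -
      have "real t * real t \<le> r * r" using r by (intro mult_mono) auto
      then have "real ((t - 1)\<^sup>2) \<le> real m"
        using r(2) mult_mono[of "real (t - 1)" "real t" "real (t - 1)" "real t"] by (simp add: power2_eq_square)
      then show ?thesis by (simp only: of_nat_le_iff)
    qed
    finally show "t - 1 choose 2 \<le> m" .
  qed (use t in auto)
  ultimately show ?thesis using t by simp
qed

lemma tendsto_vertex_number: "(\<lambda>m. real (vertex_number t m) / sqrt (real m)) \<longlonglongrightarrow> 2"
proof (rule tendsto_sandwich)
  have *: "(\<lambda>m. (4 * real t + 1) / sqrt (real m)) \<longlonglongrightarrow> 0"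
    by (rule tendsto_divide_0[OF tendsto_const
        filterlim_at_top_imp_at_infinity[OF filterlim_compose[OF sqrt_at_top filterlim_real_sequentially]]])
  show "(\<lambda>m. 2 - (4 * real t + 1) / sqrt (real m)) \<longlonglongrightarrow> 2" using tendsto_diff[OF tendsto_const[of 2] *] by simp
  show "(\<lambda>m. 2) \<longlonglongrightarrow> (2::real)" by simp
  show "\<forall>\<^sub>F m in sequentially. 2 - (4 * real t + 1) / sqrt (real m) \<le> real (vertex_number t m) / sqrt (real m)"
    using eventually_sqrt_ge[of "8 * real t + 4"]
  proof eventually_elim
    case (elim m)
    then have "sqrt (real m) > 0" by linarith
    then have 1: "2 - (4 * real t + 1) / sqrt (real m) = (2 * sqrt (real m) - 4 * real t - 1) / sqrt (real m)"
      by (simp add: diff_divide_distrib add_divide_distrib)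
    show ?case unfolding 1 using vertex_number_bounds(2)[OF elim] by (rule divide_right_mono) simp
  qed
  show "\<forall>\<^sub>F m in sequentially. real (vertex_number t m) / sqrt (real m) \<le> 2"
    using eventually_sqrt_ge[of "8 * real t + 4"]
  proof eventually_elim
    case (elim m)
    then have "sqrt (real m) > 0" by linarith
    then show ?case using vertex_number_bounds(1)[OF elim] by (simp add: field_simps)
  qed
qed

text \<open>With n about 2 sqrt m the edge density m/N tends to 1/2, so the first moment bound
  divided by 2 (t!)^2 m^t tends to 2^(2t - t^2 - 1)/(t!)^2, and 2t - t^2 - 1 = -(t - 1)^2.\<close>

lemma gnm_average_copies:
  fixes \<delta> :: real
  assumes t: "t \<ge> 2" and \<delta>: "\<delta> > 0"
  shows "\<forall>\<^sub>F m in sequentially. (\<Sum>G\<in>gnm (vertex_number t m) m. num_copies (complete_bipartite t t) G)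
    \<le> real (card (gnm (vertex_number t m) m)) * ((1 / 2 ^ (t - 1)\<^sup>2 / (fact t)\<^sup>2 + \<delta>) * real m ^ t)"
proof -
  define \<nu> where "\<nu> m = real (vertex_number t m) / sqrt (real m)" for m
  define N where "N m = real (vertex_number t m choose 2)" for m
  define a where "a = (2 * (fact t)\<^sup>2 :: real)"
  have a: "a > 0" by (simp add: a_def)
  have \<nu>: "\<nu> \<longlonglongrightarrow> 2" unfolding \<nu>_def by (rule tendsto_vertex_number)
  have inv: "(\<lambda>m. 1 / sqrt (real m)) \<longlonglongrightarrow> 0"
    by (rule tendsto_divide_0[OF tendsto_const
        filterlim_at_top_imp_at_infinity[OF filterlim_compose[OF sqrt_at_top filterlim_real_sequentially]]])
  have "(\<lambda>m. 2 / (\<nu> m * (\<nu> m - 1 / sqrt (real m)))) \<longlonglongrightarrow> 2 / (2 * (2 - 0))"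
    by (intro tendsto_intros \<nu> inv) auto
  moreover have "\<forall>\<^sub>F m in sequentially. 2 / (\<nu> m * (\<nu> m - 1 / sqrt (real m))) = real m / N m"
    using eventually_gt_at_top[of 0]
  proof eventually_elim
    case (elim m)
    define r where "r = sqrt (real m)"
    have r: "r > 0" "real m = r * r" using elim by (simp_all add: r_def)
    have "\<nu> m * (\<nu> m - 1 / r) = real (vertex_number t m) * (real (vertex_number t m) - 1) / real m"
      using r by (simp add: \<nu>_def r_def[symmetric] field_simps)
    then show ?case unfolding r_def[symmetric] N_def real_choose_two by simp
  qed
  ultimately have lim_mN: "(\<lambda>m. real m / N m) \<longlonglongrightarrow> 2 / (2 * (2 - 0))" by (rule Lim_transform_eventually)
  have "(\<lambda>m. \<nu> m ^ (2 * t) * (real m / N m) ^ t\<^sup>2 / a) \<longlonglongrightarrow> 2 ^ (2 * t) * (2 / (2 * (2 - 0))) ^ t\<^sup>2 / a"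
    using a by (intro tendsto_divide tendsto_mult tendsto_power tendsto_const \<nu> lim_mN) auto
  also have "2 ^ (2 * t) * (2 / (2 * (2 - 0))) ^ t\<^sup>2 / a = 1 / 2 ^ (t - 1)\<^sup>2 / (fact t)\<^sup>2"
  proof -
    obtain j where j: "t = Suc j" using t by (cases t) auto
    have "(2::real) ^ (2 * t) * 2 ^ (t - 1)\<^sup>2 = 2 * 2 ^ t\<^sup>2"
      unfolding power_add[symmetric] power_Suc[symmetric] by (simp add: j power2_eq_square)
    then have "(2::real) ^ (2 * t) * (1 / 2) ^ t\<^sup>2 = 2 / 2 ^ (t - 1)\<^sup>2" by (simp add: field_simps power_divide)
    then show ?thesis by (simp add: a_def)
  qed
  finally have lim: "(\<lambda>m. \<nu> m ^ (2 * t) * (real m / N m) ^ t\<^sup>2 / a) \<longlonglongrightarrow> 1 / 2 ^ (t - 1)\<^sup>2 / (fact t)\<^sup>2" .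
  have "\<forall>\<^sub>F m in sequentially. \<nu> m ^ (2 * t) * (real m / N m) ^ t\<^sup>2 / a < 1 / 2 ^ (t - 1)\<^sup>2 / (fact t)\<^sup>2 + \<delta>"
    by (rule order_tendstoD(2)[OF lim]) (use \<delta> in simp)
  then show ?thesis
    using eventually_sqrt_ge[of "8 * real t + 4"] eventually_ge_at_top[of "t\<^sup>2 + 1"]
  proof eventually_elim
    case (elim m)
    define n s S where "n = vertex_number t m" and "s = t\<^sup>2" and "S = gnm n m"
    define X where "X G = card (inj_homs (complete_bipartite t t) G)" for G :: "nat graph"
    have mN: "m \<le> n choose 2" using vertex_number_bounds(3)[OF elim(2)] by (simp add: n_def)
    have mpos: "m > 0" using elim(3) by simp
    have "(n choose 2) > 0" using mN mpos by linarith
    then have N0: "N m > 0" by (simp only: N_def n_def of_nat_0_less_iff)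
    have card_verts: "card (verts (complete_bipartite t t)) = 2 * t" by (simp add: complete_bipartite_def)
    have "(\<Sum>G\<in>S. X G) * (n choose 2) ^ s \<le> card S * m ^ s * n ^ (2 * t)"
      using sum_inj_homs_gnm_le[OF simple_complete_bipartite, of t m n] elim(3) mN
        card_verts by (simp add: card_edges_complete_bipartite S_def X_def s_def)
    then have "real ((\<Sum>G\<in>S. X G) * (n choose 2) ^ s) \<le> real (card S * m ^ s * n ^ (2 * t))"
      by (simp only: of_nat_le_iff)
    then have "(\<Sum>G\<in>S. real (X G)) * N m ^ s \<le> real (card S) * real m ^ s * real n ^ (2 * t)"
      by (simp add: N_def n_def)
    then have "(\<Sum>G\<in>S. real (X G)) \<le> real (card S) * real m ^ s * real n ^ (2 * t) / N m ^ s"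
      using N0 by (simp add: pos_le_divide_eq)
    also have "\<dots> = real (card S) * (\<nu> m ^ (2 * t) * (real m / N m) ^ s * real m ^ t)"
    proof -
      have "real n ^ (2 * t) = \<nu> m ^ (2 * t) * real m ^ t"
        using mpos by (simp add: \<nu>_def n_def power_divide power_mult)
      then show ?thesis by (simp add: power_divide)
    qed
    finally have 1: "(\<Sum>G\<in>S. real (X G)) \<le> real (card S) * (\<nu> m ^ (2 * t) * (real m / N m) ^ s * real m ^ t)" .
    have "(\<Sum>G\<in>S. num_copies (complete_bipartite t t) G) = (\<Sum>G\<in>S. real (X G)) / a"
      using t by (simp add: num_copies_complete_bipartite X_def a_def sum_divide_distrib)
    also have "\<dots> \<le> real (card S) * (\<nu> m ^ (2 * t) * (real m / N m) ^ s * real m ^ t) / a"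
      using 1 a by (intro divide_right_mono) auto
    also have "\<dots> = real (card S) * ((\<nu> m ^ (2 * t) * (real m / N m) ^ s / a) * real m ^ t)" by simp
    also have "\<dots> \<le> real (card S) * ((1 / 2 ^ (t - 1)\<^sup>2 / (fact t)\<^sup>2 + \<delta>) * real m ^ t)"
      using elim(1) by (intro mult_left_mono mult_right_mono) (auto simp: s_def)
    finally show ?case by (simp add: S_def n_def)
  qed
qed

text \<open>For large \<open>m\<close> the spectral condition holds on the whole sample space, so
  only the count is random; supersaturation bounds it below everywhere, and the average then
  controls its upper tail.\<close>

lemma gnm_prob_tendsto_1:
  fixes \<epsilon> :: real
  assumes t: "t \<ge> 2" and \<epsilon>: "\<epsilon> > 0" and c: "c = 1 / 2 ^ (t - 1)\<^sup>2 / (fact t)\<^sup>2"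
  shows "(\<lambda>m. measure_pmf.prob (uniform_graph (vertex_number t m) m)
      {G. graph_radius G > graph_radius (split_graph (t - 1) m) \<and>
          num_copies (complete_bipartite t t) G \<le> (c + \<epsilon>) * real m ^ t}) \<longlonglongrightarrow> 1"
    (is "?p \<longlonglongrightarrow> 1")
proof (rule tendstoI)
  fix \<eta> :: real assume \<eta>: "\<eta> > 0"
  \<comment> \<open>Makes the exceptional fraction 2 \<delta>/\<epsilon> equal to \<eta>/2.\<close>
  define \<delta> where "\<delta> = \<epsilon> * \<eta> / 4"
  have \<delta>: "\<delta> > 0" using \<epsilon> \<eta> by (simp add: \<delta>_def)
  obtain m0 where m0: "\<And>m (G :: nat graph). m \<ge> m0 \<Longrightarrow> simple_graph G \<Longrightarrow> card (edges G) = m \<Longrightarrow>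
    graph_radius G > graph_radius (split_graph (t - 1) m) \<Longrightarrow>
    num_copies (complete_bipartite t t) G \<ge> (1 / 2 ^ (t - 1)\<^sup>2 / (fact t)\<^sup>2 - \<delta>) * real m ^ t"
    by (rule num_copies_supersaturation[OF t \<delta>, where 'a = nat]) (rule that; assumption)
  show "\<forall>\<^sub>F m in sequentially. dist (?p m) 1 < \<eta>"
    using eventually_ge_at_top[of m0] eventually_gt_at_top[of 0] eventually_sqrt_ge[of "8 * real t + 4"]
      gnm_average_copies[OF t \<delta>]
  proof eventually_elim
    case (elim m)
    define S where "S = gnm (vertex_number t m) m"
    define Y where "Y G = num_copies (complete_bipartite t t) G" for G :: "nat graph"
    have finS: "finite S" by (simp add: S_def finite_gnm)
    \<comment> \<open>The sample space must be nonempty for \<open>pmf_of_set\<close> to be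
      specified.\<close>
    have cS: "card S > 0"
      using vertex_number_bounds(3)[OF elim(3)] by (simp add: S_def card_gnm zero_less_binomial_iff)
    then have neS: "S \<noteq> {}" by auto
    have rad: "graph_radius G > graph_radius (split_graph (t - 1) m)" if "G \<in> S" for G
      using gnm_graph_radius_gt[OF t elim(3)] that by (simp add: S_def)
    have low: "(c - \<delta>) * real m ^ t \<le> Y G" if "G \<in> S" for G
      unfolding Y_def c by (rule m0[OF elim(1) _ _ rad[OF that]]) (use that in \<open>auto simp: S_def gnm_def\<close>)
    define B where "B = {G \<in> S. Y G > (c + \<epsilon>) * real m ^ t}"
    have frac: "real (card B) / real (card S) \<le> 2 * \<delta> / \<epsilon>"
      unfolding B_def by (rule fraction_exceeding_le[OF finS neS _ _ \<epsilon> low])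
        (use elim(2,4) \<delta> in \<open>auto simp: S_def Y_def c\<close>)
    have "?p m = real (card (S - B)) / real (card S)"
    proof -
      have "S \<inter> {G. graph_radius G > graph_radius (split_graph (t - 1) m) \<and>
          num_copies (complete_bipartite t t) G \<le> (c + \<epsilon>) * real m ^ t} = S - B"
        using rad by (auto simp: B_def Y_def)
      then show ?thesis
        unfolding uniform_graph_def S_def[symmetric] using measure_pmf_of_set[OF neS finS] by simp
    qed
    also have "\<dots> = 1 - real (card B) / real (card S)"
    proof -
      have "B \<subseteq> S" by (auto simp: B_def)
      then have "real (card (S - B)) = real (card S) - real (card B)"
        using finS by (simp add: card_Diff_subset finite_subset card_mono of_nat_diff)
      then show ?thesis using cS by (simp add: diff_divide_distrib)
    qed
    finally have "dist (?p m) 1 = real (card B) / real (card S)" by (simp add: dist_real_def)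
    also have "\<dots> \<le> \<eta> / 2" using frac \<epsilon> by (simp add: \<delta>_def)
    also have "\<dots> < \<eta>" using \<eta> by simp
    finally show ?case .
  qed
qed

theorem theorem1p5:
  fixes t :: nat and c :: real
  assumes "t \<ge> 2"
    and "c = 2 powi (- ((int t - 1)\<^sup>2)) / (fact t)\<^sup>2"
  shows "(\<forall>\<epsilon>::real. \<epsilon> > 0 \<longrightarrow> (\<exists>m\<^sub>0::nat. \<forall>m \<ge> m\<^sub>0. \<forall>G :: nat graph.
            simple_graph G \<longrightarrow> card (edges G) = m \<longrightarrow>
            graph_radius G > graph_radius (split_graph (t - 1) m) \<longrightarrow>
            num_copies (complete_bipartite t t) G \<ge> (c - \<epsilon>) * real m ^ t))
       \<and> (\<forall>c'::real. c' > c \<longrightarrow> \<not> (\<forall>\<epsilon>::real. \<epsilon> > 0 \<longrightarrow> (\<exists>m\<^sub>0::nat. \<forall>m \<ge> m\<^sub>0. \<forall>G :: nat graph.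
            simple_graph G \<longrightarrow> card (edges G) = m \<longrightarrow>
            graph_radius G > graph_radius (split_graph (t - 1) m) \<longrightarrow>
            num_copies (complete_bipartite t t) G \<ge> (c' - \<epsilon>) * real m ^ t)))
       \<and> (\<exists>n :: nat \<Rightarrow> nat.
            (\<lambda>m. real (n m) / sqrt (real m)) \<longlonglongrightarrow> 2 \<and>
            (\<forall>\<epsilon>::real. \<epsilon> > 0 \<longrightarrow>
              (\<lambda>m. measure_pmf.prob (uniform_graph (n m) m)
                 {G. graph_radius G > graph_radius (split_graph (t - 1) m) \<and>
                     num_copies (complete_bipartite t t) G \<le> (c + \<epsilon>) * real m ^ t})
              \<longlonglongrightarrow> 1))"
proof -
  note t = assms(1)
  \<comment> \<open>Integer exponents of the statement become natural ones; \<open>t - 1\<close> is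
    not truncated as t >= 2.\<close>
  have c: "c = 1 / 2 ^ (t - 1)\<^sup>2 / (fact t)\<^sup>2"
  proof -
    have "(int t - 1)\<^sup>2 = int ((t - 1)\<^sup>2)" using t by (simp add: of_nat_diff)
    then show ?thesis unfolding assms(2) by (simp only: power_int_minus power_int_of_nat inverse_eq_divide)
  qed
  have lower: "\<exists>m\<^sub>0::nat. \<forall>m \<ge> m\<^sub>0. \<forall>G :: nat graph.
      simple_graph G \<longrightarrow> card (edges G) = m \<longrightarrow>
      graph_radius G > graph_radius (split_graph (t - 1) m) \<longrightarrow>
      num_copies (complete_bipartite t t) G \<ge> (c - \<epsilon>) * real m ^ t" if "\<epsilon> > 0" for \<epsilon> :: real
    using num_copies_supersaturation[OF t that, where 'a = nat] unfolding c by metis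
  have prob: "(\<lambda>m. measure_pmf.prob (uniform_graph (vertex_number t m) m)
      {G. graph_radius G > graph_radius (split_graph (t - 1) m) \<and>
          num_copies (complete_bipartite t t) G \<le> (c + \<epsilon>) * real m ^ t}) \<longlonglongrightarrow> 1" if "\<epsilon> > 0" for \<epsilon> :: real
    by (rule gnm_prob_tendsto_1[OF t that c])
  \<comment> \<open>An event of positive probability contains an actual graph. With a third of the
    gap as \<open>\<epsilon>\<close>, its count contradicts the bound with the larger
    constant.\<close>
  have sharp: False if c': "c' > c" and bound: "\<And>\<epsilon>::real. \<epsilon> > 0 \<Longrightarrow> \<exists>m\<^sub>0::nat. \<forall>m \<ge> m\<^sub>0. \<forall>G :: nat graph.
      simple_graph G \<longrightarrow> card (edges G) = m \<longrightarrow>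
      graph_radius G > graph_radius (split_graph (t - 1) m) \<longrightarrow>
      num_copies (complete_bipartite t t) G \<ge> (c' - \<epsilon>) * real m ^ t" for c'
  proof -
    define \<epsilon> where "\<epsilon> = (c' - c) / 3"
    have \<epsilon>: "\<epsilon> > 0" "c + \<epsilon> < c' - \<epsilon>" using c' by (auto simp: \<epsilon>_def field_simps)
    obtain m0 where m0: "\<And>m (G :: nat graph). m \<ge> m0 \<Longrightarrow> simple_graph G \<Longrightarrow> card (edges G) = m \<Longrightarrow>
      graph_radius G > graph_radius (split_graph (t - 1) m) \<Longrightarrow>
      num_copies (complete_bipartite t t) G \<ge> (c' - \<epsilon>) * real m ^ t"
      using bound[OF \<epsilon>(1)] by blast
    define Ev where "Ev m = {G :: nat graph. graph_radius G > graph_radius (split_graph (t - 1) m) \<and>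
          num_copies (complete_bipartite t t) G \<le> (c + \<epsilon>) * real m ^ t}" for m
    have "\<forall>\<^sub>F m in sequentially. measure_pmf.prob (uniform_graph (vertex_number t m) m) (Ev m) > 0"
      unfolding Ev_def by (rule order_tendstoD(1)[OF prob[OF \<epsilon>(1)]]) simp
    then have "\<forall>\<^sub>F m in sequentially. measure_pmf.prob (uniform_graph (vertex_number t m) m) (Ev m) > 0
        \<and> m \<ge> m0 \<and> m > 0 \<and> sqrt (real m) \<ge> 8 * real t + 4"
      using eventually_ge_at_top[of m0] eventually_gt_at_top[of 0] eventually_sqrt_ge[of "8 * real t + 4"]
      by eventually_elim simp
    then obtain m where m: "measure_pmf.prob (uniform_graph (vertex_number t m) m) (Ev m) > 0"
        "m \<ge> m0" "m > 0" "sqrt (real m) \<ge> 8 * real t + 4"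
      unfolding eventually_sequentially by blast
    define S where "S = gnm (vertex_number t m) m"
    have "card S > 0"
      using vertex_number_bounds(3)[OF m(4)] by (simp add: S_def card_gnm zero_less_binomial_iff)
    then have S: "S \<noteq> {}" "finite S" by (auto simp: S_def finite_gnm)
    have "real (card (S \<inter> Ev m)) / real (card S) > 0"
      using m(1) measure_pmf_of_set[OF S] by (simp add: uniform_graph_def S_def)
    then have "S \<inter> Ev m \<noteq> {}" by auto
    then obtain G where "G \<in> S" "G \<in> Ev m" by blast
    then have G: "simple_graph G" "card (edges G) = m" "graph_radius G > graph_radius (split_graph (t - 1) m)"
        "num_copies (complete_bipartite t t) G \<le> (c + \<epsilon>) * real m ^ t"
      by (auto simp: S_def gnm_def Ev_def)
    have "(c' - \<epsilon>) * real m ^ t \<le> (c + \<epsilon>) * real m ^ t" using m0[OF m(2) G(1-3)] G(4) by linarith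
    then show False using \<epsilon>(2) m(3) by simp
  qed
  show ?thesis
    using lower sharp tendsto_vertex_number[of t] prob by blast
qed

end
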